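(* Let $X$ be a Banach space, fix $p>1$, and let $\mathcal W_X=\langle t\rangle^{-p}L^\infty_t\mathcal B(X)$, a Banach algebra under convolution in $t$ (composition in $\mathcal B(X)$), with unitization $\overline{\mathcal W}_X=\mathcal W_X\oplus\mathbb C\mathbb 1$, $\mathbb 1=\delta_{t=0}I$. Let $T\in\mathcal W_X$ satisfy, for some $N\ge1$, $$ \lim_{\delta\to0}\|T^N-T^N(\cdot-\delta)\|_{\mathcal W_X}=0, $$ where $T^N$ is the $N$-th convolution power. If $I+\widehat T(\lambda)$ is invertible in $\mathcal B(X)$ for every $\lambda\in\mathbb R$, then $\mathbb 1+T$ has an inverse in $\overline{\mathcal W}_X$ of the form $\mathbb 1+S$ with $S\in\mathcal W_X$.
   Context: $\langle t\rangle=(1+t^2)^{1/2}$. $\mathcal W_X$ consists of strongly measurable families $T(t)\in\mathcal B(X)$, $t\in\mathbb R$, with norm $\sup_t\langle t\rangle^p\|T(t)\|_{\mathcal B(X)}$; the product is $(T_1*T_2)(t)=\int_{\mathbb R}T_1(s)T_2(t-s)\,ds$. The Fourier transform is $\widehat T(\lambda)=\int_{\mathbb R}T(t)e^{-it\lambda}\,dt$, and $\widehat{\mathbb 1}=I$. *)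

theory Defs
  imports "HOL-Analysis.Analysis"
begin

class complex_banach = banach +
  fixes cscale :: "complex \<Rightarrow> 'a \<Rightarrow> 'a"
  assumes cscale_of_real: "cscale (of_real r) x = r *\<^sub>R x"
    and cscale_add_left: "cscale (a + b) x = cscale a x + cscale b x"
    and cscale_add_right: "cscale a (x + y) = cscale a x + cscale a y"
    and cscale_assoc: "cscale a (cscale b x) = cscale (a * b) x"
    and norm_cscale: "norm (cscale a x) = cmod a * norm x"

instantiation complex :: complex_banach
begin
definition cscale_complex :: "complex \<Rightarrow> complex \<Rightarrow> complex" where
  "cscale_complex a x = a * x"
instance
  by standard (auto simp: cscale_complex_def algebra_simps norm_mult scaleR_conv_of_real)
end

definition jbr :: "real \<Rightarrow> real" where
  "jbr t = sqrt (1 + t\<^sup>2)"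

definition bop :: "('a::complex_banach \<Rightarrow> 'a) \<Rightarrow> bool" where
  "bop A \<longleftrightarrow> bounded_linear A \<and> (\<forall>c x. A (cscale c x) = cscale c (A x))"

definition strongly_measurable :: "(real \<Rightarrow> 'a::complex_banach \<Rightarrow> 'a) \<Rightarrow> bool" where
  "strongly_measurable T \<longleftrightarrow>
     (\<forall>x. \<exists>u :: nat \<Rightarrow> real \<Rightarrow> 'a. (\<forall>i. simple_function lebesgue (u i)) \<and>
            (\<forall>t. (\<lambda>i. u i t) \<longlonglongrightarrow> T t x))"

definition in_W :: "real \<Rightarrow> (real \<Rightarrow> 'a::complex_banach \<Rightarrow> 'a) \<Rightarrow> bool" where
  "in_W p T \<longleftrightarrow> (\<forall>t. bop (T t)) \<and> strongly_measurable T \<and>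
     (\<exists>C. AE t in lebesgue. jbr t powr p * onorm (T t) \<le> C)"

definition conv :: "(real \<Rightarrow> 'a::complex_banach \<Rightarrow> 'a) \<Rightarrow> (real \<Rightarrow> 'a \<Rightarrow> 'a) \<Rightarrow> real \<Rightarrow> 'a \<Rightarrow> 'a" where
  "conv T1 T2 t x = integral UNIV (\<lambda>s. T1 s (T2 (t - s) x))"

text \<open>N-th convolution power, N \<ge> 1 (value at 0 is irrelevant).\<close>
fun conv_power :: "(real \<Rightarrow> 'a::complex_banach \<Rightarrow> 'a) \<Rightarrow> nat \<Rightarrow> real \<Rightarrow> 'a \<Rightarrow> 'a" where
  "conv_power T 0 = (\<lambda>t x. 0)"
| "conv_power T (Suc 0) = T"
| "conv_power T (Suc (Suc n)) = conv T (conv_power T (Suc n))"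

definition fourier :: "(real \<Rightarrow> 'a::complex_banach \<Rightarrow> 'a) \<Rightarrow> real \<Rightarrow> 'a \<Rightarrow> 'a" where
  "fourier T lam x = integral UNIV (\<lambda>t. cscale (exp (- \<i> * of_real (t * lam))) (T t x))"

definition invertible_bop :: "('a::complex_banach \<Rightarrow> 'a) \<Rightarrow> bool" where
  "invertible_bop A \<longleftrightarrow> bop A \<and> (\<exists>B. bop B \<and> (\<forall>x. B (A x) = x) \<and> (\<forall>x. A (B x) = x))"

end

theory Submission
  imports Defs
begin

text \<open>
  Convolution with \<open>T\<close> is a bounded operator \<open>A\<close> on the Banach space of bounded continuous functions
  with values in \<open>X\<close>, commuting with translations. To invert \<open>1 + A\<close>, fix a small step \<open>h\<close> and let \<open>t\<close> be
  the translation by \<open>h\<close>. Modulo the closed left ideal generated by \<open>1 + A\<close> we have \<open>1 = (-A)\<^sup>N\<close>, and since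
  \<open>T\<^sup>N\<close> is continuous under translations, translations by less than \<open>h\<close> are negligible there. Hence modulo
  \<open>t - exp (-ih\<lambda>)\<close> the operator \<open>A\<close> is close to the Fourier transform of \<open>T\<close> at \<open>\<lambda>\<close> if \<open>\<lambda>\<close> is bounded,
  whereas for large \<open>\<lambda>\<close> everything is negligible; in both cases \<open>1\<close> lies, up to a small error, in the ideal
  generated by \<open>1 + A\<close> and the central element \<open>t - exp (-ih\<lambda>)\<close>. So in the quotient by the ideal all these
  elements are surjective with uniform bounds, which is impossible for the isometry \<open>t\<close> unless the
  quotient is zero. This gives a left inverse, and right ideals give a right inverse. No decay of the
  Fourier transform, no partition of unity and no Fourier inversion is involved.

  Conjugation with the weight \<open>(1 + \<kappa>\<bar>t\<bar>)\<^sup>p\<close> changes \<open>A\<close> by little in operator norm if \<open>\<kappa>\<close> is small, so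
  \<open>1 + A\<close> is also invertible on the weighted space. Solving \<open>F + T * F = T * T\<close> there yields the
  inverse \<open>S = F - T\<close>.
\<close>

section \<open>Bounded operators as a normed algebra\<close>

text \<open>Two obstacles shape the proof. \<open>T\<close> is only strongly measurable and X may be
  non-separable, so \<open>T\<close> is not handled as a norm-measurable function into the operator
  algebra, and smallness of translations is given only for the N-th power. Every use of it therefore
  passes through the factor \<open>G = (- cop T) ^ N\<close>; this costs nothing, because
  \<open>1 - G\<close> is a multiple of \<open>1 + cop T\<close> from either side. Secondly,
  \<open>1 + cop T\<close> is in general not central, so its one-sided ideals give no quotient
  algebra. A quotient seminorm \<open>q\<close> takes its place, multiplied only by elements
  commuting with everything that commutes with translation and complex scalars. The clash between
  surjectivity and isometry is quantitative:
  \<open>q D \<le> 2 * C * q ((1 - m \<nu> * t) * D)\<close> for all unimodular \<nu> forces q 1 to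
  be at most 16 C^2 / n for every n. What matters is that C is the same for all \<nu>; it may grow
  as the step h shrinks, since h is fixed before C is formed. In the weighted step the condition p >
  1 reappears: the scaled weight has mass of order 1/\<kappa>, which a factor \<kappa>^p must
  beat.\<close>

text \<open>The class \<open>real_normed_algebra_1\<close> is out of reach, since \<open>1 = 0\<close> on the trivial space.\<close>

typedef (overloaded) 'b endo = "UNIV :: ('b::real_normed_vector \<Rightarrow>\<^sub>L 'b) set"
  morphisms endo_blinfun Endo by simp

setup_lifting type_definition_endo

instantiation endo :: (real_normed_vector) real_normed_vector
begin
lift_definition zero_endo :: "'a endo" is 0 .
lift_definition plus_endo :: "'a endo \<Rightarrow> 'a endo \<Rightarrow> 'a endo" is "(+)" .
lift_definition minus_endo :: "'a endo \<Rightarrow> 'a endo \<Rightarrow> 'a endo" is "(-)" .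
lift_definition uminus_endo :: "'a endo \<Rightarrow> 'a endo" is uminus .
lift_definition scaleR_endo :: "real \<Rightarrow> 'a endo \<Rightarrow> 'a endo" is scaleR .
lift_definition norm_endo :: "'a endo \<Rightarrow> real" is norm .
definition dist_endo :: "'a endo \<Rightarrow> 'a endo \<Rightarrow> real" where "dist_endo a b = norm (a - b)"
definition sgn_endo :: "'a endo \<Rightarrow> 'a endo" where "sgn_endo x = inverse (norm x) *\<^sub>R x"
definition [code del]:
  "(uniformity :: ('a endo \<times> 'a endo) filter) = (INF e\<in>{0 <..}. principal {(x, y). dist x y < e})"
definition open_endo :: "'a endo set \<Rightarrow> bool"
  where [code del]: "open_endo S = (\<forall>x\<in>S. \<forall>\<^sub>F (x', y) in uniformity. x' = x \<longrightarrow> y \<in> S)"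
instance
proof
  fix x y z :: "'a endo" and a b :: real and U :: "'a endo set"
  show "x + y + z = x + (y + z)" by transfer (rule add.assoc)
  show "x + y = y + x" by transfer (rule add.commute)
  show "0 + x = x" by transfer simp
  show "- x + x = 0" by transfer simp
  show "x - y = x + - y" by transfer simp
  show "a *\<^sub>R (x + y) = a *\<^sub>R x + a *\<^sub>R y" by transfer (rule scaleR_add_right)
  show "(a + b) *\<^sub>R x = a *\<^sub>R x + b *\<^sub>R x" by transfer (rule scaleR_add_left)
  show "a *\<^sub>R b *\<^sub>R x = (a * b) *\<^sub>R x" by transfer simp
  show "1 *\<^sub>R x = x" by transfer simp
  show "dist x y = norm (x - y)" by (rule dist_endo_def)
  show "sgn x = inverse (norm x) *\<^sub>R x" by (rule sgn_endo_def)
  show "(uniformity :: ('a endo \<times> 'a endo) filter) = (INF e\<in>{0 <..}. principal {(x, y). dist x y < e})"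
    by (rule uniformity_endo_def)
  show "open U = (\<forall>x\<in>U. \<forall>\<^sub>F (x', y) in uniformity. x' = x \<longrightarrow> y \<in> U)" by (rule open_endo_def)
  show "norm x = 0 \<longleftrightarrow> x = 0" by transfer simp
  show "norm (x + y) \<le> norm x + norm y" by transfer (rule norm_triangle_ineq)
  show "norm (a *\<^sub>R x) = \<bar>a\<bar> * norm x" by transfer simp
qed
end

instantiation endo :: (real_normed_vector) "{real_normed_algebra, monoid_mult}"
begin
lift_definition one_endo :: "'a endo" is id_blinfun .
lift_definition times_endo :: "'a endo \<Rightarrow> 'a endo \<Rightarrow> 'a endo" is blinfun_compose .
instance
proof
  fix x y z :: "'a endo" and r :: real
  show "x * y * z = x * (y * z)" by transfer (rule blinfun_eqI, simp)
  show "1 * x = x" by transfer (rule blinfun_eqI, simp)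
  show "x * 1 = x" by transfer (rule blinfun_eqI, simp)
  show "(x + y) * z = x * z + y * z" by transfer (rule blinfun_eqI, simp add: blinfun.add_left)
  show "x * (y + z) = x * y + x * z" by transfer (rule blinfun_eqI, simp add: blinfun.add_left blinfun.add_right)
  show "r *\<^sub>R x * y = r *\<^sub>R (x * y)" by transfer (rule blinfun_eqI, simp add: blinfun.scaleR_left)
  show "x * r *\<^sub>R y = r *\<^sub>R (x * y)"
    by transfer (rule blinfun_eqI, simp add: blinfun.scaleR_left blinfun.scaleR_right)
  show "norm (x * y) \<le> norm x * norm y" by transfer (rule norm_blinfun_compose)
qed
end

instance endo :: (banach) banach
proof
  fix X :: "nat \<Rightarrow> 'a endo"
  assume C: "Cauchy X"
  have "Cauchy (\<lambda>n. endo_blinfun (X n))"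
    using C unfolding Cauchy_def dist_endo_def dist_norm by (simp add: minus_endo.rep_eq norm_endo.rep_eq)
  then obtain L where "(\<lambda>n. endo_blinfun (X n)) \<longlonglongrightarrow> L"
    using Cauchy_convergent_iff convergent_def by blast
  then have "X \<longlonglongrightarrow> Endo L"
    unfolding LIMSEQ_iff by (simp add: minus_endo.rep_eq norm_endo.rep_eq Endo_inverse)
  then show "convergent X" by (auto simp: convergent_def)
qed

lift_definition eapp :: "'a::real_normed_vector endo \<Rightarrow> 'a \<Rightarrow> 'a" is blinfun_apply .

lemma eapp_ext: "(\<And>x. eapp A x = eapp B x) \<Longrightarrow> A = B"
  by transfer (rule blinfun_eqI)

lemma eapp_simps [simp]:
  "eapp 0 x = 0" "eapp 1 x = x" "eapp (A + B) x = eapp A x + eapp B x"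
  "eapp (A - B) x = eapp A x - eapp B x" "eapp (- A) x = - eapp A x"
  "eapp (r *\<^sub>R A) x = r *\<^sub>R eapp A x" "eapp (A * B) x = eapp A (eapp B x)"
  by (transfer; simp add: blinfun.add_left blinfun.diff_left blinfun.minus_left blinfun.scaleR_left)+

lemma bounded_linear_eapp: "bounded_linear (eapp A)"
  by transfer (rule blinfun.bounded_linear_right)

lemmas eapp_add = linear_add[OF bounded_linear.linear[OF bounded_linear_eapp]]
lemmas eapp_scaleR = linear_scale[OF bounded_linear.linear[OF bounded_linear_eapp]]

lemma eapp_sum [simp]: "eapp (sum A I) x = (\<Sum>i\<in>I. eapp (A i) x)"
  by (induction I rule: infinite_finite_induct) auto

lemma norm_eapp: "norm (eapp A x) \<le> norm A * norm x"
  by transfer (rule norm_blinfun)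

lemma norm_endo_le: "0 \<le> b \<Longrightarrow> (\<And>x. norm (eapp A x) \<le> b * norm x) \<Longrightarrow> norm A \<le> b"
  by transfer (rule norm_blinfun_bound)

lemma eapp_Endo: "bounded_linear f \<Longrightarrow> eapp (Endo (Blinfun f)) = f"
  by (simp add: eapp.rep_eq Endo_inverse bounded_linear_Blinfun_apply)

lemma norm_one_endo_le: "norm (1 :: 'b::real_normed_vector endo) \<le> 1"
  by (rule norm_endo_le) auto

lemma norm_power_endo_le: "norm (A ^ k :: 'b::real_normed_vector endo) \<le> norm A ^ k"
proof (induction k)
  case (Suc k)
  then show ?case
    by (simp add: order_trans[OF norm_mult_ineq] mult_left_mono)
qed (simp add: norm_one_endo_le)

lemma neumann_inverse:
  fixes e :: "'b::banach endo"
  assumes "norm e < 1"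
  shows "\<exists>y. (1 - e) * y = 1 \<and> y * (1 - e) = 1"
proof -
  have "summable (\<lambda>k. norm e ^ k)" using assms by (simp add: summable_geometric)
  then have sm: "summable (\<lambda>k. e ^ k)"
    by (rule summable_comparison_test'[where N=0]) (rule norm_power_endo_le)
  define y where "y = (\<Sum>k. e ^ k)"
  have s1: "e * y = (\<Sum>k. e ^ Suc k)"
    unfolding y_def using bounded_linear.suminf[OF bounded_linear_mult_right sm, of e] by simp
  have s2: "y * e = (\<Sum>k. e ^ Suc k)"
    unfolding y_def using bounded_linear.suminf[OF bounded_linear_mult_left sm, of e]
    by (simp add: power_commutes)
  have "y = e ^ 0 + (\<Sum>k. e ^ Suc k)"
    unfolding y_def using suminf_split_head[OF sm] by simp
  then have "y = 1 + (\<Sum>k. e ^ Suc k)" by simp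
  then show ?thesis using s1 s2
    by (intro exI[of _ y]) (simp add: algebra_simps)
qed

section \<open>One-sided invertibility from central localization\<close>

lemma sum_roots_of_unity_power:
  fixes M e :: nat
  assumes "0 < e" "e < 2 * M" "0 < M"
  shows "(\<Sum>m<M. cis (2 * pi * real m / real M) ^ e) = (if e = M then of_nat M else 0)"
proof -
  define z where "z = cis (2 * pi * real e / real M)"
  have eq: "cis (2 * pi * real m / real M) ^ e = z ^ m" for m
    unfolding z_def Complex.DeMoivre by (rule arg_cong[where f=cis]) simp
  have zM: "z ^ M = 1"
  proof -
    have "z ^ M = cis (2 * pi * real e)" using assms unfolding z_def Complex.DeMoivre by simp
    also have "\<dots> = cis (2*pi) ^ e" unfolding Complex.DeMoivre by (simp add: algebra_simps)
    finally show ?thesis by simp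
  qed
  show ?thesis
  proof (cases "e = M")
    case True
    then have "z = 1" using assms by (simp add: z_def)
    then show ?thesis using True eq by simp
  next
    case False
    have "z \<noteq> 1"
    proof
      assume "z = 1"
      then have "cos (2 * pi * real e / real M) = 1"
        by (simp add: z_def complex_eq_iff)
      then obtain k :: int where k: "2 * pi * real e / real M = k * 2 * pi"
        by (auto simp: cos_one_2pi_int)
      then have "real e = k * real M" using assms by (simp add: field_simps)
      then have ek: "int e = k * int M" by (metis of_int_eq_iff of_int_mult of_int_of_nat_eq)
      have "0 < k * int M" "k * int M < 2 * int M" using assms ek by linarith+
      then have "0 < k" "k < 2" using assms by (auto simp: zero_less_mult_iff)
      then have "k = 1" by simp
      then show False using ek False by simp
    qed
    then have "(\<Sum>m<M. z ^ m) = 0" using zM by (simp add: geometric_sum)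
    then show ?thesis using False eq by simp
  qed
qed

lemma le_divide_nat_imp_zero:
  fixes x K :: real
  assumes "\<And>n::nat. 0 < n \<Longrightarrow> x \<le> K / real n" "x \<ge> 0"
  shows "x = 0"
proof (rule ccontr)
  assume "x \<noteq> 0"
  then have "x > 0" using assms by simp
  then obtain n :: nat where n: "K / x < n" using reals_Archimedean2 by blast
  have "x \<le> K / real (Suc n)" using assms(1)[of "Suc n"] by simp
  then have "x * real (Suc n) \<le> K" by (simp add: field_simps)
  moreover have "K < x * n" using n \<open>x>0\<close> by (simp add: field_simps)
  ultimately show False using \<open>x>0\<close> by (simp add: algebra_simps)
qed

text \<open>The norm of the class of \<open>x\<close> modulo \<open>R\<close>. Keeping it as a
  seminorm on the algebra itself allows \<open>R\<close> to be a one-sided ideal, for which the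
  quotient is not an algebra.\<close>

definition quotient_norm :: "'b::real_normed_algebra set \<Rightarrow> 'b \<Rightarrow> real"
  where "quotient_norm R x = (INF r\<in>R. norm (x - r))"

text \<open>The stability assumptions of the two product estimates concern a single factor: modulo a
  right ideal, left multiplication is controlled only for factors that happen to preserve the
  ideal.\<close>

lemma quotient_norm:
  assumes R: "0 \<in> R" "\<And>r s. r \<in> R \<Longrightarrow> s \<in> R \<Longrightarrow> r + s \<in> R"
  shows quotient_norm_nonneg: "0 \<le> quotient_norm R x"
    and quotient_norm_le: "r \<in> R \<Longrightarrow> quotient_norm R x \<le> norm (x - r)"
    and quotient_norm_lessD: "quotient_norm R x < c \<Longrightarrow> \<exists>r\<in>R. norm (x - r) < c"
    and quotient_norm_add: "quotient_norm R (x + y) \<le> quotient_norm R x + quotient_norm R y"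
    and quotient_norm_mult_left: "(\<And>r. r \<in> R \<Longrightarrow> x * r \<in> R) \<Longrightarrow> quotient_norm R (x * y) \<le> norm x * quotient_norm R y"
    and quotient_norm_mult_right: "(\<And>r. r \<in> R \<Longrightarrow> r * y \<in> R) \<Longrightarrow> quotient_norm R (x * y) \<le> quotient_norm R x * norm y"
proof -
  have ne: "R \<noteq> {}" using R(1) by auto
  have bdd: "bdd_below ((\<lambda>r. norm (x - r)) ` R)" for x by (rule bdd_belowI[of _ 0]) auto
  show nonneg: "0 \<le> quotient_norm R x" for x unfolding quotient_norm_def using ne by (intro cINF_greatest) auto
  show le: "quotient_norm R x \<le> norm (x - r)" if "r \<in> R" for r x
    unfolding quotient_norm_def by (intro cINF_lower bdd that)
  show ex: "\<exists>r\<in>R. norm (x - r) < c" if "quotient_norm R x < c" for x c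
    using that ne unfolding quotient_norm_def by (subst (asm) cINF_less_iff) (auto intro: bdd)
  show "quotient_norm R (x + y) \<le> quotient_norm R x + quotient_norm R y"
  proof (rule field_le_epsilon)
    fix e :: real assume "e > 0"
    obtain r s where r: "r \<in> R" "norm (x - r) < quotient_norm R x + e/2"
      and s: "s \<in> R" "norm (y - s) < quotient_norm R y + e/2"
      using ex[of x "quotient_norm R x + e/2"] ex[of y "quotient_norm R y + e/2"] \<open>e > 0\<close> by auto
    have "quotient_norm R (x + y) \<le> norm ((x - r) + (y - s))"
      using le[OF R(2)[OF r(1) s(1)], of "x + y"] by (simp add: algebra_simps)
    then show "quotient_norm R (x + y) \<le> quotient_norm R x + quotient_norm R y + e"
      using norm_triangle_ineq[of "x - r" "y - s"] r(2) s(2) by linarith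
  qed
  show "quotient_norm R (x * y) \<le> norm x * quotient_norm R y" if "\<And>r. r \<in> R \<Longrightarrow> x * r \<in> R"
  proof (cases "norm x = 0")
    case True then show ?thesis using le[OF R(1), of 0] by simp
  next
    case False
    then have nx: "norm x > 0" by simp
    have "quotient_norm R (x * y) / norm x \<le> quotient_norm R y" unfolding quotient_norm_def[of R y]
    proof (rule cINF_greatest[OF ne])
      fix r assume r: "r \<in> R"
      have "quotient_norm R (x * y) \<le> norm (x * (y - r))"
        using le[OF that[OF r], of "x * y"] by (simp add: right_diff_distrib)
      then have "quotient_norm R (x * y) \<le> norm x * norm (y - r)" using norm_mult_ineq order_trans by blast
      then show "quotient_norm R (x * y) / norm x \<le> norm (y - r)" using nx by (simp add: field_simps)
    qed
    then show ?thesis using nx by (simp add: field_simps)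
  qed
  show "quotient_norm R (x * y) \<le> quotient_norm R x * norm y" if "\<And>r. r \<in> R \<Longrightarrow> r * y \<in> R"
  proof (cases "norm y = 0")
    case True then show ?thesis using le[OF R(1), of 0] by simp
  next
    case False
    then have ny: "norm y > 0" by simp
    have "quotient_norm R (x * y) / norm y \<le> quotient_norm R x" unfolding quotient_norm_def[of R x]
    proof (rule cINF_greatest[OF ne])
      fix r assume r: "r \<in> R"
      have "quotient_norm R (x * y) \<le> norm ((x - r) * y)"
        using le[OF that[OF r], of "x * y"] by (simp add: left_diff_distrib)
      then have "quotient_norm R (x * y) \<le> norm (x - r) * norm y" using norm_mult_ineq order_trans by blast
      then show "quotient_norm R (x * y) / norm y \<le> norm (x - r)" using ny by (simp add: field_simps)
    qed
    then show ?thesis using ny by (simp add: field_simps)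
  qed
qed

text \<open>Abstracts translation by a fixed step and its inverse; being mutually inverse
  contractions, both are isometries. The algebra \<open>endo\<close> is only real, so complex
  scalars enter as operators \<open>m c\<close>.\<close>

locale rotation =
  fixes t t' :: "'b::real_normed_vector endo" and m :: "complex \<Rightarrow> 'b endo"
  assumes m_add: "\<And>c d. m (c + d) = m c + m d" and m_mult: "\<And>c d. m (c * d) = m c * m d"
    and m_of_real: "\<And>r. m (of_real r) = r *\<^sub>R 1"
    and norm_m: "\<And>c. norm (m c) \<le> cmod c" and tm: "\<And>c. t * m c = m c * t"
    and t: "norm t \<le> 1" "norm t' \<le> 1" "t' * t = 1" "t * t' = 1"
begin

definition comm :: "'b endo \<Rightarrow> bool"
  where "comm e \<longleftrightarrow> e * t = t * e \<and> (\<forall>c. e * m c = m c * e)"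

text \<open>The bicommutant of \<open>t\<close> and the scalars. It contains \<open>t'\<close> and
  all polynomials in \<open>t\<close>, and its elements commute with the cofactors and errors
  \<open>v\<close>, \<open>e\<close> of the local identities below, which satisfy
  \<open>comm\<close>.\<close>

definition bicomm :: "'b endo set"
  where "bicomm = {x. \<forall>e. comm e \<longrightarrow> x * e = e * x}"

lemma m_one: "m 1 = 1" using m_of_real[of 1] by simp

lemma m_comm: "m c * m d = m d * m c" by (metis m_mult mult.commute)

lemma comm_t: "comm t" and comm_m: "comm (m c)"
  by (auto simp: comm_def tm m_comm)

lemma bicomm:
  "t \<in> bicomm" "t' \<in> bicomm" "m c \<in> bicomm"
  "x \<in> bicomm \<Longrightarrow> y \<in> bicomm \<Longrightarrow> x + y \<in> bicomm"
  "x \<in> bicomm \<Longrightarrow> y \<in> bicomm \<Longrightarrow> x * y \<in> bicomm"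
proof -
  show "t' \<in> bicomm" unfolding bicomm_def
  proof safe
    fix e assume "comm e"
    then have "e * t = t * e" by (simp add: comm_def)
    then have "t' * (e * t) * t' = t' * (t * e) * t'" by simp
    then have "t' * e * (t * t') = (t' * t) * e * t'" by (simp only: mult.assoc)
    then show "t' * e = e * t'" by (simp add: t)
  qed
  show "x * y \<in> bicomm" if "x \<in> bicomm" "y \<in> bicomm"
    unfolding bicomm_def
  proof safe
    fix e assume e: "comm e"
    have "x * y * e = x * (y * e)" by (rule mult.assoc)
    also have "\<dots> = x * e * y" using that(2) e by (simp add: bicomm_def mult.assoc)
    also have "\<dots> = e * (x * y)" using that(1) e by (simp add: bicomm_def mult.assoc)
    finally show "x * y * e = e * (x * y)" .
  qed
qed (auto simp: bicomm_def comm_def distrib_left distrib_right)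

lemma comm_closed:
  assumes "comm x" "comm y"
  shows "comm (x + y)" "comm (x - y)" "comm (x * y)" "comm (- x)" "comm (r *\<^sub>R x)"
proof -
  have *: "x * y * z = z * (x * y)" if "x * z = z * x" "y * z = z * y" for z
    by (metis that mult.assoc)
  show "comm (x * y)" using assms unfolding comm_def by (auto intro!: *)
qed (use assms in \<open>auto simp: comm_def algebra_simps\<close>)

lemma comm_basic: "comm 1" "comm 0"
  by (auto simp: comm_def)

lemma comm_mt: "comm v \<Longrightarrow> (1 - m \<nu> * t) * v = v * (1 - m \<nu> * t)"
proof -
  assume v: "comm v"
  have "m \<nu> * t * v = m \<nu> * v * t" using v by (simp add: comm_def mult.assoc)
  also have "\<dots> = v * (m \<nu> * t)" using v by (simp add: comm_def mult.assoc[symmetric])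
  finally show ?thesis by (simp add: algebra_simps)
qed

text \<open>With \<open>D\<^sub>\<nu> = (\<Sum>k<n. \<nu>\<^sup>k t\<^sup>k)\<close> one has \<open>q (D\<^sub>\<nu>\<^sup>2) \<le> 4C\<^sup>2\<close> independently of \<open>n\<close>, because
  \<open>(1 - \<nu>t) D\<^sub>\<nu>\<close> has norm at most 2, whereas the average of \<open>\<nu>\<^sup>n\<^sup>+\<^sup>1 D\<^sub>\<nu>\<^sup>2\<close> over the \<open>2n\<close>-th roots of
  unity is \<open>n t\<^sup>n\<^sup>-\<^sup>1\<close>. Letting \<open>n\<close> tend to infinity gives \<open>q 1 = 0\<close>.\<close>

lemma seminorm_vanishes:
  fixes q :: "'b endo \<Rightarrow> real"
  assumes q_nonneg: "\<And>x. 0 \<le> q x" and q_le: "\<And>x. q x \<le> norm x"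
    and q_add: "\<And>x y. q (x + y) \<le> q x + q y"
    and q_mult: "\<And>x y. x \<in> bicomm \<Longrightarrow> q (x * y) \<le> norm x * q y"
    and C: "C \<ge> 0"
    and key: "\<And>D \<nu>. D \<in> bicomm \<Longrightarrow> cmod \<nu> = 1 \<Longrightarrow> q D \<le> C * q ((1 - m \<nu> * t) * D)"
  shows "q 1 = 0"
proof -
  note S = bicomm
  have "q 1 \<le> (4 * C * C) / real n" if n: "n > 0" for n :: nat
  proof -
  have m0: "m 0 = 0" using m_of_real[of 0] by simp
  have q_sum: "q (\<Sum>i\<in>I. x i) \<le> (\<Sum>i\<in>I. q (x i))" for I :: "nat set" and x
  proof (induction I rule: infinite_finite_induct)
    case (insert i I)
    then show ?case using q_add[of "x i" "sum x I"] by simp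
  qed (use q_le[of 0] in auto)
  have m_sum: "m (\<Sum>i\<in>I. f i) = (\<Sum>i\<in>I. m (f i))" for I :: "nat set" and f
    by (induction I rule: infinite_finite_induct) (auto simp: m0 m_add)
  have S1: "1 \<in> bicomm" using S(3)[of 1] m_one by simp
  have S0: "0 \<in> bicomm" using S(3)[of 0] m0 by simp
  have Spow: "x ^ k \<in> bicomm" if "x \<in> bicomm" for x k using that by (induction k) (auto simp: S1 S)
  have Ssum: "(\<Sum>i\<in>I. x i) \<in> bicomm" if "\<And>i. x i \<in> bicomm" for I :: "nat set" and x
    by (induction I rule: infinite_finite_induct) (auto simp: S0 S that)
  define D where "D \<nu> = (\<Sum>k<n. m (\<nu> ^ k) * t ^ k)" for \<nu>
  have DS: "D \<nu> \<in> bicomm" for \<nu> unfolding D_def by (intro Ssum S(5) S(3) Spow S(1))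
  have pw: "m (\<nu> ^ k) * t ^ k = (m \<nu> * t) ^ k" for \<nu> k
  proof (induction k)
    case (Suc k)
    have "m (\<nu> ^ Suc k) * t ^ Suc k = m \<nu> * (m (\<nu> ^ k) * t) * t ^ k" by (simp add: m_mult mult.assoc)
    also have "\<dots> = (m \<nu> * t) * (m (\<nu>^k) * t ^ k)" by (subst tm[symmetric]) (simp only: mult.assoc)
    finally show ?case using Suc by simp
  qed (simp add: m_one)
  have geo: "(1 - y) * (\<Sum>k<j. y ^ k) = 1 - y ^ j" for y :: "'b endo" and j
  proof (induction j)
    case (Suc j)
    have "(1 - y) * (\<Sum>k<Suc j. y ^ k) = (1 - y) * (\<Sum>k<j. y ^ k) + (1 - y) * y ^ j"
      by (simp add: distrib_left)
    also have "\<dots> = 1 - y ^ j + (y ^ j - y * y ^ j)" by (subst Suc) (simp add: left_diff_distrib)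
    finally show ?case by simp
  qed simp
  have nt: "norm (m \<nu> * t) \<le> 1" if "cmod \<nu> = 1" for \<nu>
    using norm_mult_ineq[of "m \<nu>" t] norm_m[of \<nu>] t(1) that
    by (smt (verit) mult_left_le norm_ge_zero)
  have gD: "norm ((1 - m \<nu> * t) * D \<nu>) \<le> 2" if "cmod \<nu> = 1" for \<nu>
  proof -
    have "(1 - m \<nu> * t) * D \<nu> = 1 - (m \<nu> * t) ^ n"
      unfolding D_def using geo[of "m \<nu> * t" n] by (simp add: pw)
    moreover have "norm ((m \<nu> * t) ^ n) \<le> 1"
      using norm_power_endo_le[of "m \<nu> * t" n] power_le_one[OF norm_ge_zero nt[OF that], of n] by simp
    ultimately show ?thesis
      using norm_triangle_ineq4[of 1 "(m \<nu> * t) ^ n"] norm_one_endo_le[where 'b='b] by simp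
  qed
  have qD: "q (D \<nu>) \<le> 2 * C" if "cmod \<nu> = 1" for \<nu>
  proof -
    have "q (D \<nu>) \<le> C * q ((1 - m \<nu> * t) * D \<nu>)" by (rule key[OF DS that])
    also have "\<dots> \<le> C * 2" using q_le[of "(1 - m \<nu> * t) * D \<nu>"] gD[OF that] C
      by (intro mult_left_mono) auto
    finally show ?thesis by simp
  qed
  \<comment> \<open>One application of \<open>key\<close> trades one factor \<open>D\<close> for the
    bound 2, and \<open>qD\<close> controls the other. The square is essential: averaging
    \<open>D\<close> itself would isolate a coefficient 1, whereas the square yields the coefficient
    \<open>n\<close> that produces the decay.\<close>
  have qDD: "q (D \<nu> * D \<nu>) \<le> 4 * C * C" if c: "cmod \<nu> = 1" for \<nu>
  proof -
    have z: "(1 - m \<nu> * t) = 1 + m (-1) * (m \<nu> * t)" using m_of_real[of "-1"] by simp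
    have zS: "1 - m \<nu> * t \<in> bicomm" unfolding z by (intro S S1)
    have "q (D \<nu> * D \<nu>) \<le> C * q ((1 - m \<nu> * t) * (D \<nu> * D \<nu>))" by (intro key S DS c)
    also have "\<dots> \<le> C * (2 * (2 * C))"
    proof (intro mult_left_mono C)
      have "q (((1 - m \<nu> * t) * D \<nu>) * D \<nu>) \<le> norm ((1 - m \<nu> * t) * D \<nu>) * q (D \<nu>)"
        by (intro q_mult S(5) zS DS)
      also have "\<dots> \<le> 2 * (2 * C)" by (intro mult_mono gD qD c) (auto simp: q_nonneg)
      finally show "q ((1 - m \<nu> * t) * (D \<nu> * D \<nu>)) \<le> 2 * (2 * C)" by (simp add: mult.assoc)
    qed
    finally show ?thesis by simp
  qed
  \<comment> \<open>The shift \<open>n + 1\<close> together with \<open>M = 2 * n\<close> selects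
    the pairs with \<open>k + l = n - 1\<close>, of which there are \<open>n\<close>. The exponents
    are at most \<open>3 * n - 1\<close>, hence below \<open>2 * M\<close>.\<close>
  define M where "M = 2 * n"
  define \<nu> where "\<nu> i = cis (2 * pi * real i / real M)" for i :: nat
  have c1: "cmod (\<nu> i) = 1" for i by (simp add: \<nu>_def)
  have DD: "m (\<nu> i ^ (n + 1)) * (D (\<nu> i) * D (\<nu> i)) = (\<Sum>k<n. \<Sum>l<n. m (\<nu> i ^ (n + 1 + k + l)) * t ^ (k + l))" for i
  proof -
    have "D (\<nu> i) * D (\<nu> i) = (\<Sum>k<n. \<Sum>l<n. (m (\<nu> i) * t) ^ (k + l))"
      unfolding D_def pw by (simp add: sum_product power_add)
    also have "\<dots> = (\<Sum>k<n. \<Sum>l<n. m (\<nu> i ^ (k + l)) * t ^ (k + l))"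
      by (simp only: pw[symmetric])
    finally show ?thesis
      by (simp add: sum_distrib_left m_mult[symmetric] mult.assoc[symmetric] power_add)
  qed
  have inner: "(\<Sum>i<M. m (\<nu> i ^ (n + 1 + k + l)) * t ^ (k + l)) = (if l = n - 1 - k then real M *\<^sub>R t ^ (n - 1) else 0)"
    if "k < n" "l < n" for k l
  proof -
    have "(\<Sum>i<M. m (\<nu> i ^ (n + 1 + k + l)) * t ^ (k + l)) = m (\<Sum>i<M. \<nu> i ^ (n + 1 + k + l)) * t ^ (k + l)"
      by (simp add: sum_distrib_right m_sum)
    also have "(\<Sum>i<M. \<nu> i ^ (n + 1 + k + l)) = (if n + 1 + k + l = M then of_nat M else 0)"
      unfolding \<nu>_def using that n by (intro sum_roots_of_unity_power) (auto simp: M_def)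
    also have "(n + 1 + k + l = M) = (l = n - 1 - k)" using that by (auto simp: M_def)
    finally show ?thesis using that m_of_real[of "real M"] by (auto simp: m0)
  qed
  have tot: "(\<Sum>i<M. m (\<nu> i ^ (n + 1)) * (D (\<nu> i) * D (\<nu> i))) = (real n * real M) *\<^sub>R t ^ (n - 1)"
  proof -
    have "(\<Sum>i<M. m (\<nu> i ^ (n + 1)) * (D (\<nu> i) * D (\<nu> i)))
        = (\<Sum>k<n. \<Sum>l<n. \<Sum>i<M. m (\<nu> i ^ (n + 1 + k + l)) * t ^ (k + l))"
      unfolding DD by (subst sum.swap, rule sum.cong[OF refl], subst sum.swap, rule refl)
    also have "\<dots> = (\<Sum>k<n. \<Sum>l<n. if l = n - 1 - k then real M *\<^sub>R t ^ (n - 1) else 0)"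
      by (intro sum.cong refl inner) auto
    also have "\<dots> = (\<Sum>k<n. real M *\<^sub>R t ^ (n - 1))"
      by (intro sum.cong refl) (subst sum.delta, auto)
    also have "\<dots> = (real n * real M) *\<^sub>R t ^ (n - 1)"
      by (simp add: sum_constant_scaleR)
    finally show ?thesis .
  qed
  have "t' ^ j * t ^ j = 1" for j
  proof (induction j)
    case (Suc j)
    have "t' ^ Suc j * t ^ Suc j = t' ^ j * (t' * t) * t ^ j"
      unfolding power_Suc2[of t'] power_Suc[of t] by (simp only: mult.assoc)
    then show ?case using Suc t(3) by simp
  qed simp
  then have one: "1 = ((1 / (real n * real M)) *\<^sub>R t' ^ (n - 1)) * (\<Sum>i<M. m (\<nu> i ^ (n + 1)) * (D (\<nu> i) * D (\<nu> i)))"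
    unfolding tot using n by (simp add: M_def)
  have "q 1 \<le> norm ((1 / (real n * real M)) *\<^sub>R t' ^ (n - 1)) * q (\<Sum>i<M. m (\<nu> i ^ (n + 1)) * (D (\<nu> i) * D (\<nu> i)))"
  proof (subst one, rule q_mult)
    have "(1 / (real n * real M)) *\<^sub>R t' ^ (n - 1) = m (of_real (1 / (real n * real M))) * t' ^ (n - 1)"
      by (simp only: m_of_real) simp
    then show "(1 / (real n * real M)) *\<^sub>R t' ^ (n - 1) \<in> bicomm" by (simp only: S Spow)
  qed
  also have "\<dots> \<le> (1 / (real n * real M)) * (\<Sum>i<M. 4 * C * C)"
  proof (intro mult_mono)
    show "norm ((1 / (real n * real M)) *\<^sub>R t' ^ (n - 1)) \<le> 1 / (real n * real M)"
      using norm_power_endo_le[of t' "n - 1"] power_le_one[OF norm_ge_zero t(2), of "n - 1"]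
      by (simp add: divide_right_mono)
    have "q (m (\<nu> i ^ (n + 1)) * (D (\<nu> i) * D (\<nu> i))) \<le> 4 * C * C" for i
    proof -
      have "norm (m (\<nu> i ^ (n + 1))) \<le> 1"
        using norm_m[of "\<nu> i ^ (n + 1)"] c1[of i] by (simp only: norm_power power_one)
      then have "norm (m (\<nu> i ^ (n + 1))) * q (D (\<nu> i) * D (\<nu> i)) \<le> 1 * (4 * C * C)"
        by (intro mult_mono qDD c1) (auto simp: q_nonneg)
      then show ?thesis using q_mult[OF S(3), of "\<nu> i ^ (n + 1)" "D (\<nu> i) * D (\<nu> i)"] by linarith
    qed
    then show "q (\<Sum>i<M. m (\<nu> i ^ (n + 1)) * (D (\<nu> i) * D (\<nu> i))) \<le> (\<Sum>i<M. 4 * C * C)"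
      by (intro order_trans[OF q_sum] sum_mono)
  qed (auto simp: q_nonneg)
  also have "\<dots> = 4 * C * C / real n" using n by (simp add: M_def)
  finally show ?thesis .
  qed
  then show ?thesis by (rule le_divide_nat_imp_zero) (assumption | rule q_nonneg)+
qed

text \<open>Multiplying the identity for 1 by \<open>D\<close> from the left puts its first term
  into the left ideal of \<open>a\<close>. The error is absorbed because
  \<open>norm e \<le> 1/2\<close>, which doubles \<open>C\<close> and gives the inequality
  \<open>key\<close> of \<open>seminorm_vanishes\<close>. Then \<open>q 1 = 0\<close> means that
  multiples \<open>b * a\<close> come arbitrarily close to 1.\<close>

lemma left_inverse:
  assumes C: "C \<ge> 0"
    and loc: "\<And>\<nu>. cmod \<nu> = 1 \<Longrightarrow> \<exists>w v e. 1 = w * a + (1 - m \<nu> * t) * v + e \<and> comm v \<and> comm e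
      \<and> norm v \<le> C \<and> norm e \<le> 1/2"
  shows "\<exists>b. norm (1 - b * a) < 1"
proof -
  define R where "R = range (\<lambda>w. w * a)"
  define q where "q = quotient_norm R"
  have R: "0 \<in> R" "\<And>r s. r \<in> R \<Longrightarrow> s \<in> R \<Longrightarrow> r + s \<in> R" and Rx: "\<And>x r. r \<in> R \<Longrightarrow> x * r \<in> R"
    unfolding R_def by (auto simp: image_iff distrib_right[symmetric] mult.assoc[symmetric] intro: exI[of _ 0])
  note q_nonneg = quotient_norm_nonneg[OF R, folded q_def] and q_add = quotient_norm_add[OF R, folded q_def]
    and q_mult = quotient_norm_mult_left[OF R Rx, folded q_def] and q_ex = quotient_norm_lessD[OF R, folded q_def]
  have q_le': "q x \<le> norm (x - w * a)" for x w
    unfolding q_def by (rule quotient_norm_le[OF R]) (auto simp: R_def)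
  have "q 1 = 0"
  proof (rule seminorm_vanishes[of q "2 * C"])
    show "q x \<le> norm x" for x using q_le'[of x 0] by simp
    show "q D \<le> 2 * C * q ((1 - m \<nu> * t) * D)" if D: "D \<in> bicomm" and \<nu>: "cmod \<nu> = 1" for D \<nu>
    proof -
      from loc[OF \<nu>] obtain w v e where 1: "1 = w * a + (1 - m \<nu> * t) * v + e"
        and cv: "comm v" and ce: "comm e" and nv: "norm v \<le> C" and ne: "norm e \<le> 1/2" by blast
      define s where "s = 1 - m \<nu> * t"
      have sv: "s * v = v * s" unfolding s_def by (rule comm_mt[OF cv])
      have cs: "comm s" unfolding s_def by (intro comm_closed comm_basic comm_t comm_m)
      have Dc: "D * y = y * D" if "comm y" for y using D that by (simp add: bicomm_def)
      have "D = D * (w * a + s * v + e)" using 1 by (simp add: s_def)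
      also have "\<dots> = (D * w) * a + (v * (s * D) + e * D)"
        unfolding distrib_left sv Dc[OF ce] using Dc[OF comm_closed(3)[OF cv cs]]
        by (simp add: mult.assoc)
      finally have 2: "D = (D * w) * a + (v * (s * D) + e * D)" .
      have "q ((D * w) * a) \<le> 0" using q_le'[of "D * w * a" "D * w"] by simp
      then have "q D \<le> q (v * (s * D) + e * D)" using q_add[of "D * w * a" "v * (s * D) + e * D"] 2 by simp
      also have "\<dots> \<le> q (v * (s * D)) + q (e * D)" by (rule q_add)
      also have "\<dots> \<le> norm v * q (s * D) + norm e * q D" by (intro add_mono q_mult)
      also have "\<dots> \<le> C * q (s * D) + 1/2 * q D" by (intro add_mono mult_right_mono nv ne q_nonneg)
      finally show ?thesis by (simp add: s_def)
    qed
  qed (use C in \<open>auto intro: q_nonneg q_add q_mult\<close>)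
  then show ?thesis using q_ex[of 1 1] by (auto simp: R_def)
qed

text \<open>Now \<open>D\<close> multiplies from the right. Since \<open>seminorm_vanishes\<close>
  still multiplies from the left, bicommutant elements must preserve the right ideal of
  \<open>a\<close>, and \<open>comm a\<close> ensures that they do.\<close>

lemma right_inverse:
  assumes C: "C \<ge> 0" and ca: "comm a"
    and loc: "\<And>\<nu>. cmod \<nu> = 1 \<Longrightarrow> \<exists>w v e. 1 = a * w + (1 - m \<nu> * t) * v + e \<and> comm v \<and> comm e
      \<and> norm v \<le> C \<and> norm e \<le> 1/2"
  shows "\<exists>b. norm (1 - a * b) < 1"
proof -
  define R where "R = range (\<lambda>w. a * w)"
  define q where "q = quotient_norm R"
  have R: "0 \<in> R" "\<And>r s. r \<in> R \<Longrightarrow> s \<in> R \<Longrightarrow> r + s \<in> R" and Rx: "\<And>x r. r \<in> R \<Longrightarrow> r * x \<in> R"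
    unfolding R_def by (auto simp: image_iff distrib_left[symmetric] mult.assoc intro: exI[of _ 0])
  note q_nonneg = quotient_norm_nonneg[OF R, folded q_def] and q_add = quotient_norm_add[OF R, folded q_def]
    and q_mult2 = quotient_norm_mult_right[OF R Rx, folded q_def] and q_ex = quotient_norm_lessD[OF R, folded q_def]
  have q_le': "q x \<le> norm (x - a * w)" for x w
    unfolding q_def by (rule quotient_norm_le[OF R]) (auto simp: R_def)
  have q_mult: "q (x * y) \<le> norm x * q y" if x: "x \<in> bicomm" for x y
    unfolding q_def
  proof (rule quotient_norm_mult_left[OF R])
    fix r assume "r \<in> R"
    then obtain w where "r = a * w" by (auto simp: R_def)
    then have "x * r = a * (x * w)" using x ca by (simp add: bicomm_def mult.assoc[symmetric])
    then show "x * r \<in> R" by (simp add: R_def)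
  qed
  have "q 1 = 0"
  proof (rule seminorm_vanishes[of q "2 * C"])
    show "q x \<le> norm x" for x using q_le'[of x 0] by simp
    show "q D \<le> 2 * C * q ((1 - m \<nu> * t) * D)" if D: "D \<in> bicomm" and \<nu>: "cmod \<nu> = 1" for D \<nu>
    proof -
      from loc[OF \<nu>] obtain w v e where 1: "1 = a * w + (1 - m \<nu> * t) * v + e"
        and cv: "comm v" and ce: "comm e" and nv: "norm v \<le> C" and ne: "norm e \<le> 1/2" by blast
      define s where "s = 1 - m \<nu> * t"
      have "D = (a * w + s * v + e) * D" using 1 by (simp add: s_def)
      also have "\<dots> = a * (w * D) + ((s * D) * v + D * e)"
        using D cv ce unfolding bicomm_def by (simp add: distrib_right mult.assoc)
      finally have 2: "D = a * (w * D) + ((s * D) * v + D * e)" .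
      have "q (a * (w * D)) \<le> 0" using q_le'[of "a * (w * D)" "w * D"] by simp
      then have "q D \<le> q ((s * D) * v + D * e)" using q_add[of "a * (w * D)" "(s * D) * v + D * e"] 2 by simp
      also have "\<dots> \<le> q ((s * D) * v) + q (D * e)" by (rule q_add)
      also have "\<dots> \<le> q (s * D) * norm v + q D * norm e" by (intro add_mono q_mult2)
      also have "\<dots> \<le> q (s * D) * C + q D * (1/2)" by (intro add_mono mult_left_mono nv ne q_nonneg)
      finally show ?thesis by (simp add: s_def algebra_simps)
    qed
  qed (use C in \<open>auto intro: q_nonneg q_add q_mult\<close>)
  then show ?thesis using q_ex[of 1 1] by (auto simp: R_def)
qed

end

section \<open>Integration of dominated functions with values in a Banach space\<close>

lemma has_integral_UNIV_affine:
  fixes F :: "real \<Rightarrow> 'a::banach"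
  assumes F: "(F has_integral I) UNIV" and m: "m \<noteq> 0"
  shows "((\<lambda>s. F (m * s + c)) has_integral ((1 / \<bar>m\<bar>) *\<^sub>R I)) UNIV"
proof (subst has_integral', intro allI impI)
  fix e :: real assume e: "e > 0"
  then have "e * \<bar>m\<bar> > 0" using m by simp
  with F[unfolded has_integral'[of F I UNIV], rule_format, OF this]
  obtain B where B: "B > 0"
    and BI: "\<And>a b. ball 0 B \<subseteq> cbox a b \<Longrightarrow> \<exists>z. (F has_integral z) (cbox a b) \<and> norm (z - I) < e * \<bar>m\<bar>"
    by (simp only: UNIV_I if_True) blast
  \<comment> \<open>Chosen so that \<open>\<bar>y\<bar> < B\<close> implies
    \<open>\<bar>(y - c) / m\<bar> < B'\<close>: a box containing the ball of radius
    \<open>B'\<close> is then mapped by the substitution onto a box containing the ball of radius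
    \<open>B\<close>.\<close>
  define B' where "B' = (B + \<bar>c\<bar>) / \<bar>m\<bar>"
  have "B' > 0" using B m by (simp add: B'_def add_pos_nonneg)
  moreover have "\<exists>z. ((\<lambda>x. if x \<in> UNIV then F (m * x + c) else 0) has_integral z) (cbox a b)
      \<and> norm (z - (1 / \<bar>m\<bar>) *\<^sub>R I) < e" if sub: "ball 0 B' \<subseteq> cbox a b" for a b
  proof -
    have "0 \<in> cbox a b" using sub \<open>B' > 0\<close> by (meson centre_in_ball subsetD)
    then have ab: "a \<le> b" by auto
    define a0 where "a0 = (if m > 0 then m * a + c else m * b + c)"
    define b0 where "b0 = (if m > 0 then m * b + c else m * a + c)"
    have "ball 0 B \<subseteq> cbox a0 b0"
    proof
      fix y :: real assume y: "y \<in> ball 0 B"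
      have "\<bar>y - c\<bar> / \<bar>m\<bar> < B'" using y m by (auto simp: B'_def divide_strict_right_mono)
      then have "(y - c) / m \<in> ball 0 B'" by (simp add: abs_divide)
      then have "(y - c) / m \<in> cbox a b" using sub by blast
      then show "y \<in> cbox a0 b0" using m by (auto simp: a0_def b0_def field_simps split: if_splits)
    qed
    from BI[OF this] obtain z where z: "(F has_integral z) (cbox a0 b0)" "norm (z - I) < e * \<bar>m\<bar>" by blast
    have img: "(\<lambda>x. (1 / m) *\<^sub>R x + - ((1 / m) *\<^sub>R c)) ` cbox a0 b0 = cbox a b"
    proof -
      have "(\<lambda>x. (1 / m) *\<^sub>R x + - ((1 / m) *\<^sub>R c)) ` cbox a0 b0 = {x. m * x + c \<in> cbox a0 b0}"
      proof (intro equalityI subsetI)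
        fix x assume "x \<in> {x. m * x + c \<in> cbox a0 b0}"
        then have "x = (1 / m) *\<^sub>R (m * x + c) + - ((1 / m) *\<^sub>R c)" "m * x + c \<in> cbox a0 b0"
          using m by (auto simp: field_simps)
        then show "x \<in> (\<lambda>x. (1 / m) *\<^sub>R x + - ((1 / m) *\<^sub>R c)) ` cbox a0 b0" by blast
      qed (use m in \<open>auto simp: field_simps\<close>)
      also have "\<dots> = cbox a b" using m ab
        by (auto simp: a0_def b0_def mult_le_cancel_left split: if_splits)
      finally show ?thesis .
    qed
    have "((\<lambda>x. F (m * x + c)) has_integral ((1 / \<bar>m\<bar>) *\<^sub>R z)) (cbox a b)"
      using has_integral_affinity[OF z(1) m, of c] unfolding img by simp
    moreover have "norm ((1 / \<bar>m\<bar>) *\<^sub>R z - (1 / \<bar>m\<bar>) *\<^sub>R I) < e"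
    proof -
      have "norm ((1 / \<bar>m\<bar>) *\<^sub>R z - (1 / \<bar>m\<bar>) *\<^sub>R I) = norm (z - I) / \<bar>m\<bar>"
        by (simp add: scaleR_diff_right[symmetric])
      then show ?thesis using z(2) m by (simp add: pos_divide_less_eq)
    qed
    ultimately show ?thesis by auto
  qed
  ultimately show "\<exists>B>0. \<forall>a b. ball 0 B \<subseteq> cbox a b \<longrightarrow>
      (\<exists>z. ((\<lambda>x. if x \<in> UNIV then F (m * x + c) else 0) has_integral z) (cbox a b)
      \<and> norm (z - (1 / \<bar>m\<bar>) *\<^sub>R I) < e)" by blast
qed

lemma integrable_UNIV_reflect:
  fixes F :: "real \<Rightarrow> 'a::banach"
  shows "(\<lambda>s. F (t - s)) integrable_on UNIV \<longleftrightarrow> F integrable_on UNIV"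
proof -
  have "(\<lambda>s. F (t - s)) integrable_on UNIV" if "F integrable_on UNIV" for F :: "real \<Rightarrow> 'a"
    using that has_integral_UNIV_affine[of F _ "-1" t] by (auto simp: integrable_on_def)
  from this[of F] this[of "\<lambda>s. F (t - s)"] show ?thesis by auto
qed

lemma integral_UNIV_reflect:
  fixes F :: "real \<Rightarrow> 'a::banach"
  shows "integral UNIV (\<lambda>s. F (t - s)) = integral UNIV F"
proof (cases "F integrable_on UNIV")
  case True
  then have "((\<lambda>s. F (t - s)) has_integral integral UNIV F) UNIV"
    using has_integral_UNIV_affine[OF integrable_integral[OF True], of "-1" t] by simp
  then show ?thesis by (rule integral_unique)
next
  case False
  then show ?thesis using integrable_UNIV_reflect[of F t] by (simp add: not_integrable_integral)
qed

lemma integrable_UNIV_shift: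
  fixes F :: "real \<Rightarrow> 'a::banach"
  shows "(\<lambda>s. F (s + c)) integrable_on UNIV \<longleftrightarrow> F integrable_on UNIV"
  using integrable_UNIV_reflect[of "\<lambda>s. F (c - s)" 0] integrable_UNIV_reflect[of F c]
  by (simp add: add.commute)

lemma integral_UNIV_shift:
  fixes F :: "real \<Rightarrow> 'a::banach"
  shows "integral UNIV (\<lambda>s. F (s + c)) = integral UNIV F"
  using integral_UNIV_reflect[of "\<lambda>s. F (c - s)" 0] integral_UNIV_reflect[of F c]
  by (simp add: add.commute)

text \<open>The Henstock--Kurzweil integral of Banach-valued functions is closed under limits in mean;
  the Bochner integral of the library is not available since the target need not be separable.\<close>

lemma integrable_on_mean_limit:
  fixes F :: "real \<Rightarrow> 'a::banach" and d :: "nat \<Rightarrow> real \<Rightarrow> real"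
  assumes u: "\<And>i. u i integrable_on UNIV" and d: "\<And>i. d i integrable_on UNIV"
    and le: "\<And>i s. norm (F s - u i s) \<le> d i s" and lim: "(\<lambda>i. integral UNIV (d i)) \<longlonglongrightarrow> 0"
  shows "F integrable_on UNIV"
proof -
  have dge: "0 \<le> d i s" for i s using le[of s i] norm_ge_zero order_trans by blast
  have small: "\<exists>i. integral UNIV (d i) < e" if "e > 0" for e
    using order_tendstoD(2)[OF lim that] by (auto simp: eventually_sequentially)
  have ui: "u i integrable_on cbox a b" for i a b
    using integrable_on_subcbox[OF u] by blast
  have di: "d i integrable_on cbox a b" for i a b
    by (rule integrable_on_subcbox[OF d]) simp
  have dle: "integral (cbox a b) (d i) \<le> integral UNIV (d i)" for a b i
    by (rule integral_subset_le[OF subset_UNIV di d]) (simp add: dge)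
  have cb: "F integrable_on cbox a b" for a b
    unfolding integrable_Cauchy
  proof (intro allI impI)
    fix e :: real assume e: "e > 0"
    then obtain i where i: "integral UNIV (d i) < e / 8" using small[of "e/8"] by auto
    have e8: "e / 8 > 0" using e by simp
    obtain g1 where g1: "gauge g1" "\<And>D. D tagged_division_of cbox a b \<Longrightarrow> g1 fine D \<Longrightarrow>
        norm ((\<Sum>(x,K)\<in>D. measure lborel K *\<^sub>R u i x) - integral (cbox a b) (u i)) < e / 8"
      by (rule has_integralD[OF integrable_integral[OF ui[of i a b]] e8]) (rule that)
    obtain g2 where g2: "gauge g2" "\<And>D. D tagged_division_of cbox a b \<Longrightarrow> g2 fine D \<Longrightarrow>
        norm ((\<Sum>(x,K)\<in>D. measure lborel K *\<^sub>R d i x) - integral (cbox a b) (d i)) < e / 8"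
      by (rule has_integralD[OF integrable_integral[OF di[of i a b]] e8]) (rule that)
    \<comment> \<open>The bound \<open>le\<close> compares Riemann sums over one and the same tagged
      division, so the sums of \<open>F\<close> are controlled without any measurability of
      \<open>F\<close>. Two units \<open>e / 8\<close> come from the sums of \<open>d i\<close>, one
      from those of \<open>u i\<close>.\<close>
    have key: "norm ((\<Sum>(x,K)\<in>D. measure lborel K *\<^sub>R F x) - integral (cbox a b) (u i)) < 3 * (e / 8)"
      if D: "D tagged_division_of cbox a b" "g1 fine D" "g2 fine D" for D
    proof -
      have eq: "(\<Sum>(x,K)\<in>D. measure lborel K *\<^sub>R F x) - (\<Sum>(x,K)\<in>D. measure lborel K *\<^sub>R u i x)
          = (\<Sum>(x,K)\<in>D. measure lborel K *\<^sub>R (F x - u i x))"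
        by (simp add: sum_subtractf[symmetric] split_def scaleR_diff_right)
      have "norm (\<Sum>(x,K)\<in>D. measure lborel K *\<^sub>R (F x - u i x)) \<le> (\<Sum>(x,K)\<in>D. measure lborel K *\<^sub>R d i x)"
        unfolding split_def by (rule sum_norm_le) (auto intro!: mult_left_mono le)
      also have "\<dots> < 2 * (e / 8)"
        using g2(2)[OF D(1,3)] dle[of a b i] i unfolding real_norm_def by linarith
      finally have 1: "norm ((\<Sum>(x,K)\<in>D. measure lborel K *\<^sub>R F x) - (\<Sum>(x,K)\<in>D. measure lborel K *\<^sub>R u i x)) < 2 * (e/8)"
        unfolding eq .
      have "norm ((\<Sum>(x,K)\<in>D. measure lborel K *\<^sub>R F x) - integral (cbox a b) (u i)) \<le>
         norm ((\<Sum>(x,K)\<in>D. measure lborel K *\<^sub>R F x) - (\<Sum>(x,K)\<in>D. measure lborel K *\<^sub>R u i x))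
         + norm ((\<Sum>(x,K)\<in>D. measure lborel K *\<^sub>R u i x) - integral (cbox a b) (u i))"
        by (rule order_trans[OF _ norm_triangle_ineq]) simp
      then show ?thesis using 1 g1(2)[OF D(1,2)] by linarith
    qed
    show "\<exists>g. gauge g \<and> (\<forall>D1 D2. D1 tagged_division_of cbox a b \<and> g fine D1 \<and>
        D2 tagged_division_of cbox a b \<and> g fine D2 \<longrightarrow>
        norm ((\<Sum>(x,K)\<in>D1. measure lborel K *\<^sub>R F x) - (\<Sum>(x,K)\<in>D2. measure lborel K *\<^sub>R F x)) < e)"
    proof (intro exI[of _ "\<lambda>x. g1 x \<inter> g2 x"] conjI allI impI)
      show "gauge (\<lambda>x. g1 x \<inter> g2 x)" using g1 g2 by (intro gauge_Int)
      fix D1 D2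
      assume A: "D1 tagged_division_of cbox a b \<and> (\<lambda>x. g1 x \<inter> g2 x) fine D1 \<and>
        D2 tagged_division_of cbox a b \<and> (\<lambda>x. g1 x \<inter> g2 x) fine D2"
      then have "norm ((\<Sum>(x,K)\<in>D1. measure lborel K *\<^sub>R F x) - integral (cbox a b) (u i)) < 3 * (e / 8)"
        "norm ((\<Sum>(x,K)\<in>D2. measure lborel K *\<^sub>R F x) - integral (cbox a b) (u i)) < 3 * (e / 8)"
        using key[of D1] key[of D2] by (simp_all only: fine_Int simp_thms)
      then have "dist (\<Sum>(x,K)\<in>D1. measure lborel K *\<^sub>R F x) (\<Sum>(x,K)\<in>D2. measure lborel K *\<^sub>R F x) < 3 * (e/8) + 3 * (e/8)"
        unfolding dist_norm[symmetric] by (rule order_le_less_trans[OF dist_triangle2 add_strict_mono])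
      then show "norm ((\<Sum>(x,K)\<in>D1. measure lborel K *\<^sub>R F x) - (\<Sum>(x,K)\<in>D2. measure lborel K *\<^sub>R F x)) < e"
        using e by (simp add: dist_norm)
    qed
  qed
  show ?thesis
  proof (subst integrable_alt, intro conjI allI impI)
    fix e :: real assume e: "e > 0"
    then obtain i where i: "integral UNIV (d i) < e / 3" using small[of "e/3"] by auto
    obtain B where B: "B > 0" "\<And>a b c d. ball 0 B \<subseteq> cbox a b \<Longrightarrow> ball 0 B \<subseteq> cbox c d \<Longrightarrow>
       norm (integral (cbox a b) (u i) - integral (cbox c d) (u i)) < e / 3"
      using integrable_altD(2)[OF u[of i], of "e/3"] e by auto
    have near: "norm (integral (cbox a b) F - integral (cbox a b) (u i)) < e / 3" for a b
    proof -
      have "norm (integral (cbox a b) F - integral (cbox a b) (u i))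
        = norm (integral (cbox a b) (\<lambda>x. F x - u i x))" using cb ui by (simp add: integral_diff)
      also have "\<dots> \<le> integral (cbox a b) (d i)"
        by (rule integral_norm_bound_integral[OF integrable_diff[OF cb ui] di le])
      finally show ?thesis using dle[of a b i] i by linarith
    qed
    show "\<exists>B>0. \<forall>a b c d. ball 0 B \<subseteq> cbox a b \<and> ball 0 B \<subseteq> cbox c d \<longrightarrow>
       norm (integral (cbox a b) (\<lambda>x. if x \<in> UNIV then F x else 0)
         - integral (cbox c d) (\<lambda>x. if x \<in> UNIV then F x else 0)) < e"
    proof (intro exI[of _ B] conjI B allI impI)
      fix a b c d :: real assume A: "ball 0 B \<subseteq> cbox a b \<and> ball 0 B \<subseteq> cbox c d"
      have "dist (integral (cbox a b) F) (integral (cbox c d) F) < e/3 + e/3 + e/3"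
        using near[of a b] near[of c d] B(2)[of a b c d] A unfolding dist_norm[symmetric]
        using dist_triangle[of "integral (cbox a b) F" "integral (cbox c d) F" "integral (cbox a b) (u i)"]
          dist_triangle2[of "integral (cbox a b) (u i)" "integral (cbox c d) F" "integral (cbox c d) (u i)"]
        by (simp add: dist_commute)
      then show "norm (integral (cbox a b) (\<lambda>x. if x \<in> UNIV then F x else 0)
         - integral (cbox c d) (\<lambda>x. if x \<in> UNIV then F x else 0)) < e" by (simp add: dist_norm)
    qed
  qed (simp only: UNIV_I if_True cb)
qed

section \<open>Elementary functions and their almost everywhere limits\<close>

inductive elementary :: "(real \<Rightarrow> 'a::real_normed_vector) \<Rightarrow> bool" where
  tensor: "continuous_on UNIV \<phi> \<Longrightarrow> (\<And>s. B < \<bar>s\<bar> \<Longrightarrow> \<phi> s = 0) \<Longrightarrow> elementary (\<lambda>s. (\<phi> s :: real) *\<^sub>R y)"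
| plus: "elementary f \<Longrightarrow> elementary g \<Longrightarrow> elementary (\<lambda>s. f s + g s)"

text \<open>The closure of the elementary functions under sequential limits almost everywhere. This induction
  principle replaces Pettis' theorem and measurability on product spaces.\<close>

inductive smeas :: "(real \<Rightarrow> 'a::real_normed_vector) \<Rightarrow> bool" where
  elem: "elementary f \<Longrightarrow> smeas f"
| lim: "(\<And>i. smeas (u i)) \<Longrightarrow> negligible N \<Longrightarrow> (\<And>s. s \<notin> N \<Longrightarrow> (\<lambda>i. u i s) \<longlonglongrightarrow> f s) \<Longrightarrow> smeas f"

lemma elementary_continuous: "elementary f \<Longrightarrow> continuous_on UNIV f"
  by (induction rule: elementary.induct) (auto intro: continuous_intros)

lemma elementary_support: "elementary f \<Longrightarrow> \<exists>B. \<forall>s. B < \<bar>s\<bar> \<longrightarrow> f s = 0"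
proof (induction rule: elementary.induct)
  case (plus f g)
  then obtain B1 B2 where "\<forall>s. B1 < \<bar>s\<bar> \<longrightarrow> f s = 0" "\<forall>s. B2 < \<bar>s\<bar> \<longrightarrow> g s = 0" by blast
  then show ?case by (intro exI[of _ "max B1 B2"]) auto
qed auto

lemma compact_support_integrable:
  fixes f :: "real \<Rightarrow> 'a::banach"
  assumes f: "continuous_on UNIV f" and B: "\<And>s. B < \<bar>s\<bar> \<Longrightarrow> f s = 0"
  shows "f integrable_on UNIV" "integral UNIV f = integral {-B..B} f"
proof -
  have "f integrable_on {-B..B}" using f by (intro integrable_continuous_real) (rule continuous_on_subset, auto)
  then have h: "(f has_integral integral {-B..B} f) {-B..B}" by (rule integrable_integral)
  have "(f has_integral integral {-B..B} f) UNIV"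
    by (rule has_integral_on_superset[OF h]) (use B in auto)
  then show "f integrable_on UNIV" "integral UNIV f = integral {-B..B} f" by auto
qed

lemma elementary_scale:
  assumes "elementary f" and c: "continuous_on UNIV (c :: real \<Rightarrow> real)"
  shows "elementary (\<lambda>s. c s *\<^sub>R f s)"
  using assms(1)
proof (induction rule: elementary.induct)
  case (tensor \<phi> B y)
  have "elementary (\<lambda>s. (c s * \<phi> s) *\<^sub>R y)"
    by (rule elementary.tensor[where B=B]) (use tensor c in \<open>auto intro: continuous_intros\<close>)
  then show ?case by simp
next
  case (plus f g)
  then show ?case using elementary.plus[OF plus.IH] by (simp add: scaleR_add_right)
qed

lemma elementary_linear:
  assumes "elementary f" and A: "bounded_linear A"
  shows "elementary (\<lambda>s. A (f s))"
  using assms(1)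
proof (induction rule: elementary.induct)
  case (tensor \<phi> B y)
  have "elementary (\<lambda>s. \<phi> s *\<^sub>R A y)" by (rule elementary.tensor[OF tensor])
  then show ?case by (simp add: linear_scale[OF bounded_linear.linear[OF A]])
next
  case (plus f g)
  then show ?case using elementary.plus[OF plus.IH] by (simp add: linear_add[OF bounded_linear.linear[OF A]])
qed

lemma elementary_reflect:
  assumes "elementary f"
  shows "elementary (\<lambda>s. f (t - s))"
  using assms
proof (induction rule: elementary.induct)
  case (tensor \<phi> B y)
  show ?case
  proof (rule elementary.tensor[where B="B + \<bar>t\<bar>"])
    show "continuous_on UNIV (\<lambda>s. \<phi> (t - s))"
      by (rule continuous_on_compose2[OF tensor(1)]) (auto intro: continuous_intros)
  qed (use tensor in auto)
qed (rule elementary.plus)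

lemma negligible_reflect:
  assumes "negligible (N :: real set)" shows "negligible {s. t - s \<in> N}"
proof -
  have "(indicat_real N has_integral 0) UNIV" using assms by (simp add: negligible_UNIV)
  from has_integral_UNIV_affine[OF this, of "-1" t]
  have "((\<lambda>s. indicat_real N (t - s)) has_integral 0) UNIV" by simp
  also have "(\<lambda>s. indicat_real N (t - s)) = indicat_real {s. t - s \<in> N}" by (auto simp: indicator_def)
  finally show ?thesis by (simp add: negligible_UNIV)
qed

lemma smeas_reflect: "smeas f \<Longrightarrow> smeas (\<lambda>s. f (t - s))"
proof (induction rule: smeas.induct)
  case (lim u N f)
  show ?case by (rule smeas.lim[of "\<lambda>i s. u i (t - s)" "{s. t - s \<in> N}", OF lim.IH negligible_reflect[OF lim.hyps(2), of t]]) (use lim in auto)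
qed (auto intro: smeas.elem elementary_reflect)

lemma smeas_shift: "smeas f \<Longrightarrow> smeas (\<lambda>s. f (s + t))"
  using smeas_reflect[OF smeas_reflect, of f t 0] by (simp add: add.commute)

lemma smeas_linear: "smeas f \<Longrightarrow> bounded_linear A \<Longrightarrow> smeas (\<lambda>s. A (f s))"
proof (induction rule: smeas.induct)
  case (lim u N f)
  show ?case by (rule smeas.lim[of "\<lambda>i s. A (u i s)" N, OF lim.IH lim.hyps(2)]) (use lim in \<open>auto intro: bounded_linear.tendsto\<close>)
qed (auto intro: smeas.elem elementary_linear)

lemma smeas_scale: "smeas f \<Longrightarrow> continuous_on UNIV c \<Longrightarrow> smeas (\<lambda>s. (c s :: real) *\<^sub>R f s)"
proof (induction rule: smeas.induct)
  case (lim u N f)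
  show ?case by (rule smeas.lim[of "\<lambda>i s. c s *\<^sub>R u i s" N, OF lim.IH lim.hyps(2)]) (use lim in \<open>auto intro: tendsto_intros\<close>)
qed (auto intro: smeas.elem elementary_scale)

text \<open>The induction principle handles one function at a time: limits are taken in
  \<open>g\<close> for fixed elementary \<open>f\<close>, and afterwards in \<open>f\<close> for
  fixed \<open>g\<close>.\<close>

lemma smeas_add: "smeas f \<Longrightarrow> smeas g \<Longrightarrow> smeas (\<lambda>s. f s + g s)"
proof (induction rule: smeas.induct)
  case (elem f)
  from elem(2) show ?case
  proof (induction rule: smeas.induct)
    case (lim u N g)
    show ?case by (rule smeas.lim[of "\<lambda>i s. f s + u i s" N, OF lim.IH lim.hyps(2)]) (use lim in \<open>auto intro: tendsto_intros\<close>)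
  qed (auto intro: smeas.elem elementary.plus elem)
next
  case (lim u N f)
  show ?case by (rule smeas.lim[of "\<lambda>i s. u i s + g s" N, OF lim.IH[OF lim.prems] lim.hyps(2)]) (use lim in \<open>auto intro: tendsto_intros\<close>)
qed

lemma smeas_scaleR: "smeas f \<Longrightarrow> smeas (\<lambda>s. r *\<^sub>R f s)"
  by (rule smeas_linear[OF _ bounded_linear_scaleR_right])

lemma smeas_diff: "smeas f \<Longrightarrow> smeas g \<Longrightarrow> smeas (\<lambda>s. f s - g s)"
  using smeas_add[of f "\<lambda>s. (-1) *\<^sub>R g s"] smeas_scaleR[of g "-1"] by simp

lemma smeas_zero: "smeas (\<lambda>s. 0)"
proof -
  have "elementary (\<lambda>s. (0::real) *\<^sub>R (0::'a))" by (rule elementary.tensor[where B=0]) auto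
  then show ?thesis by (intro smeas.elem) simp
qed

lemma smeas_sum: "(\<And>i. i \<in> I \<Longrightarrow> smeas (f i)) \<Longrightarrow> smeas (\<lambda>s. \<Sum>i\<in>I. f i s)"
  by (induction I rule: infinite_finite_induct) (auto intro: smeas_zero smeas_add)

definition plateau :: "nat \<Rightarrow> real \<Rightarrow> real"
  where "plateau n s = max 0 (min 1 (real n - \<bar>s\<bar>))"

lemma plateau: "continuous_on UNIV (plateau n)" "real n < \<bar>s\<bar> \<Longrightarrow> plateau n s = 0"
  "0 \<le> plateau n s" "plateau n s \<le> 1"
  unfolding plateau_def by (auto intro!: continuous_intros)

lemma plateau_tendsto: "(\<lambda>n. plateau n s) \<longlonglongrightarrow> 1"
proof -
  obtain k where k: "\<bar>s\<bar> + 1 \<le> real k" using real_arch_simple by blast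
  have "plateau n s = 1" if "n \<ge> k" for n using that k by (auto simp: plateau_def)
  then show ?thesis by (intro tendsto_eventually) (auto simp: eventually_sequentially)
qed

lemma smeas_const: "smeas (\<lambda>s. y)"
proof (rule smeas.lim[of "\<lambda>n s. plateau n s *\<^sub>R y" "{}"])
  show "smeas (\<lambda>s. plateau n s *\<^sub>R y)" for n
    by (rule smeas.elem, rule elementary.tensor[where B = "real n"]) (auto simp: plateau)
  show "(\<lambda>n. plateau n s *\<^sub>R y) \<longlonglongrightarrow> y" for s
    using tendsto_scaleR[OF plateau_tendsto[of s] tendsto_const[of y]] by simp
qed auto

text \<open>A measurable indicator is an almost everywhere limit of continuous scalar functions, and
  \<open>smeas\<close> is stable under continuous multipliers and under such limits.\<close>

lemma smeas_indicator:
  assumes f: "smeas f" and A: "A \<in> sets lebesgue"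
  shows "smeas (\<lambda>s. (indicator A s :: real) *\<^sub>R f s)"
proof -
  have "(indicator A :: real \<Rightarrow> real) measurable_on UNIV"
    using A by (subst measurable_on_iff_borel_measurable) auto
  then obtain N g where N: "negligible N" and g: "\<And>n. continuous_on UNIV (g n)"
    and lim: "\<And>x. x \<notin> N \<Longrightarrow> (\<lambda>n::nat. g n x) \<longlonglongrightarrow> (indicator A x :: real)"
    unfolding measurable_on_def by auto
  show ?thesis
    by (rule smeas.lim[of "\<lambda>n s. g n s *\<^sub>R f s" N])
      (auto intro!: smeas_scale f g N tendsto_intros lim)
qed

lemma smeas_simple:
  assumes u: "simple_function lebesgue (u :: real \<Rightarrow> 'a::real_normed_vector)"
  shows "smeas u"
proof -
  have fin: "finite (range u)" using simple_functionD(1)[OF u] by simp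
  have eq: "u = (\<lambda>s. \<Sum>y\<in>range u. indicator (u -` {y}) s *\<^sub>R y)"
  proof
    fix s
    have "(\<Sum>y\<in>range u. indicator (u -` {y}) s *\<^sub>R y) = (\<Sum>y\<in>range u. if y = u s then y else 0)"
      by (intro sum.cong) (auto simp: indicator_def)
    then show "u s = (\<Sum>y\<in>range u. indicator (u -` {y}) s *\<^sub>R y)" using fin by simp
  qed
  have "u -` {y} \<in> sets lebesgue" for y using simple_functionD(2)[OF u, of "{y}"] by simp
  then show ?thesis by (subst eq) (intro smeas_sum smeas_indicator smeas_const)
qed

lemma strongly_measurable_smeas:
  assumes "strongly_measurable T" shows "smeas (\<lambda>s. T s x)"
proof -
  obtain u where "\<And>i::nat. simple_function lebesgue (u i)" "\<And>t. (\<lambda>i. u i t) \<longlonglongrightarrow> T t x"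
    using assms unfolding strongly_measurable_def by blast
  then show ?thesis by (rule smeas.lim[of u "{}", OF smeas_simple negligible_empty])
qed

text \<open>Convergence at every point, rather than almost everywhere, is what
  \<open>strongly_measurable\<close> demands; the lemma is used again at the very end to show that
  the inverse lies in the weighted algebra.\<close>

lemma continuous_simple_approx:
  fixes g :: "real \<Rightarrow> 'a::real_normed_vector"
  assumes g: "continuous_on UNIV g"
  shows "\<exists>u. (\<forall>i::nat. simple_function lebesgue (u i)) \<and> (\<forall>t. (\<lambda>i. u i t) \<longlonglongrightarrow> g t)"
proof (intro exI conjI allI)
  \<comment> \<open>\<open>u i\<close> samples \<open>g\<close> on the grid of mesh
    \<open>1 / i\<close>. Clipping the index at \<open>i * i\<close> confines the grid to
    \<open>[- i, i]\<close> and makes the range finite. For \<open>i = 0\<close> division by zero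
    just gives the constant \<open>g 0\<close>.\<close>
  define k :: "nat \<Rightarrow> real \<Rightarrow> int" where "k i t = max (- int (i * i)) (min (int (i * i)) \<lfloor>real i * t\<rfloor>)" for i t
  define u where "u i t = g (of_int (k i t) / real i)" for i t
  show "simple_function lebesgue (u i)" for i
  proof -
    have "k i \<in> measurable borel (count_space UNIV)" unfolding k_def by measurable
    then have km: "k i \<in> measurable lebesgue (count_space UNIV)"
      by (intro measurable_completion) (simp add: measurable_def)
    have "range (k i) \<subseteq> {- int (i * i)..int (i * i)}" by (auto simp: k_def)
    then have "finite (range (k i))" using finite_subset by blast
    then have "simple_function lebesgue (k i)"
      unfolding simple_function_def using measurable_sets[OF km] by simp
    then have "simple_function lebesgue ((\<lambda>n. g (of_int n / real i)) \<circ> k i)" by (rule simple_function_compose)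
    moreover have "u i = (\<lambda>n. g (of_int n / real i)) \<circ> k i" by (auto simp: u_def)
    ultimately show ?thesis by simp
  qed
  show "(\<lambda>i. u i t) \<longlonglongrightarrow> g t" for t
  proof -
    have "(\<lambda>i. of_int (k i t) / real i) \<longlonglongrightarrow> t"
    proof (rule Lim_transform_eventually)
      show "(\<lambda>i. of_int \<lfloor>real i * t\<rfloor> / real i) \<longlonglongrightarrow> t"
      proof (rule real_tendsto_sandwich[of "\<lambda>i. t - 1 / real i" _ _ "\<lambda>i. t"])
        have "t - 1 / real i \<le> of_int \<lfloor>real i * t\<rfloor> / real i \<and> of_int \<lfloor>real i * t\<rfloor> / real i \<le> t"
          if "i > 0" for i
        proof -
          have "of_int \<lfloor>real i * t\<rfloor> \<le> real i * t" "real i * t - 1 \<le> of_int \<lfloor>real i * t\<rfloor>" by linarith+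
          from this[THEN divide_right_mono, of "real i"] that show ?thesis by (simp add: diff_divide_distrib)
        qed
        then show "\<forall>\<^sub>F i in sequentially. t - 1 / real i \<le> of_int \<lfloor>real i * t\<rfloor> / real i"
          "\<forall>\<^sub>F i in sequentially. of_int \<lfloor>real i * t\<rfloor> / real i \<le> t"
          by (auto intro!: eventually_sequentiallyI[of 1])
        show "(\<lambda>i. t - 1 / real i) \<longlonglongrightarrow> t"
          using tendsto_diff[OF tendsto_const[of t] lim_1_over_n] by simp
      qed auto
      obtain n0 where n0: "\<bar>t\<bar> + 1 \<le> real n0" using real_arch_simple by blast
      have "k i t = \<lfloor>real i * t\<rfloor>" if "i \<ge> n0" for i
      proof -
        have a: "\<bar>t\<bar> + 1 \<le> real i" using that n0 by linarith
        then have "real i * \<bar>t\<bar> \<le> real i * real i" by (intro mult_left_mono) auto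
        then have "\<bar>real i * t\<bar> \<le> real (i * i)" by (simp only: abs_mult abs_of_nat of_nat_mult)
        then have "real i * t \<le> real (i * i)" "- real (i * i) \<le> real i * t" by linarith+
        then have "\<lfloor>real i * t\<rfloor> \<le> int (i * i)" "- int (i * i) \<le> \<lfloor>real i * t\<rfloor>" by linarith+
        then show ?thesis by (simp add: k_def)
      qed
      then show "\<forall>\<^sub>F i in sequentially. of_int \<lfloor>real i * t\<rfloor> / real i = of_int (k i t) / real i"
        by (auto intro!: eventually_sequentiallyI[of n0])
    qed
    moreover have "isCont g t" using g by (simp add: continuous_on_eq_continuous_at)
    ultimately show ?thesis unfolding u_def by (rule isCont_tendsto_compose[rotated])
  qed
qed

lemma smeas_continuous:
  fixes g :: "real \<Rightarrow> 'a::real_normed_vector"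
  assumes "continuous_on UNIV g" shows "smeas g"
proof -
  obtain u where "\<And>i::nat. simple_function lebesgue (u i)" "\<And>t. (\<lambda>i. u i t) \<longlonglongrightarrow> g t"
    using continuous_simple_approx[OF assms] by blast
  then show ?thesis by (rule smeas.lim[of u "{}", OF smeas_simple negligible_empty])
qed

text \<open>Strong measurability speaks of fixed vectors only. On a tensor the scalar factor is
  pulled out of \<open>T s\<close>, leaving a fixed vector; limits pass through because each
  \<open>T s\<close> is continuous.\<close>

lemma smeas_family:
  assumes T: "\<And>y. smeas (\<lambda>s. T s y)" and lin: "\<And>s. bounded_linear (T s)" and f: "smeas f"
  shows "smeas (\<lambda>s. T s (f s))"
  using f
proof (induction rule: smeas.induct)
  case (elem f)
  then show ?case
  proof (induction rule: elementary.induct)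
    case (tensor \<phi> B y)
    then show ?case using smeas_scale[OF T[of y] tensor(1)]
      by (simp add: linear_scale[OF bounded_linear.linear[OF lin]])
  next
    case (plus f g)
    then show ?case using smeas_add[OF plus.IH] by (simp add: linear_add[OF bounded_linear.linear[OF lin]])
  qed
next
  case (lim u N f)
  show ?case by (rule smeas.lim[of "\<lambda>i s. T s (u i s)" N, OF lim.IH lim.hyps(2)]) (use lim lin in \<open>auto intro: bounded_linear.tendsto\<close>)
qed

text \<open>The radial retraction onto the ball of radius \<open>k s\<close> preserves elementary functions, because it
  only multiplies them by a continuous scalar function.\<close>

lemma smeas_dominated_induct [consumes 4, case_names elem lim]:
  fixes f :: "real \<Rightarrow> 'a::real_normed_vector"
  assumes f: "smeas f" and dom: "\<And>s. norm (f s) \<le> k s"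
    and kc: "continuous_on UNIV k" and kpos: "\<And>s. 0 < (k s :: real)"
    and elem: "\<And>f. elementary f \<Longrightarrow> (\<And>s. norm (f s) \<le> k s) \<Longrightarrow> P f"
    and lim: "\<And>f u N. (\<And>i::nat. P (u i)) \<Longrightarrow> (\<And>i. smeas (u i)) \<Longrightarrow> (\<And>i s. norm (u i s) \<le> k s) \<Longrightarrow>
      smeas f \<Longrightarrow> (\<And>s. norm (f s) \<le> k s) \<Longrightarrow> negligible N \<Longrightarrow>
      (\<And>s. s \<notin> N \<Longrightarrow> (\<lambda>i. u i s) \<longlonglongrightarrow> f s) \<Longrightarrow> P f"
  shows "P f"
proof -
  define r where "r f s = (k s / max (k s) (norm (f s))) *\<^sub>R f s" for f :: "real \<Rightarrow> 'a" and s
  have mpos: "0 < max (k s) a" for s a using kpos[of s] by (simp add: less_max_iff_disj)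
  have r_le: "norm (r f s) \<le> k s" for f s
  proof -
    have "norm (r f s) = k s * (norm (f s) / max (k s) (norm (f s)))"
      using kpos[of s] mpos[of s "norm (f s)"] by (simp add: r_def)
    also have "\<dots> \<le> k s * 1" using kpos[of s] mpos[of s "norm (f s)"]
      by (intro mult_left_mono) (auto simp: divide_le_eq)
    finally show ?thesis by simp
  qed
  have r_id: "r f s = f s" if "norm (f s) \<le> k s" for f s
    using that kpos[of s] by (simp add: r_def max_absorb1)
  \<comment> \<open>The induction runs over functions without bound and proves the claim for their
    retractions, because the approximants provided by \<open>smeas\<close> need not obey the bound
    \<open>k\<close>.\<close>
  have "smeas (r f) \<and> P (r f)" using f
  proof (induction rule: smeas.induct)
    case (elem f)
    have "k s \<noteq> 0 \<and> max (k s) (norm (f s)) \<noteq> 0" for s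
      using mpos[of s "norm (f s)"] kpos[of s] by linarith
    then have "continuous_on UNIV (\<lambda>s. k s / max (k s) (norm (f s)))"
      by (intro continuous_intros kc elementary_continuous[OF elem]) auto
    then have "elementary (r f)" unfolding r_def by (intro elementary_scale elem)
    then show ?case using assms(5)[OF _ r_le] by (auto intro: smeas.elem)
  next
    case (lim u N f)
    have t: "(\<lambda>i. r (u i) s) \<longlonglongrightarrow> r f s" if "s \<notin> N" for s
      unfolding r_def using lim(3)[OF that] mpos[of s "norm (f s)"]
      by (intro tendsto_intros) auto
    have sm: "smeas (r f)" by (rule smeas.lim[of "\<lambda>i. r (u i)" N]) (use lim t in auto)
    show ?case using sm assms(6)[of "\<lambda>i. r (u i)" "r f" N] lim t r_le by auto
  qed
  moreover have "r f = f" using r_id dom by auto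
  ultimately show ?thesis by simp
qed

section \<open>Dominated convergence with values in a Banach space\<close>

lemma dominated_convergence_real_AE:
  fixes f :: "nat \<Rightarrow> real \<Rightarrow> real"
  assumes f: "\<And>i. f i integrable_on UNIV" and h: "h integrable_on UNIV"
    and le: "\<And>i s. norm (f i s) \<le> h s" and N: "negligible N"
    and lim: "\<And>s. s \<notin> N \<Longrightarrow> (\<lambda>i. f i s) \<longlonglongrightarrow> g s"
  shows "g integrable_on UNIV" "(\<lambda>i. integral UNIV (f i)) \<longlonglongrightarrow> integral UNIV g"
proof -
  define f' where "f' i s = (if s \<in> N then 0 else f i s)" for i s
  define g' where "g' s = (if s \<in> N then 0 else g s)" for s
  have f': "f' i integrable_on UNIV" "integral UNIV (f' i) = integral UNIV (f i)" for i
    by (rule integrable_spike[OF f N], simp add: f'_def) (rule integral_spike[OF N], simp add: f'_def)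
  have f'_le: "norm (f' i s) \<le> h s" for i s
    using le[of i s] norm_ge_zero[of "f i s"] by (auto simp: f'_def simp del: norm_ge_zero)
  have f'_lim: "(\<lambda>i. f' i s) \<longlonglongrightarrow> g' s" for s
    using lim by (cases "s \<in> N") (auto simp: f'_def g'_def)
  have "g' integrable_on UNIV \<and> (\<lambda>i. integral UNIV (f' i)) \<longlonglongrightarrow> integral UNIV g'"
    using dominated_convergence[of f' UNIV h g', OF f'(1) h f'_le f'_lim] by blast
  moreover have "g integrable_on UNIV" if "g' integrable_on UNIV"
    by (rule integrable_spike[OF that N]) (simp add: g'_def)
  moreover have "integral UNIV g' = integral UNIV g"
    by (rule integral_spike[OF N]) (simp add: g'_def)
  ultimately show "g integrable_on UNIV" "(\<lambda>i. integral UNIV (f i)) \<longlonglongrightarrow> integral UNIV g"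
    by (auto simp: f')
qed

lemma norm_dominated_integrable:
  fixes f :: "real \<Rightarrow> 'a::real_normed_vector"
  assumes "smeas f" "\<And>s. norm (f s) \<le> k s" "continuous_on UNIV k" "\<And>s. 0 < (k s :: real)"
    and k: "k integrable_on UNIV"
  shows "(\<lambda>s. norm (f s)) integrable_on UNIV"
  using assms(1-4)
proof (induction rule: smeas_dominated_induct)
  case (elem f)
  obtain B where "\<forall>s. B < \<bar>s\<bar> \<longrightarrow> f s = 0" using elementary_support[OF elem(1)] by blast
  then show ?case using elementary_continuous[OF elem(1)]
    by (intro compact_support_integrable[where B=B]) (auto intro: continuous_intros)
next
  case (lim f u N)
  show ?case
    by (rule dominated_convergence_real_AE(1)[of "\<lambda>i s. norm (u i s)" k N])
      (use lim k in \<open>auto intro: tendsto_norm\<close>)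
qed

lemma dominated_mean_tendsto:
  fixes f :: "real \<Rightarrow> 'a::real_normed_vector"
  assumes "smeas f" "\<And>s. norm (f s) \<le> k s" "continuous_on UNIV k" "\<And>s. 0 < (k s :: real)"
    and k: "k integrable_on UNIV"
    and u: "\<And>i::nat. smeas (u i)" "\<And>i s. norm (u i s) \<le> k s" and N: "negligible N"
    and lim: "\<And>s. s \<notin> N \<Longrightarrow> (\<lambda>i. u i s) \<longlonglongrightarrow> f s"
  shows "(\<lambda>s. norm (f s - u i s)) integrable_on UNIV"
    "(\<lambda>i. integral UNIV (\<lambda>s. norm (f s - u i s))) \<longlonglongrightarrow> 0"
proof -
  have le: "norm (f s - u i s) \<le> 2 * k s" for i s
    using norm_triangle_ineq4[of "f s" "u i s"] assms(2)[of s] u(2)[of i s] by linarith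
  show int: "(\<lambda>s. norm (f s - u i s)) integrable_on UNIV" for i
    by (rule norm_dominated_integrable[OF smeas_diff[OF assms(1) u(1)] le])
      (use assms in \<open>auto intro: continuous_intros integrable_on_mult_right\<close>)
  have "(\<lambda>i. integral UNIV (\<lambda>s. norm (f s - u i s))) \<longlonglongrightarrow> integral UNIV (\<lambda>s::real. 0::real)"
  proof (rule dominated_convergence_real_AE(2)[where f = "\<lambda>i s. norm (f s - u i s)" and h = "\<lambda>s. 2 * k s" and N = N and g = "\<lambda>s. 0"])
    show "(\<lambda>i. norm (f s - u i s)) \<longlonglongrightarrow> 0" if "s \<notin> N" for s
      using tendsto_norm[OF tendsto_diff[OF tendsto_const[of "f s"] lim[OF that]]] by simp
  qed (use int k N le in \<open>auto intro: integrable_on_mult_right\<close>)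
  then show "(\<lambda>i. integral UNIV (\<lambda>s. norm (f s - u i s))) \<longlonglongrightarrow> 0" by simp
qed

text \<open>Elementary functions are continuous with compact support. The limit step is closure in
  mean, with majorants \<open>norm (f s - u i s)\<close> whose integrals tend to 0 by scalar
  dominated convergence.\<close>

lemma dominated_integrable:
  fixes f :: "real \<Rightarrow> 'a::banach"
  assumes "smeas f" "\<And>s. norm (f s) \<le> k s" "continuous_on UNIV k" "\<And>s. 0 < (k s :: real)"
    and k: "k integrable_on UNIV"
  shows "f integrable_on UNIV"
  using assms(1-4)
proof (induction rule: smeas_dominated_induct)
  case (elem f)
  obtain B where "\<forall>s. B < \<bar>s\<bar> \<longrightarrow> f s = 0" using elementary_support[OF elem(1)] by blast
  then show ?case using elementary_continuous[OF elem(1)]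
    by (intro compact_support_integrable[where B=B]) auto
next
  case (lim f u N)
  note m = dominated_mean_tendsto[OF lim(4,5) assms(3,4) k lim(2,3,6,7)]
  show ?case
    by (rule integrable_on_mean_limit[of u "\<lambda>i s. norm (f s - u i s)"]) (use lim m in auto)
qed

lemma dominated_convergence_smeas:
  fixes f :: "real \<Rightarrow> 'a::banach"
  assumes "smeas f" "\<And>s. norm (f s) \<le> k s" "continuous_on UNIV k" "\<And>s. 0 < (k s :: real)"
    and k: "k integrable_on UNIV"
    and u: "\<And>i::nat. smeas (u i)" "\<And>i s. norm (u i s) \<le> k s" and N: "negligible N"
    and lim: "\<And>s. s \<notin> N \<Longrightarrow> (\<lambda>i. u i s) \<longlonglongrightarrow> f s"
  shows "(\<lambda>i. integral UNIV (u i)) \<longlonglongrightarrow> integral UNIV f"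
proof -
  note m = dominated_mean_tendsto[OF assms]
  have f: "f integrable_on UNIV" by (rule dominated_integrable[OF assms(1-5)])
  have ui: "u i integrable_on UNIV" for i by (rule dominated_integrable[OF u assms(3-5)])
  have "norm (integral UNIV (u i) - integral UNIV f) \<le> integral UNIV (\<lambda>s. norm (f s - u i s))" for i
  proof -
    have "norm (integral UNIV (u i) - integral UNIV f) = norm (integral UNIV (\<lambda>s. u i s - f s))"
      using f ui by (simp add: integral_diff)
    also have "\<dots> \<le> integral UNIV (\<lambda>s. norm (f s - u i s))"
      by (rule integral_norm_bound_integral) (auto intro!: integrable_diff ui f m simp: norm_minus_commute)
    finally show ?thesis .
  qed
  then have "(\<lambda>i. integral UNIV (u i) - integral UNIV f) \<longlonglongrightarrow> 0"
    by (intro Lim_null_comparison[OF _ m(2)] always_eventually allI)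
  then show ?thesis by (simp add: LIM_zero_iff)
qed

section \<open>Convolution\<close>

text \<open>Equivalent to \<open>jbr t powr (- p)\<close> up to constants.\<close>

definition kern :: "real \<Rightarrow> real \<Rightarrow> real" where "kern p s = (1 + \<bar>s\<bar>) powr (- p)"

lemma kern_pos: "0 < kern p s" and kern_nonneg: "0 \<le> kern p s"
  by (simp_all add: kern_def)

lemma kern_continuous: "continuous_on UNIV (kern p)"
  unfolding kern_def by (intro continuous_intros) auto

lemma kern_le_1: "0 \<le> p \<Longrightarrow> kern p s \<le> 1"
  unfolding kern_def using powr_mono[of "-p" 0 "1 + \<bar>s\<bar>"] powr_zero_eq_one[of "1 + \<bar>s\<bar>"]
  by (auto split: if_splits)

lemma kern_antimono: "0 \<le> p \<Longrightarrow> \<bar>s\<bar> \<le> \<bar>t\<bar> \<Longrightarrow> kern p t \<le> kern p s"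
  unfolding kern_def by (rule powr_mono2') auto

lemma kern_half:
  assumes "0 \<le> p" "1 + \<bar>t\<bar> \<le> 2 * (1 + \<bar>s\<bar>)"
  shows "kern p s \<le> 2 powr p * kern p t"
proof -
  have "kern p s \<le> ((1 + \<bar>t\<bar>) / 2) powr (- p)"
    unfolding kern_def using assms by (intro powr_mono2') auto
  also have "\<dots> = 2 powr p * kern p t"
    unfolding kern_def by (subst powr_divide) (auto simp: powr_minus_divide)
  finally show ?thesis .
qed

text \<open>At least one of \<open>s\<close> and \<open>t - s\<close> has about half the size of
  \<open>t\<close>, and the kernel at that point is comparable to \<open>kern p t\<close>.
  Integrated in \<open>s\<close>, this says that the weighted space is stable under
  convolution.\<close>

lemma kern_mult_le:
  assumes p: "0 \<le> p"
  shows "kern p s * kern p (t - s) \<le> 2 powr p * kern p t * (kern p s + kern p (t - s))"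
proof -
  have "1 + \<bar>t\<bar> \<le> 2 * (1 + \<bar>s\<bar>) \<or> 1 + \<bar>t\<bar> \<le> 2 * (1 + \<bar>t - s\<bar>)"
    using abs_triangle_ineq[of s "t - s"] by auto
  then show ?thesis
  proof
    assume "1 + \<bar>t\<bar> \<le> 2 * (1 + \<bar>s\<bar>)"
    from mult_right_mono[OF kern_half[OF p this] kern_nonneg[of p "t - s"]]
    have "kern p s * kern p (t - s) \<le> 2 powr p * kern p t * kern p (t - s)" .
    also have "\<dots> \<le> 2 powr p * kern p t * (kern p s + kern p (t - s))"
      by (intro mult_left_mono) (auto simp: kern_nonneg)
    finally show ?thesis .
  next
    assume "1 + \<bar>t\<bar> \<le> 2 * (1 + \<bar>t - s\<bar>)"
    from mult_left_mono[OF kern_half[OF p this] kern_nonneg[of p s]]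
    have "kern p s * kern p (t - s) \<le> 2 powr p * kern p t * kern p s" by (simp add: mult_ac)
    also have "\<dots> \<le> 2 powr p * kern p t * (kern p s + kern p (t - s))"
      by (intro mult_left_mono) (auto simp: kern_nonneg)
    finally show ?thesis .
  qed
qed

lemma kern_integrable:
  assumes p: "1 < p" shows "kern p integrable_on UNIV"
proof -
  define F where "F x = (if x \<in> {1..} then x powr (- p) else 0)" for x :: real
  have "F integrable_on UNIV"
    unfolding F_def integrable_restrict_UNIV using has_integral_powr_to_inf[of "-p" 1] p by auto
  then have F1: "(\<lambda>s. F (s + 1)) integrable_on UNIV" and F2: "(\<lambda>s. F (1 - s)) integrable_on UNIV"
    using integrable_UNIV_shift[of F 1] integrable_UNIV_reflect[of F 1] by auto
  show ?thesis
  \<comment> \<open>The two half-line pieces meet only at 0, where they add up to 2 instead of 1;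
    hence the exceptional point.\<close>
  proof (rule integrable_spike[OF integrable_add[OF F1 F2] negligible_sing[of 0]])
    show "kern p s = F (s + 1) + F (1 - s)" if "s \<in> UNIV - {0}" for s
      using that by (auto simp: F_def kern_def add.commute)
  qed
qed

text \<open>The bound is imposed at every \<open>s\<close> and on vectors, so measurability of an
  operator norm never arises. Exceptional null sets are removed when the theorem is reduced to this
  setting.\<close>

definition opfam :: "(real \<Rightarrow> 'a::real_normed_vector \<Rightarrow> 'a) \<Rightarrow> (real \<Rightarrow> real) \<Rightarrow> bool"
  where "opfam A \<alpha> \<longleftrightarrow> (\<forall>y. smeas (\<lambda>s. A s y)) \<and> (\<forall>s. bounded_linear (A s)) \<and> (\<forall>s y. norm (A s y) \<le> \<alpha> s * norm y)"

text \<open>Two normal functionals agree as soon as they agree on tensors \<open>\<phi> s *\<^sub>R y\<close>; this is how iterated integrals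
  are interchanged below.\<close>

definition normal :: "(real \<Rightarrow> real) \<Rightarrow> ((real \<Rightarrow> 'a::real_normed_vector) \<Rightarrow> 'a) \<Rightarrow> bool"
  where "normal k \<Lambda> \<longleftrightarrow>
    (\<forall>f g M. smeas f \<longrightarrow> smeas g \<longrightarrow> (\<forall>s. norm (f s) \<le> M * k s) \<longrightarrow> (\<forall>s. norm (g s) \<le> M * k s) \<longrightarrow>
      \<Lambda> (\<lambda>s. f s + g s) = \<Lambda> f + \<Lambda> g) \<and>
    (\<forall>f u N M. smeas f \<longrightarrow> (\<forall>i::nat. smeas (u i)) \<longrightarrow> (\<forall>s. norm (f s) \<le> M * k s) \<longrightarrow>
      (\<forall>i s. norm (u i s) \<le> M * k s) \<longrightarrow> negligible N \<longrightarrow> (\<forall>s. s \<notin> N \<longrightarrow> (\<lambda>i. u i s) \<longlonglongrightarrow> f s) \<longrightarrow>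
      (\<lambda>i. \<Lambda> (u i)) \<longlonglongrightarrow> \<Lambda> f)"

lemma normal_add: "normal k \<Lambda> \<Longrightarrow> smeas f \<Longrightarrow> smeas g \<Longrightarrow> (\<And>s. norm (f s) \<le> M * k s) \<Longrightarrow>
    (\<And>s. norm (g s) \<le> M * k s) \<Longrightarrow> \<Lambda> (\<lambda>s. f s + g s) = \<Lambda> f + \<Lambda> g"
  unfolding normal_def by blast

lemma normal_lim: "normal k \<Lambda> \<Longrightarrow> smeas f \<Longrightarrow> (\<And>i::nat. smeas (u i)) \<Longrightarrow> (\<And>s. norm (f s) \<le> M * k s) \<Longrightarrow>
    (\<And>i s. norm (u i s) \<le> M * k s) \<Longrightarrow> negligible N \<Longrightarrow> (\<And>s. s \<notin> N \<Longrightarrow> (\<lambda>i. u i s) \<longlonglongrightarrow> f s) \<Longrightarrow>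
    (\<lambda>i. \<Lambda> (u i)) \<longlonglongrightarrow> \<Lambda> f"
  unfolding normal_def by blast

lemma elementary_dominated:
  assumes "elementary f" and k: "continuous_on UNIV k" "\<And>s. 0 < (k s :: real)"
  shows "\<exists>M>0. \<forall>s. norm (f s) \<le> M * k s"
proof -
  obtain B where B: "\<forall>s. B < \<bar>s\<bar> \<longrightarrow> f s = 0" using elementary_support[OF assms(1)] by blast
  have kn: "k s \<noteq> 0" for s using k(2)[of s] by simp
  have "continuous_on UNIV (\<lambda>s. norm (f s) / k s)"
    by (intro continuous_intros elementary_continuous[OF assms(1)] k) (simp add: kn)
  then have "bounded ((\<lambda>s. norm (f s) / k s) ` {-B..B})"
    by (intro compact_imp_bounded compact_continuous_image) (auto intro: continuous_on_subset)
  then obtain M where M: "\<forall>s\<in>{-B..B}. norm (norm (f s) / k s) \<le> M"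
    by (auto simp: bounded_iff)
  have "norm (f s) \<le> (max M 0 + 1) * k s" for s
  proof (cases "s \<in> {-B..B}")
    case True
    then have "\<bar>norm (f s) / k s\<bar> \<le> M" using M unfolding real_norm_def by blast
    then have "norm (f s) / k s \<le> max M 0 + 1" by linarith
    then show ?thesis using k(2)[of s] by (simp add: pos_divide_le_eq)
  next
    case False
    then have "f s = 0" using B by auto
    then show ?thesis using k(2)[of s] by simp
  qed
  then show ?thesis by (intro exI[of _ "max M 0 + 1"]) auto
qed

lemma tensor_dominated:
  fixes \<phi> k :: "real \<Rightarrow> real"
  assumes "continuous_on UNIV \<phi>" "\<And>s. B < \<bar>s\<bar> \<Longrightarrow> \<phi> s = 0" and k: "continuous_on UNIV k" "\<And>s. 0 < (k s :: real)"
  shows "\<exists>M>0. \<forall>s. \<bar>\<phi> s :: real\<bar> \<le> M * k s"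
  using elementary_dominated[OF elementary.tensor[OF assms(1,2), of B "1::real"] k] by simp

lemma normal_eq:
  assumes \<Lambda>: "normal k \<Lambda>1" "normal k \<Lambda>2" and k: "continuous_on UNIV k" "\<And>s. 0 < (k s :: real)"
    and f: "smeas f" "\<And>s. norm (f s) \<le> M * k s"
    and tensor: "\<And>\<phi> B y. continuous_on UNIV \<phi> \<Longrightarrow> (\<And>s. B < \<bar>s\<bar> \<Longrightarrow> \<phi> s = 0) \<Longrightarrow>
      \<Lambda>1 (\<lambda>s. (\<phi> s :: real) *\<^sub>R y) = \<Lambda>2 (\<lambda>s. \<phi> s *\<^sub>R y)"
  shows "\<Lambda>1 f = \<Lambda>2 f"
proof -
  \<comment> \<open>\<open>\<bar>M\<bar> + 1\<close> in place of \<open>M\<close> makes the majorant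
    strictly positive, as \<open>smeas_dominated_induct\<close> requires.\<close>
  define K where "K s = (\<bar>M\<bar> + 1) * k s" for s
  have "norm (f s) \<le> K s" for s
    using f(2)[of s] mult_right_mono[of M "\<bar>M\<bar> + 1" "k s"] k(2)[of s] unfolding K_def by linarith
  note K_le = this
  have K: "continuous_on UNIV K" "\<And>s. 0 < K s"
    using k by (auto simp: K_def intro!: continuous_intros)
  show ?thesis using f(1) K_le K
  proof (induction rule: smeas_dominated_induct)
    case (elem f)
    from elem(1) show ?case
    proof (induction rule: elementary.induct)
      case (plus f g)
      obtain M1 M2 where M: "M1 > 0" "M2 > 0" "\<And>s. norm (f s) \<le> M1 * k s" "\<And>s. norm (g s) \<le> M2 * k s"
        using elementary_dominated[OF plus(1) k] elementary_dominated[OF plus(2) k] by blast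
      have M': "norm (f s) \<le> (M1 + M2) * k s" "norm (g s) \<le> (M1 + M2) * k s" for s
        using M(3,4)[of s] M(1,2) k(2)[of s] mult_pos_pos[of M1 "k s"] mult_pos_pos[of M2 "k s"]
        unfolding distrib_right by linarith+
      show ?case
        using normal_add[OF \<Lambda>(1) smeas.elem[OF plus(1)] smeas.elem[OF plus(2)] M']
          normal_add[OF \<Lambda>(2) smeas.elem[OF plus(1)] smeas.elem[OF plus(2)] M'] plus.IH by simp
    qed (rule tensor)
  next
    case (lim f u N)
    have "(\<lambda>i. \<Lambda>1 (u i)) \<longlonglongrightarrow> \<Lambda>1 f" "(\<lambda>i. \<Lambda>2 (u i)) \<longlonglongrightarrow> \<Lambda>2 f"
      using normal_lim[OF \<Lambda>(1) lim(4,2) lim(5,3)[unfolded K_def] lim(6,7)]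
        normal_lim[OF \<Lambda>(2) lim(4,2) lim(5,3)[unfolded K_def] lim(6,7)] by auto
    then show ?case using lim(1) LIMSEQ_unique by auto
  qed
qed

context
  fixes p :: real
  assumes p: "1 < p"
begin

definition kint :: real where "kint = integral UNIV (kern p)"

lemma kint_nonneg: "0 \<le> kint" unfolding kint_def
  by (intro integral_nonneg kern_integrable p) (simp add: kern_nonneg)

lemma kern_dom_integrable:
  fixes f :: "real \<Rightarrow> 'a::banach"
  assumes f: "smeas f" "\<And>s. norm (f s) \<le> M * kern p s"
  shows "f integrable_on UNIV" "(\<lambda>s. norm (f s)) integrable_on UNIV" "norm (integral UNIV f) \<le> M * kint"
proof -
  have le: "norm (f s) \<le> (\<bar>M\<bar> + 1) * kern p s" for s
    using f(2)[of s] mult_right_mono[of M "\<bar>M\<bar> + 1" "kern p s"] kern_pos[of p s] by linarith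
  have kc: "continuous_on UNIV (\<lambda>s. (\<bar>M\<bar> + 1) * kern p s)" "\<And>s. 0 < (\<bar>M\<bar> + 1) * kern p s"
    "(\<lambda>s. (\<bar>M\<bar> + 1) * kern p s) integrable_on UNIV"
    by (auto intro!: continuous_intros kern_continuous integrable_on_mult_right kern_integrable p simp: kern_pos)
  show i: "f integrable_on UNIV" by (rule dominated_integrable[OF f(1) le kc])
  show "(\<lambda>s. norm (f s)) integrable_on UNIV" by (rule norm_dominated_integrable[OF f(1) le kc])
  have "norm (integral UNIV f) \<le> integral UNIV (\<lambda>s. M * kern p s)"
    by (rule integral_norm_bound_integral[OF i]) (auto intro: f integrable_on_mult_right kern_integrable p)
  then show "norm (integral UNIV f) \<le> M * kint" by (simp add: kint_def)
qed

lemma kern_dom_convergence: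
  fixes f :: "real \<Rightarrow> 'a::banach"
  assumes f: "smeas f" "\<And>s. norm (f s) \<le> M * kern p s"
    and u: "\<And>i::nat. smeas (u i)" "\<And>i s. norm (u i s) \<le> M * kern p s"
    and N: "negligible N" and lim: "\<And>s. s \<notin> N \<Longrightarrow> (\<lambda>i. u i s) \<longlonglongrightarrow> f s"
  shows "(\<lambda>i. integral UNIV (u i)) \<longlonglongrightarrow> integral UNIV f"
    "(\<lambda>i. integral UNIV (\<lambda>s. norm (f s - u i s))) \<longlonglongrightarrow> 0"
proof -
  have M: "M * kern p s \<le> (\<bar>M\<bar> + 1) * kern p s" for s
    using mult_right_mono[of M "\<bar>M\<bar> + 1" "kern p s"] kern_pos[of p s] by linarith
  note le = order_trans[OF f(2) M] order_trans[OF u(2) M]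
  have kc: "continuous_on UNIV (\<lambda>s. (\<bar>M\<bar> + 1) * kern p s)" "\<And>s. 0 < (\<bar>M\<bar> + 1) * kern p s"
    "(\<lambda>s. (\<bar>M\<bar> + 1) * kern p s) integrable_on UNIV"
    by (auto intro!: continuous_intros kern_continuous integrable_on_mult_right kern_integrable p simp: kern_pos)
  show "(\<lambda>i. integral UNIV (u i)) \<longlonglongrightarrow> integral UNIV f"
    by (rule dominated_convergence_smeas[OF f(1) le(1) kc u(1) le(2) N lim])
  show "(\<lambda>i. integral UNIV (\<lambda>s. norm (f s - u i s))) \<longlonglongrightarrow> 0"
    by (rule dominated_mean_tendsto(2)[OF f(1) le(1) kc u(1) le(2) N lim])
qed

lemma kern_dom_continuous:
  fixes F :: "real \<Rightarrow> real \<Rightarrow> 'a::banach"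
  assumes F: "\<And>t. smeas (F t)" "\<And>t s. norm (F t s) \<le> M * kern p s" "\<And>s. continuous_on UNIV (\<lambda>t. F t s)"
  shows "continuous_on UNIV (\<lambda>t. integral UNIV (F t))"
  unfolding continuous_on_sequentially comp_def
proof (intro allI ballI impI)
  fix x :: "nat \<Rightarrow> real" and a assume "(\<forall>n. x n \<in> UNIV) \<and> x \<longlonglongrightarrow> a"
  then show "(\<lambda>n. integral UNIV (F (x n))) \<longlonglongrightarrow> integral UNIV (F a)"
    by (intro kern_dom_convergence(1)[where N = "{}" and M = M] F negligible_empty)
      (use F(3) in \<open>auto simp: continuous_on_sequentially comp_def\<close>)
qed

text \<open>The source of all normal functionals below. \<sigma> stands for the identity, a
  reflection or a shift of the line, and the bound on \<open>\<alpha> s * k (\<sigma> s)\<close>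
  makes the integrand a multiple of \<open>kern p\<close>, so that dominated convergence
  applies.\<close>

lemma normal_atomic:
  fixes A :: "real \<Rightarrow> 'a::banach \<Rightarrow> 'a"
  assumes A: "opfam A \<alpha>" and dom: "\<And>s. \<alpha> s * k (\<sigma> s) \<le> D * kern p s" and \<alpha>: "\<And>s. 0 \<le> \<alpha> s"
    and \<sigma>: "\<And>f :: real \<Rightarrow> 'a. smeas f \<Longrightarrow> smeas (\<lambda>s. f (\<sigma> s))" "\<And>N. negligible N \<Longrightarrow> negligible {s. \<sigma> s \<in> N}"
    and k: "\<And>s. 0 < k s"
  shows "normal k (\<lambda>f. integral UNIV (\<lambda>s. A s (f (\<sigma> s))))"
    and "smeas f \<Longrightarrow> (\<And>s. norm (f s) \<le> M * k s) \<Longrightarrow> norm (integral UNIV (\<lambda>s. A s (f (\<sigma> s)))) \<le> (M * D) * kint"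
    and "smeas f \<Longrightarrow> (\<And>s. norm (f s) \<le> M * k s) \<Longrightarrow> norm (A s (f (\<sigma> s))) \<le> (M * D) * kern p s"
    and "smeas f \<Longrightarrow> smeas (\<lambda>s. A s (f (\<sigma> s)))"
proof -
  have sm: "smeas (\<lambda>s. A s (f (\<sigma> s)))" if "smeas f" for f
    using A \<sigma>(1)[OF that] by (auto simp: opfam_def intro: smeas_family)
  have le: "norm (A s (f (\<sigma> s))) \<le> (M * D) * kern p s" if "\<And>s. norm (f s) \<le> M * k s" for f M s
  proof -
    have "0 \<le> M * k 0" using that[of 0] norm_ge_zero order_trans by blast
    then have M: "0 \<le> M" using k[of 0] by (simp add: zero_le_mult_iff)
    have "norm (A s (f (\<sigma> s))) \<le> \<alpha> s * norm (f (\<sigma> s))" using A by (simp add: opfam_def)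
    also have "\<dots> \<le> \<alpha> s * (M * k (\<sigma> s))" by (intro mult_left_mono that \<alpha>)
    also have "\<dots> \<le> M * (D * kern p s)" using mult_left_mono[OF dom M, of s] by (simp add: mult_ac)
    finally show ?thesis by simp
  qed
  have addA: "A s (x + y) = A s x + A s y" for s x y
    using A by (intro linear_add bounded_linear.linear) (simp add: opfam_def)
  show "normal k (\<lambda>f. integral UNIV (\<lambda>s. A s (f (\<sigma> s))))"
    unfolding normal_def
  proof (intro conjI allI impI)
    fix f g :: "real \<Rightarrow> 'a" and M
    assume "smeas f" "smeas g" "\<forall>s. norm (f s) \<le> M * k s" "\<forall>s. norm (g s) \<le> M * k s"
    then show "integral UNIV (\<lambda>s. A s (f (\<sigma> s) + g (\<sigma> s))) =
       integral UNIV (\<lambda>s. A s (f (\<sigma> s))) + integral UNIV (\<lambda>s. A s (g (\<sigma> s)))"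
      unfolding addA by (intro integral_add kern_dom_integrable(1)[OF sm le]) auto
  next
    fix f :: "real \<Rightarrow> 'a" and u :: "nat \<Rightarrow> real \<Rightarrow> 'a" and N M
    assume *: "smeas f" "\<forall>i. smeas (u i)" "\<forall>s. norm (f s) \<le> M * k s" "\<forall>i s. norm (u i s) \<le> M * k s"
      "negligible N" "\<forall>s. s \<notin> N \<longrightarrow> (\<lambda>i. u i s) \<longlonglongrightarrow> f s"
    show "(\<lambda>i. integral UNIV (\<lambda>s. A s (u i (\<sigma> s)))) \<longlonglongrightarrow> integral UNIV (\<lambda>s. A s (f (\<sigma> s)))"
    proof (rule kern_dom_convergence(1)[where N = "{s. \<sigma> s \<in> N}" and M = "M * D"])
      show "(\<lambda>i. A s (u i (\<sigma> s))) \<longlonglongrightarrow> A s (f (\<sigma> s))" if "s \<notin> {s. \<sigma> s \<in> N}" for s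
        using * that A by (intro bounded_linear.tendsto[of "A s"]) (auto simp: opfam_def)
    qed (use * in \<open>auto intro: sm le \<sigma>\<close>)
  qed
  show "smeas f \<Longrightarrow> (\<And>s. norm (f s) \<le> M * k s) \<Longrightarrow> norm (integral UNIV (\<lambda>s. A s (f (\<sigma> s)))) \<le> (M * D) * kint"
    by (rule kern_dom_integrable(3)[OF sm le])
  show "smeas f \<Longrightarrow> (\<And>s. norm (f s) \<le> M * k s) \<Longrightarrow> norm (A s (f (\<sigma> s))) \<le> (M * D) * kern p s"
    by (rule le)
  show "smeas f \<Longrightarrow> smeas (\<lambda>s. A s (f (\<sigma> s)))" by (rule sm)
qed

text \<open>Dominated convergence in the outer variable, after normality of the inner functional for
  each fixed \<open>u\<close>. In this way both sides of an interchange formula are seen to be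
  normal, and \<open>normal_eq\<close> reduces the formula to tensors.\<close>

lemma normal_iterate:
  fixes A :: "real \<Rightarrow> 'a::banach \<Rightarrow> 'a"
  assumes A: "opfam A (\<lambda>s. C * kern p s)" and C: "C \<ge> 0" and \<Lambda>: "\<And>u. normal k (\<Lambda> u)"
    and sm: "\<And>f M. smeas f \<Longrightarrow> (\<And>s. norm (f s) \<le> M * k s) \<Longrightarrow> smeas (\<lambda>u. \<Lambda> u f)"
    and le: "\<And>f M u. smeas f \<Longrightarrow> (\<And>s. norm (f s) \<le> M * k s) \<Longrightarrow> norm (\<Lambda> u f) \<le> M * D"
  shows "normal k (\<lambda>f. integral UNIV (\<lambda>u. A u (\<Lambda> u f)))"
proof -
  have smA: "smeas (\<lambda>u. A u (\<Lambda> u f))" if "smeas f" "\<And>s. norm (f s) \<le> M * k s" for f M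
    using A sm[OF that] by (auto simp: opfam_def intro: smeas_family)
  have leA: "norm (A u (\<Lambda> u f)) \<le> (C * (M * D)) * kern p u" if "smeas f" "\<And>s. norm (f s) \<le> M * k s" for f M u
  proof -
    have "norm (A u (\<Lambda> u f)) \<le> C * kern p u * norm (\<Lambda> u f)" using A by (simp add: opfam_def)
    also have "\<dots> \<le> C * kern p u * (M * D)" using C by (intro mult_left_mono le that) (auto simp: kern_nonneg)
    finally show ?thesis by (simp add: mult_ac)
  qed
  have addA: "A s (x + y) = A s x + A s y" for s x y
    using A by (intro linear_add bounded_linear.linear) (simp add: opfam_def)
  show ?thesis
    unfolding normal_def
  proof (intro conjI allI impI)
    fix f g :: "real \<Rightarrow> 'a" and M
    assume *: "smeas f" "smeas g" "\<forall>s. norm (f s) \<le> M * k s" "\<forall>s. norm (g s) \<le> M * k s"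
    then have "\<Lambda> u (\<lambda>s. f s + g s) = \<Lambda> u f + \<Lambda> u g" for u by (intro normal_add[OF \<Lambda>]) auto
    then show "integral UNIV (\<lambda>u. A u (\<Lambda> u (\<lambda>s. f s + g s))) =
       integral UNIV (\<lambda>u. A u (\<Lambda> u f)) + integral UNIV (\<lambda>u. A u (\<Lambda> u g))"
      using * by (simp add: addA) (intro integral_add kern_dom_integrable(1)[OF smA leA], auto)
  next
    fix f :: "real \<Rightarrow> 'a" and u :: "nat \<Rightarrow> real \<Rightarrow> 'a" and N M
    assume *: "smeas f" "\<forall>i. smeas (u i)" "\<forall>s. norm (f s) \<le> M * k s" "\<forall>i s. norm (u i s) \<le> M * k s"
      "negligible N" "\<forall>s. s \<notin> N \<longrightarrow> (\<lambda>i. u i s) \<longlonglongrightarrow> f s"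
    have "(\<lambda>i. \<Lambda> v (u i)) \<longlonglongrightarrow> \<Lambda> v f" for v
      using * by (intro normal_lim[OF \<Lambda>, where N=N and M=M]) auto
    note lim = this
    have bl: "bounded_linear (A v)" for v using A by (simp add: opfam_def)
    show "(\<lambda>i. integral UNIV (\<lambda>v. A v (\<Lambda> v (u i)))) \<longlonglongrightarrow> integral UNIV (\<lambda>v. A v (\<Lambda> v f))"
    proof (rule kern_dom_convergence(1)[where N = "{}" and M = "C * (M * D)"])
      show "smeas (\<lambda>v. A v (\<Lambda> v f))" by (rule smA[where M=M]) (use * in auto)
      show "norm (A v (\<Lambda> v f)) \<le> C * (M * D) * kern p v" for v by (rule leA) (use * in auto)
      show "smeas (\<lambda>v. A v (\<Lambda> v (u i)))" for i by (rule smA[where M=M]) (use * in auto)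
      show "norm (A v (\<Lambda> v (u i))) \<le> C * (M * D) * kern p v" for i v by (rule leA) (use * in auto)
      show "(\<lambda>i. A v (\<Lambda> v (u i))) \<longlonglongrightarrow> A v (\<Lambda> v f)" for v
        by (rule bounded_linear.tendsto[OF bl lim])
    qed simp
  qed
qed

end

section \<open>Interchange of iterated integrals\<close>

lemma integral_UNIV_support:
  fixes f :: "real \<Rightarrow> 'a::banach"
  assumes "\<And>s. s \<notin> S \<Longrightarrow> f s = 0"
  shows "integral UNIV f = integral S f"
  by (subst integral_restrict_UNIV[symmetric]) (rule integral_cong, use assms in auto)

lemma integral_UNIV_scaleR_left:
  fixes c :: "'a::banach"
  assumes "f integrable_on UNIV"
  shows "integral UNIV (\<lambda>s. f s *\<^sub>R c) = integral UNIV f *\<^sub>R c"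
  using has_integral_scaleR_left[OF integrable_integral[OF assms]] by (rule integral_unique)

text \<open>The substitution \<open>u = s + r\<close> leads to a continuous integrand on a compact
  rectangle, where the order of integration may be swapped. The vector and operator valued versions
  are bootstrapped from this case, one argument at a time.\<close>

lemma scalar_fubini:
  fixes \<zeta> \<phi> \<psi> :: "real \<Rightarrow> real"
  assumes c: "continuous_on UNIV \<zeta>" "continuous_on UNIV \<phi>" "continuous_on UNIV \<psi>"
    and B1: "\<And>s. B1 < \<bar>s\<bar> \<Longrightarrow> \<zeta> s = 0" and B2: "\<And>s. B2 < \<bar>s\<bar> \<Longrightarrow> \<phi> s = 0"
  shows "integral UNIV (\<lambda>s. integral UNIV (\<lambda>r. \<phi> (s + r) * \<psi> r) * \<zeta> s) =
    integral UNIV (\<lambda>u. \<phi> u * integral UNIV (\<lambda>s. \<psi> (u - s) * \<zeta> s))"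
proof -
  have in1: "integral UNIV (\<lambda>r. \<phi> (s + r) * \<psi> r) = integral {-B2..B2} (\<lambda>u. \<phi> u * \<psi> (u - s))" for s
  proof -
    have "integral UNIV (\<lambda>r. \<phi> (s + r) * \<psi> r) = integral UNIV (\<lambda>u. \<phi> u * \<psi> (u - s))"
      using integral_UNIV_shift[of "\<lambda>u. \<phi> u * \<psi> (u - s)" s] by (simp add: add.commute)
    also have "\<dots> = integral {-B2..B2} (\<lambda>u. \<phi> u * \<psi> (u - s))"
      by (rule integral_UNIV_support) (use B2 in \<open>auto simp: abs_if split: if_splits\<close>)
    finally show ?thesis .
  qed
  have in2: "integral UNIV (\<lambda>s. \<psi> (u - s) * \<zeta> s) = integral {-B1..B1} (\<lambda>s. \<psi> (u - s) * \<zeta> s)" for u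
    by (rule integral_UNIV_support) (use B1 in \<open>auto simp: abs_if split: if_splits\<close>)
  have cont: "continuous_on S (\<lambda>(s, u). \<phi> u * \<psi> (u - s) * \<zeta> s)" for S
    unfolding split_def
    by (intro continuous_intros continuous_on_compose2[OF c(1)] continuous_on_compose2[OF c(2)] continuous_on_compose2[OF c(3)]) auto
  have "integral UNIV (\<lambda>s. integral UNIV (\<lambda>r. \<phi> (s + r) * \<psi> r) * \<zeta> s)
      = integral {-B1..B1} (\<lambda>s. integral {-B2..B2} (\<lambda>u. \<phi> u * \<psi> (u - s)) * \<zeta> s)"
    unfolding in1 by (rule integral_UNIV_support) (use B1 in \<open>auto simp: abs_if split: if_splits\<close>)
  also have "\<dots> = integral {-B1..B1} (\<lambda>s. integral {-B2..B2} (\<lambda>u. \<phi> u * \<psi> (u - s) * \<zeta> s))"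
    by simp
  also have "\<dots> = integral {-B2..B2} (\<lambda>u. integral {-B1..B1} (\<lambda>s. \<phi> u * \<psi> (u - s) * \<zeta> s))"
    using integral_swap_continuous[OF cont, of "-B1" B1 "-B2" B2] by simp
  also have "\<dots> = integral {-B2..B2} (\<lambda>u. \<phi> u * integral {-B1..B1} (\<lambda>s. \<psi> (u - s) * \<zeta> s))"
    by (simp add: mult.assoc)
  also have "\<dots> = integral UNIV (\<lambda>u. \<phi> u * integral UNIV (\<lambda>s. \<psi> (u - s) * \<zeta> s))"
    unfolding in2 by (rule integral_UNIV_support[symmetric]) (use B2 in \<open>auto simp: abs_if split: if_splits\<close>)
  finally show ?thesis .
qed

lemma opfam_scaleR:
  assumes "continuous_on UNIV a" "\<And>s. \<bar>a s\<bar> \<le> \<alpha> s"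
  shows "opfam (\<lambda>s y. (a s :: real) *\<^sub>R y) \<alpha>"
  unfolding opfam_def
  using assms by (auto intro!: smeas_continuous continuous_intros bounded_linear_scaleR_right mult_right_mono)

lemma opfam_linear: "opfam T \<alpha> \<Longrightarrow> bounded_linear (T s)"
  and opfam_smeas: "opfam T \<alpha> \<Longrightarrow> smeas (\<lambda>s. T s y)"
  and opfam_le: "opfam T \<alpha> \<Longrightarrow> norm (T s y) \<le> \<alpha> s * norm y"
  by (auto simp: opfam_def)

lemma opfam_scale: "opfam T \<alpha> \<Longrightarrow> T s (r *\<^sub>R y) = r *\<^sub>R T s y"
  by (intro linear_scale bounded_linear.linear opfam_linear)

context
  fixes p :: real
  assumes p: "1 < p"
begin

lemma p0: "0 \<le> p" using p by simp

lemma scaled_kern: "opfam T (\<lambda>s. C * kern p s) \<Longrightarrow> 0 \<le> C \<Longrightarrow> norm y \<le> M \<Longrightarrow> norm (T s y) \<le> (C * M) * kern p s"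
  using opfam_le[of T "\<lambda>s. C * kern p s" s y] mult_left_mono[of "norm y" M "C * kern p s"] kern_nonneg[of p s]
  by (simp add: mult_ac)

lemma conv_bounded_continuous:
  fixes T :: "real \<Rightarrow> 'a::banach \<Rightarrow> 'a"
  assumes T: "opfam T (\<lambda>s. C * kern p s)" and C: "0 \<le> C"
    and f: "continuous_on UNIV f" "\<And>s. norm (f s) \<le> M"
  shows "continuous_on UNIV (\<lambda>t. integral UNIV (\<lambda>s. T s (f (t - s))))"
proof (rule kern_dom_continuous[OF p, where M = "C * M"])
  show "smeas (\<lambda>s. T s (f (t - s)))" for t
    by (rule smeas_family[OF opfam_smeas[OF T] opfam_linear[OF T] smeas_reflect[OF smeas_continuous[OF f(1)]]])
  show "norm (T s (f (t - s))) \<le> C * M * kern p s" for t s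
    by (rule scaled_kern[OF T C f(2)])
  show "continuous_on UNIV (\<lambda>t. T s (f (t - s)))" for s
    by (intro bounded_linear.continuous_on[OF opfam_linear[OF T]] continuous_on_compose2[OF f(1)] continuous_intros) auto
qed

text \<open>Replacing \<open>g\<close> by an approximant in mean changes the convolution by at most
  \<open>C\<close> times the mean distance, uniformly in \<open>t\<close>, because
  \<open>kern\<close> is at most 1. The continuity so obtained takes over the role of joint
  measurability.\<close>

lemma conv_continuous:
  fixes T :: "real \<Rightarrow> 'a::banach \<Rightarrow> 'a"
  assumes T: "opfam T (\<lambda>s. C * kern p s)" and C: "0 \<le> C"
    and g: "smeas g" "\<And>s. norm (g s) \<le> M * kern p s"
  shows "continuous_on UNIV (\<lambda>t. integral UNIV (\<lambda>s. T s (g (t - s))))"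
proof -
  define K where "K s = (\<bar>M\<bar> + 1) * kern p s" for s
  have le: "norm (g s) \<le> K s" for s
    using g(2)[of s] mult_right_mono[of M "\<bar>M\<bar> + 1" "kern p s"] kern_pos[of p s] unfolding K_def by linarith
  have K: "continuous_on UNIV K" "\<And>s. 0 < K s"
    by (auto simp: K_def kern_pos intro!: continuous_intros kern_continuous)
  have sm: "smeas (\<lambda>s. T s (g (t - s)))" if "smeas g" for t g
    by (rule smeas_family[OF opfam_smeas[OF T] opfam_linear[OF T] smeas_reflect[OF that]])
  have dom: "norm (T s (g (t - s))) \<le> C * (\<bar>M\<bar> + 1) * kern p s" if "\<And>s. norm (g s) \<le> K s" for t s g
  proof (rule scaled_kern[OF T C])
    have "K (t - s) \<le> \<bar>M\<bar> + 1" unfolding K_def using kern_le_1[OF p0, of "t - s"]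
      using mult_left_mono[of "kern p (t - s)" 1 "\<bar>M\<bar> + 1"] by simp
    then show "norm (g (t - s)) \<le> \<bar>M\<bar> + 1" using that[of "t - s"] by linarith
  qed
  show ?thesis using g(1) le K
  proof (induction rule: smeas_dominated_induct)
    case (elem g)
    obtain M' where "\<forall>s. norm (g s) \<le> M' * 1"
      using elementary_dominated[OF elem(1), of "\<lambda>_. 1"] by auto
    then show ?case by (intro conv_bounded_continuous[OF T C elementary_continuous[OF elem(1)], of M']) auto
  next
    case (lim f u N)
    show ?case
    proof (rule uniform_limit_theorem[OF always_eventually[OF allI[OF lim(1)]]])
      show "uniform_limit UNIV (\<lambda>i t. integral UNIV (\<lambda>s. T s (u i (t - s)))) (\<lambda>t. integral UNIV (\<lambda>s. T s (f (t - s)))) sequentially"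
      proof (rule uniform_limitI)
        fix e :: real assume e: "e > 0"
        define d where "d i = integral UNIV (\<lambda>s. norm (f s - u i s))" for i
        have "d \<longlonglongrightarrow> 0" unfolding d_def
          by (rule kern_dom_convergence(2)[OF p lim(4) lim(5)[unfolded K_def] lim(2) lim(3)[unfolded K_def] lim(6,7)])
        then have "(\<lambda>i. C * d i) \<longlonglongrightarrow> 0" by (rule tendsto_mult_right_zero)
        then have ev: "\<forall>\<^sub>F i in sequentially. C * d i < e" using order_tendstoD(2) e by blast
        have "dist (integral UNIV (\<lambda>s. T s (u i (t - s)))) (integral UNIV (\<lambda>s. T s (f (t - s)))) \<le> C * d i" for i t
        proof -
          have i1: "(\<lambda>s. T s (u i (t - s))) integrable_on UNIV" "(\<lambda>s. T s (f (t - s))) integrable_on UNIV"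
            by (rule kern_dom_integrable(1)[OF p sm dom]; use lim in auto)+
          have i2: "(\<lambda>s. norm (f s - u i s)) integrable_on UNIV"
          proof (rule kern_dom_integrable(2)[OF p smeas_diff[OF lim(4,2)]])
            show "norm (f s - u i s) \<le> (2 * (\<bar>M\<bar> + 1)) * kern p s" for s
              using norm_triangle_ineq4[of "f s" "u i s"] lim(3)[of i s] lim(5)[of s]
              unfolding K_def mult_2 distrib_right by linarith
          qed
          have i3: "(\<lambda>s. norm (f (t - s) - u i (t - s))) integrable_on UNIV"
            using i2 integrable_UNIV_reflect[of "\<lambda>s. norm (f s - u i s)" t] by simp
          have "dist (integral UNIV (\<lambda>s. T s (u i (t - s)))) (integral UNIV (\<lambda>s. T s (f (t - s))))
            = norm (integral UNIV (\<lambda>s. T s (u i (t - s)) - T s (f (t - s))))"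
            unfolding dist_norm using i1 by (simp add: integral_diff)
          also have "\<dots> \<le> integral UNIV (\<lambda>s. C * norm (f (t - s) - u i (t - s)))"
          proof (rule integral_norm_bound_integral)
            fix s
            have "norm (T s (u i (t - s)) - T s (f (t - s))) = norm (T s (u i (t - s) - f (t - s)))"
              by (simp add: linear_diff[OF bounded_linear.linear[OF opfam_linear[OF T]]])
            also have "\<dots> \<le> C * kern p s * norm (u i (t - s) - f (t - s))" by (rule opfam_le[OF T])
            also have "\<dots> \<le> C * norm (f (t - s) - u i (t - s))"
              using kern_le_1[OF p0, of s] kern_nonneg[of p s] C
              by (simp add: norm_minus_commute mult_left_le mult_right_mono)
            finally show "norm (T s (u i (t - s)) - T s (f (t - s))) \<le> C * norm (f (t - s) - u i (t - s))" .
          qed (auto intro!: integrable_diff i1 integrable_on_mult_right i3)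
          also have "\<dots> = C * d i" unfolding d_def
            using integral_UNIV_reflect[of "\<lambda>s. norm (f s - u i s)" t] by simp
          finally show ?thesis .
        qed
        then show "\<forall>\<^sub>F i in sequentially. \<forall>t\<in>UNIV. dist (integral UNIV (\<lambda>s. T s (u i (t - s)))) (integral UNIV (\<lambda>s. T s (f (t - s)))) < e"
          using ev by (auto elim!: eventually_mono intro: le_less_trans)
      qed
    qed simp
  qed
qed

text \<open>Both sides are normal in \<open>h\<close>, so \<open>h\<close> may be taken to be a
  tensor; the fixed vector then factors out and \<open>scalar_fubini\<close> remains.\<close>

lemma fubini_scalar_kernel:
  fixes h :: "real \<Rightarrow> 'a::banach" and \<phi> \<psi> :: "real \<Rightarrow> real"
  assumes \<phi>: "continuous_on UNIV \<phi>" "\<And>s. B2 < \<bar>s\<bar> \<Longrightarrow> \<phi> s = 0"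
    and \<psi>: "continuous_on UNIV \<psi>" "\<And>s. B3 < \<bar>s\<bar> \<Longrightarrow> \<psi> s = 0"
    and h: "smeas h" "\<And>s. norm (h s) \<le> M * kern p s"
  shows "integral UNIV (\<lambda>s. integral UNIV (\<lambda>r. \<phi> (s + r) * \<psi> r) *\<^sub>R h s) =
    integral UNIV (\<lambda>u. \<phi> u *\<^sub>R integral UNIV (\<lambda>s. \<psi> (u - s) *\<^sub>R h s))"
proof -
  define a where "a s = integral UNIV (\<lambda>r. \<phi> (s + r) * \<psi> r)" for s
  obtain M\<phi> where M\<phi>: "M\<phi> > 0" "\<And>s. \<bar>\<phi> s\<bar> \<le> M\<phi>" using tensor_dominated[OF \<phi>, where k = "\<lambda>_. 1"] by auto
  obtain L\<phi> where L\<phi>: "L\<phi> > 0" "\<And>s. \<bar>\<phi> s\<bar> \<le> L\<phi> * kern p s"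
    using tensor_dominated[OF \<phi> kern_continuous[of p] kern_pos] by auto
  obtain M\<psi> where M\<psi>: "M\<psi> > 0" "\<And>s. \<bar>\<psi> s\<bar> \<le> M\<psi>" using tensor_dominated[OF \<psi>, where k = "\<lambda>_. 1"] by auto
  obtain L\<psi> where L\<psi>: "L\<psi> > 0" "\<And>s. \<bar>\<psi> s\<bar> \<le> L\<psi> * kern p s"
    using tensor_dominated[OF \<psi> kern_continuous[of p] kern_pos] by auto
  have \<phi>s: "continuous_on UNIV (\<lambda>x. \<phi> (s + x))" "continuous_on UNIV (\<lambda>x. \<phi> (x + s))" for s
    by (auto intro!: continuous_on_compose2[OF \<phi>(1)] continuous_intros)
  have \<psi>s: "continuous_on UNIV (\<lambda>x. \<psi> (s - x))" "continuous_on UNIV (\<lambda>x. \<psi> (x - s))" for s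
    by (auto intro!: continuous_on_compose2[OF \<psi>(1)] continuous_intros)
  have sm: "smeas (\<lambda>r. \<phi> (s + r) * \<psi> r)" for s
    by (intro smeas_continuous continuous_intros \<phi>s \<psi>)
  have dm: "norm (\<phi> (s + r) * \<psi> r) \<le> (M\<phi> * L\<psi>) * kern p r" for s r
    using mult_mono[OF M\<phi>(2)[of "s + r"] L\<psi>(2)[of r]] M\<phi>(1) by (simp add: abs_mult mult_ac)
  have ac: "continuous_on UNIV a" unfolding a_def
    by (rule kern_dom_continuous[OF p sm dm]) (intro continuous_intros \<phi>s)
  have ab: "\<bar>a s\<bar> \<le> M\<phi> * L\<psi> * kint p" for s
    using kern_dom_integrable(3)[OF p sm dm] by (simp add: a_def)
  have ab0: "0 \<le> M\<phi> * L\<psi> * kint p" using ab[of 0] by linarith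
  have inner_atomic: "opfam (\<lambda>s y. \<psi> (u - s) *\<^sub>R y) (\<lambda>_. M\<psi>)" for u
    by (rule opfam_scaleR[OF \<psi>s(1) M\<psi>(2)])
  note inner = normal_atomic[OF p inner_atomic, where k = "kern p" and \<sigma> = "\<lambda>s. s" and D = M\<psi>,
    OF order_refl less_imp_le[OF M\<psi>(1)]]
  have outer_atomic: "opfam (\<lambda>s y :: 'a. a s *\<^sub>R y) (\<lambda>_. M\<phi> * L\<psi> * kint p)"
    by (rule opfam_scaleR[OF ac ab])
  note outer = normal_atomic(1)[OF p outer_atomic, where k = "kern p" and \<sigma> = "\<lambda>s. s" and D = "M\<phi> * L\<psi> * kint p"]
  show ?thesis
    unfolding a_def[symmetric]
  proof (rule normal_eq[where k = "kern p" and M = M, OF _ _ kern_continuous kern_pos h])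
    show "normal (kern p) (\<lambda>h :: real \<Rightarrow> 'a. integral UNIV (\<lambda>s. a s *\<^sub>R h s))"
      by (rule outer) (use ab0 in \<open>auto simp: kern_pos\<close>)
    show "normal (kern p) (\<lambda>h :: real \<Rightarrow> 'a. integral UNIV (\<lambda>u. \<phi> u *\<^sub>R integral UNIV (\<lambda>s. \<psi> (u - s) *\<^sub>R h s)))"
    proof (rule normal_iterate[OF p opfam_scaleR[OF \<phi>(1) L\<phi>(2)], where D = "M\<psi> * kint p"])
      show "normal (kern p) (\<lambda>h :: real \<Rightarrow> 'a. integral UNIV (\<lambda>s. \<psi> (u - s) *\<^sub>R h s))" for u
        by (rule inner(1)) (auto simp: kern_pos)
      show "smeas (\<lambda>u. integral UNIV (\<lambda>s. \<psi> (u - s) *\<^sub>R f s))"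
        if f: "smeas f" "\<And>s. norm (f s) \<le> M * kern p s" for f :: "real \<Rightarrow> 'a" and M
      proof (rule smeas_continuous, rule kern_dom_continuous[OF p, where M = "M * M\<psi>"])
        show "smeas (\<lambda>s. \<psi> (t - s) *\<^sub>R f s)" for t by (rule smeas_scale[OF f(1) \<psi>s(1)])
        show "norm (\<psi> (t - s) *\<^sub>R f s) \<le> M * M\<psi> * kern p s" for t s
          by (rule inner(3)) (use f in \<open>auto simp: kern_pos\<close>)
        show "continuous_on UNIV (\<lambda>t. \<psi> (t - s) *\<^sub>R f s)" for s by (intro continuous_intros \<psi>s)
      qed
      show "norm (integral UNIV (\<lambda>s. \<psi> (u - s) *\<^sub>R f s)) \<le> M * (M\<psi> * kint p)"
        if f: "smeas f" "\<And>s. norm (f s) \<le> M * kern p s" for f :: "real \<Rightarrow> 'a" and M u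
        unfolding mult.assoc[symmetric] by (rule inner(2)) (use f in \<open>auto simp: kern_pos\<close>)
    qed (use L\<phi> in auto)
    show "integral UNIV (\<lambda>s. a s *\<^sub>R \<zeta> s *\<^sub>R y) = integral UNIV (\<lambda>u. \<phi> u *\<^sub>R integral UNIV (\<lambda>s. \<psi> (u - s) *\<^sub>R \<zeta> s *\<^sub>R y))"
      if \<zeta>: "continuous_on UNIV \<zeta>" "\<And>s. B < \<bar>s\<bar> \<Longrightarrow> \<zeta> s = 0" for \<zeta> :: "real \<Rightarrow> real" and B and y :: 'a
    proof -
      have i1: "(\<lambda>s. a s * \<zeta> s) integrable_on UNIV"
        by (rule compact_support_integrable[where B=B]) (auto intro!: continuous_intros ac \<zeta>)
      have i2: "(\<lambda>s. \<psi> (u - s) * \<zeta> s) integrable_on UNIV" for u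
        by (rule compact_support_integrable[where B=B]) (auto intro!: continuous_intros \<psi>s \<zeta>)
      have c2: "continuous_on UNIV (\<lambda>u. integral UNIV (\<lambda>s. \<psi> (u - s) * \<zeta> s))"
      proof -
        obtain L\<zeta> where L\<zeta>: "L\<zeta> > 0" "\<And>s. \<bar>\<zeta> s\<bar> \<le> L\<zeta> * kern p s"
          using tensor_dominated[OF \<zeta> kern_continuous[of p] kern_pos] by auto
        show ?thesis
        proof (rule kern_dom_continuous[OF p, where M = "M\<psi> * L\<zeta>"])
          show "norm (\<psi> (t - s) * \<zeta> s) \<le> M\<psi> * L\<zeta> * kern p s" for t s
            using mult_mono[OF M\<psi>(2)[of "t - s"] L\<zeta>(2)[of s]] M\<psi>(1) by (simp add: abs_mult mult_ac)
        qed (auto intro!: smeas_continuous continuous_intros \<psi>s \<zeta>)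
      qed
      have i3: "(\<lambda>u. \<phi> u * integral UNIV (\<lambda>s. \<psi> (u - s) * \<zeta> s)) integrable_on UNIV"
        by (rule compact_support_integrable[where B=B2]) (auto intro!: continuous_intros \<phi> c2)
      show ?thesis
        using integral_UNIV_scaleR_left[OF i1, of y] integral_UNIV_scaleR_left[OF i2, of _ y] integral_UNIV_scaleR_left[OF i3, of y]
          scalar_fubini[OF \<zeta>(1) \<phi>(1) \<psi>(1) \<zeta>(2) \<phi>(2)]
        by (simp add: a_def)
    qed
  qed
qed

end

lemma opfam_add: "opfam T \<alpha> \<Longrightarrow> T s (x + y) = T s x + T s y"
  by (intro linear_add bounded_linear.linear opfam_linear)

context
  fixes p :: real
  assumes p: "1 < p"
begin

text \<open>Normality in \<open>g\<close> reduces to \<open>g r = \<psi> r *\<^sub>R z\<close>. The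
  operators then act on the fixed vector \<open>z\<close> only, and \<open>T s z\<close> is the
  vector valued function \<open>h\<close> of \<open>fubini_scalar_kernel\<close>.\<close>

lemma fubini_function_kernel:
  fixes T :: "real \<Rightarrow> 'a::banach \<Rightarrow> 'a" and \<phi> :: "real \<Rightarrow> real"
  assumes T: "opfam T (\<lambda>s. C * kern p s)" and C: "0 \<le> C"
    and \<phi>: "continuous_on UNIV \<phi>" "\<And>s. B < \<bar>s\<bar> \<Longrightarrow> \<phi> s = 0"
    and g: "smeas g" "\<And>s. norm (g s) \<le> M * kern p s"
  shows "integral UNIV (\<lambda>s. T s (integral UNIV (\<lambda>r. \<phi> (s + r) *\<^sub>R g r))) =
    integral UNIV (\<lambda>u. \<phi> u *\<^sub>R integral UNIV (\<lambda>s. T s (g (u - s))))"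
proof -
  obtain M\<phi> where M\<phi>: "M\<phi> > 0" "\<And>s. \<bar>\<phi> s\<bar> \<le> M\<phi>" using tensor_dominated[OF \<phi>, where k = "\<lambda>_. 1"] by auto
  obtain L\<phi> where L\<phi>: "L\<phi> > 0" "\<And>s. \<bar>\<phi> s\<bar> \<le> L\<phi> * kern p s"
    using tensor_dominated[OF \<phi> kern_continuous[of p] kern_pos] by auto
  have \<phi>s: "continuous_on UNIV (\<lambda>x. \<phi> (s + x))" "continuous_on UNIV (\<lambda>x. \<phi> (x + s))" for s
    by (auto intro!: continuous_on_compose2[OF \<phi>(1)] continuous_intros)
  have at1: "opfam (\<lambda>r y :: 'a. \<phi> (s + r) *\<^sub>R y) (\<lambda>_. M\<phi>)" for s
    by (rule opfam_scaleR[OF \<phi>s(1) M\<phi>(2)])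
  note inner1 = normal_atomic[OF p at1, where k = "kern p" and \<sigma> = "\<lambda>s. s" and D = M\<phi>,
    OF order_refl less_imp_le[OF M\<phi>(1)]]
  have domT: "C * kern p s * kern p (u - s) \<le> C * kern p s" for u s
    using kern_le_1[of p "u - s"] p C kern_nonneg[of p s] by (simp add: mult_left_le)
  note inner2 = normal_atomic[OF p T, where k = "kern p" and \<sigma> = "\<lambda>s. _ - s" and D = C,
    OF domT mult_nonneg_nonneg[OF C kern_nonneg]]
  show ?thesis
  proof (rule normal_eq[where k = "kern p" and M = M, OF _ _ kern_continuous kern_pos g])
    show "normal (kern p) (\<lambda>g :: real \<Rightarrow> 'a. integral UNIV (\<lambda>s. T s (integral UNIV (\<lambda>r. \<phi> (s + r) *\<^sub>R g r))))"
    proof (rule normal_iterate[OF p T C, where D = "M\<phi> * kint p"])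
      show "normal (kern p) (\<lambda>g :: real \<Rightarrow> 'a. integral UNIV (\<lambda>r. \<phi> (s + r) *\<^sub>R g r))" for s
        by (rule inner1(1)) (auto simp: kern_pos)
      show "smeas (\<lambda>s. integral UNIV (\<lambda>r. \<phi> (s + r) *\<^sub>R f r))"
        if f: "smeas f" "\<And>s. norm (f s) \<le> M * kern p s" for f :: "real \<Rightarrow> 'a" and M
      proof (rule smeas_continuous, rule kern_dom_continuous[OF p, where M = "M * M\<phi>"])
        show "smeas (\<lambda>r. \<phi> (t + r) *\<^sub>R f r)" for t by (rule smeas_scale[OF f(1) \<phi>s(1)])
        show "norm (\<phi> (t + s) *\<^sub>R f s) \<le> M * M\<phi> * kern p s" for t s
          by (rule inner1(3)) (use f in \<open>auto simp: kern_pos\<close>)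
        show "continuous_on UNIV (\<lambda>t. \<phi> (t + s) *\<^sub>R f s)" for s by (intro continuous_intros \<phi>s)
      qed
      show "norm (integral UNIV (\<lambda>r. \<phi> (s + r) *\<^sub>R f r)) \<le> M * (M\<phi> * kint p)"
        if f: "smeas f" "\<And>s. norm (f s) \<le> M * kern p s" for f :: "real \<Rightarrow> 'a" and M s
        unfolding mult.assoc[symmetric] by (rule inner1(2)) (use f in \<open>auto simp: kern_pos\<close>)
    qed
    show "normal (kern p) (\<lambda>g :: real \<Rightarrow> 'a. integral UNIV (\<lambda>u. \<phi> u *\<^sub>R integral UNIV (\<lambda>s. T s (g (u - s)))))"
    proof (rule normal_iterate[OF p opfam_scaleR[OF \<phi>(1) L\<phi>(2)], where D = "C * kint p"])
      show "normal (kern p) (\<lambda>g. integral UNIV (\<lambda>s. T s (g (u - s))))" for u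
        by (rule inner2(1)) (assumption | rule smeas_reflect negligible_reflect kern_pos)+
      show "smeas (\<lambda>u. integral UNIV (\<lambda>s. T s (f (u - s))))"
        if f: "smeas f" "\<And>s. norm (f s) \<le> M * kern p s" for f :: "real \<Rightarrow> 'a" and M
        by (rule smeas_continuous[OF conv_continuous[OF p T C f]])
      show "norm (integral UNIV (\<lambda>s. T s (f (u - s)))) \<le> M * (C * kint p)"
        if f: "smeas f" "\<And>s. norm (f s) \<le> M * kern p s" for f :: "real \<Rightarrow> 'a" and M u
        unfolding mult.assoc[symmetric] by (rule inner2(2)) (assumption | rule smeas_reflect negligible_reflect kern_pos f)+
    qed (use L\<phi> in auto)
    show "integral UNIV (\<lambda>s. T s (integral UNIV (\<lambda>r. \<phi> (s + r) *\<^sub>R \<psi> r *\<^sub>R z))) =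
        integral UNIV (\<lambda>u. \<phi> u *\<^sub>R integral UNIV (\<lambda>s. T s (\<psi> (u - s) *\<^sub>R z)))"
      if \<psi>: "continuous_on UNIV \<psi>" "\<And>s. B' < \<bar>s\<bar> \<Longrightarrow> \<psi> s = 0" for \<psi> :: "real \<Rightarrow> real" and B' and z :: 'a
    proof -
      have i2: "(\<lambda>r. \<phi> (s + r) * \<psi> r) integrable_on UNIV" for s
        by (rule compact_support_integrable[where B=B']) (auto intro!: continuous_intros \<phi>s \<psi>)
      have h: "norm (T s z) \<le> (C * norm z) * kern p s" for s
        by (rule scaled_kern[OF p T C order_refl])
      show ?thesis
        using integral_UNIV_scaleR_left[OF i2, of _ z]
          fubini_scalar_kernel[OF p \<phi> \<psi> opfam_smeas[OF T] h]
        by (simp add: opfam_scale[OF T])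
    qed
  qed
qed

text \<open>The constant is \<open>kern_mult_le\<close> integrated in \<open>s\<close>, each of the
  two kernels contributing \<open>kint\<close>. Measurability in \<open>t\<close> comes from the
  continuity in \<open>conv_continuous\<close>.\<close>

lemma opfam_conv:
  fixes T U :: "real \<Rightarrow> 'a::banach \<Rightarrow> 'a"
  assumes T: "opfam T (\<lambda>s. C * kern p s)" and C: "0 \<le> C"
    and U: "opfam U (\<lambda>s. D * kern p s)" and D: "0 \<le> D"
  shows "opfam (\<lambda>t y. integral UNIV (\<lambda>s. T s (U (t - s) y))) (\<lambda>t. (C * D * 2 powr p * (2 * kint p)) * kern p t)"
  unfolding opfam_def
proof (intro conjI allI)
  have le: "norm (T s (U (t - s) y)) \<le> C * D * norm y * (kern p s * kern p (t - s))" for s t y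
  proof -
    have "norm (T s (U (t - s) y)) \<le> C * kern p s * norm (U (t - s) y)" by (rule opfam_le[OF T])
    also have "\<dots> \<le> C * kern p s * (D * kern p (t - s) * norm y)"
      using C kern_nonneg by (intro mult_left_mono opfam_le[OF U]) auto
    finally show ?thesis by (simp add: mult_ac)
  qed
  have sm: "smeas (\<lambda>s. T s (U (t - s) y))" for t y
    by (rule smeas_family[OF opfam_smeas[OF T] opfam_linear[OF T] smeas_reflect[OF opfam_smeas[OF U]]])
  have dom: "norm (T s (U (t - s) y)) \<le> C * D * norm y * kern p s" for s t y
    by (rule order_trans[OF le]) (intro mult_left_mono, use C D kern_le_1[of p] kern_nonneg p in \<open>auto simp: mult_left_le\<close>)
  have int: "(\<lambda>s. T s (U (t - s) y)) integrable_on UNIV" for t y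
    by (rule kern_dom_integrable(1)[OF p sm dom])
  show "smeas (\<lambda>t. integral UNIV (\<lambda>s. T s (U (t - s) y)))" for y
    by (rule smeas_continuous[OF conv_continuous[OF p T C opfam_smeas[OF U] scaled_kern[OF p U D order_refl]]])
  show bound: "norm (integral UNIV (\<lambda>s. T s (U (t - s) y))) \<le> (C * D * 2 powr p * (2 * kint p)) * kern p t * norm y" for t y
  proof -
    let ?c = "C * D * norm y * (2 powr p * kern p t)"
    have k2: "(\<lambda>s. kern p (t - s)) integrable_on UNIV"
      using kern_integrable[OF p] integrable_UNIV_reflect[of "kern p" t] by simp
    have "norm (integral UNIV (\<lambda>s. T s (U (t - s) y))) \<le> integral UNIV (\<lambda>s. ?c * (kern p s + kern p (t - s)))"
    proof (rule integral_norm_bound_integral[OF int])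
      show "norm (T s (U (t - s) y)) \<le> ?c * (kern p s + kern p (t - s))" for s
        using order_trans[OF le mult_left_mono[OF kern_mult_le[of p s t], of "C * D * norm y"]] C D p
        by (simp add: mult_ac)
    qed (intro integrable_on_mult_right integrable_add kern_integrable p k2)
    also have "\<dots> = ?c * (kint p + kint p)"
      using integral_UNIV_reflect[of "kern p" t] integral_add[OF kern_integrable[OF p] k2]
      by (simp add: kint_def[OF p])
    finally show ?thesis by (simp add: mult_ac)
  qed
  show "bounded_linear (\<lambda>y. integral UNIV (\<lambda>s. T s (U (t - s) y)))" for t
  proof (rule bounded_linear_intro[where K = "(C * D * 2 powr p * (2 * kint p)) * kern p t"])
    show "integral UNIV (\<lambda>s. T s (U (t - s) (x + y))) =
        integral UNIV (\<lambda>s. T s (U (t - s) x)) + integral UNIV (\<lambda>s. T s (U (t - s) y))" for x y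
      by (simp add: opfam_add[OF T] opfam_add[OF U]) (intro integral_add int)
    show "integral UNIV (\<lambda>s. T s (U (t - s) (r *\<^sub>R x))) = r *\<^sub>R integral UNIV (\<lambda>s. T s (U (t - s) x))" for r x
      by (simp add: opfam_scale[OF T] opfam_scale[OF U])
  qed (use bound in \<open>simp add: mult_ac\<close>)
qed

text \<open>Last stage: the majorant for \<open>g\<close> is now a constant, and on a tensor the
  claim is \<open>fubini_function_kernel\<close> applied to \<open>U r y\<close>. Associativity of
  convolution and multiplicativity of \<open>cop\<close> are both instances.\<close>

lemma fubini_conv:
  fixes T U :: "real \<Rightarrow> 'a::banach \<Rightarrow> 'a"
  assumes T: "opfam T (\<lambda>s. C * kern p s)" and C: "0 \<le> C"
    and U: "opfam U (\<lambda>s. D * kern p s)" and D: "0 \<le> D"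
    and g: "smeas g" "\<And>s. norm (g s) \<le> M"
  shows "integral UNIV (\<lambda>s. T s (integral UNIV (\<lambda>r. U r (g (s + r))))) =
    integral UNIV (\<lambda>u. integral UNIV (\<lambda>s. T s (U (u - s) (g u))))"
proof -
  define E where "E = C * D * 2 powr p * (2 * kint p)"
  have E: "0 \<le> E" unfolding E_def using C D kint_nonneg[OF p] by simp
  have one: "continuous_on UNIV (\<lambda>_::real. 1::real)" "\<And>s. 0 < (1::real)" by auto
  have nshift: "negligible {r. s + r \<in> N}" if "negligible N" for s :: real and N
    using negligible_reflect[OF negligible_reflect[OF that, of s], of 0] by simp
  have sshift: "smeas (\<lambda>r. f (s + r))" if "smeas f" for s and f :: "real \<Rightarrow> 'a"
    using smeas_shift[OF that, of s] by (simp add: add.commute)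
  have domU: "D * kern p r * 1 \<le> D * kern p r" for r by simp
  note inner = normal_atomic[OF p U, where k = "\<lambda>_. 1" and \<sigma> = "\<lambda>r. _ + r" and D = D,
    OF domU mult_nonneg_nonneg[OF D kern_nonneg]]
  have inner1: "normal (\<lambda>_. 1) (\<lambda>g. integral UNIV (\<lambda>r. U r (g (s + r))))" for s
    by (rule inner(1)) (assumption | rule sshift nshift one(2))+
  \<comment> \<open>For elementary \<open>f\<close> the inner integral is continuous in
    \<open>s\<close>. For general bounded \<open>f\<close> only measurability is claimed, as a
    pointwise limit.\<close>
  have smi: "smeas (\<lambda>s. integral UNIV (\<lambda>r. U r (f (s + r))))"
    if f: "smeas f" "\<And>s. norm (f s) \<le> M * 1" for f and M
  proof -
    have le: "norm (f s) \<le> \<bar>M\<bar> + 1" for s using f(2)[of s] by simp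
    have k: "continuous_on UNIV (\<lambda>_::real. \<bar>M\<bar> + 1)" "\<And>s::real. 0 < \<bar>M\<bar> + 1" by auto
    show ?thesis using f(1) le k
    proof (induction rule: smeas_dominated_induct)
      case (elem f)
      show ?case
      proof (rule smeas_continuous, rule kern_dom_continuous[OF p, where M = "D * (\<bar>M\<bar> + 1)"])
        show "smeas (\<lambda>r. U r (f (s + r)))" for s
          by (rule smeas_family[OF opfam_smeas[OF U] opfam_linear[OF U] sshift[OF smeas.elem[OF elem(1)]]])
        show "norm (U r (f (s + r))) \<le> D * (\<bar>M\<bar> + 1) * kern p r" for s r
          by (rule scaled_kern[OF p U D elem(2)])
        show "continuous_on UNIV (\<lambda>s. U r (f (s + r)))" for r
          by (intro bounded_linear.continuous_on[OF opfam_linear[OF U]]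
              continuous_on_compose2[OF elementary_continuous[OF elem(1)]] continuous_intros) auto
      qed
    next
      case (lim f u N)
      have "(\<lambda>i. integral UNIV (\<lambda>r. U r (u i (s + r)))) \<longlonglongrightarrow> integral UNIV (\<lambda>r. U r (f (s + r)))" for s
        by (rule normal_lim[OF inner1 lim(4,2), where M = "\<bar>M\<bar> + 1", OF _ _ lim(6,7)]) (use lim(3,5) in auto)
      then show ?case by (rule smeas.lim[OF lim(1) negligible_empty])
    qed
  qed
  note cv = opfam_conv[OF T C U D, folded E_def]
  show ?thesis
  proof (rule normal_eq[where k = "\<lambda>_. 1" and M = M and f = g, OF _ _ one g(1)])
    show "normal (\<lambda>_. 1) (\<lambda>g :: real \<Rightarrow> 'a. integral UNIV (\<lambda>s. T s (integral UNIV (\<lambda>r. U r (g (s + r))))))"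
    proof (rule normal_iterate[OF p T C, where D = "D * kint p"])
      show "normal (\<lambda>_. 1) (\<lambda>g. integral UNIV (\<lambda>r. U r (g (s + r))))" for s by (rule inner1)
      show "norm (integral UNIV (\<lambda>r. U r (f (s + r)))) \<le> M * (D * kint p)"
        if f: "smeas f" "\<And>s. norm (f s) \<le> M * 1" for f :: "real \<Rightarrow> 'a" and M s
        unfolding mult.assoc[symmetric] by (rule inner(2)) (assumption | rule sshift nshift one(2) f)+
    qed (rule smi)
    show "normal (\<lambda>_. 1) (\<lambda>g :: real \<Rightarrow> 'a. integral UNIV (\<lambda>u. integral UNIV (\<lambda>s. T s (U (u - s) (g u)))))"
      by (rule normal_atomic(1)[OF p cv, where \<sigma> = "\<lambda>s. s" and D = E]) (use E in \<open>auto simp: kern_nonneg\<close>)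
    show "integral UNIV (\<lambda>s. T s (integral UNIV (\<lambda>r. U r (\<phi> (s + r) *\<^sub>R y)))) =
        integral UNIV (\<lambda>u. integral UNIV (\<lambda>s. T s (U (u - s) (\<phi> u *\<^sub>R y))))"
      if \<phi>: "continuous_on UNIV \<phi>" "\<And>s. B < \<bar>s\<bar> \<Longrightarrow> \<phi> s = 0" for \<phi> :: "real \<Rightarrow> real" and B and y :: 'a
      using fubini_function_kernel[OF T C \<phi> opfam_smeas[OF U, of y] scaled_kern[OF p U D order_refl]]
      by (simp add: opfam_scale[OF T] opfam_scale[OF U])
  qed (use g in auto)
qed

text \<open>Counterpart of \<open>in_W\<close> with decay at every \<open>t\<close> and with
  measurability in the sense of \<open>smeas\<close>, so that values may be altered on null
  sets.\<close>

definition nice :: "(real \<Rightarrow> 'a::complex_banach \<Rightarrow> 'a) \<Rightarrow> bool"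
  where "nice T \<longleftrightarrow> (\<forall>s. bop (T s)) \<and> (\<exists>C\<ge>0. opfam T (\<lambda>s. C * kern p s))"

end

lemma bounded_linear_cscale: "bounded_linear (cscale c)"
proof (rule bounded_linear_intro[where K = "cmod c"])
  show "cscale c (r *\<^sub>R x) = r *\<^sub>R cscale c x" for r and x :: 'a
    by (simp add: cscale_of_real[symmetric] cscale_assoc mult.commute)
qed (auto simp: cscale_add_right norm_cscale mult.commute)

context
  fixes p :: real
  assumes p: "1 < p"
begin

lemma nice_conv:
  assumes T: "nice p T" and U: "nice p U"
  shows "nice p (conv T U)"
  unfolding nice_def[OF p]
proof (intro conjI allI)
  obtain C where C: "0 \<le> C" "opfam T (\<lambda>s. C * kern p s)" using T by (auto simp: nice_def[OF p])
  obtain D where D: "0 \<le> D" "opfam U (\<lambda>s. D * kern p s)" using U by (auto simp: nice_def[OF p])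
  have eq: "conv T U = (\<lambda>t y. integral UNIV (\<lambda>s. T s (U (t - s) y)))" by (intro ext) (simp add: conv_def)
  note cv = opfam_conv[OF p C(2,1) D(2,1), folded eq]
  have "0 \<le> C * D * 2 powr p * (2 * kint p)" using C D kint_nonneg[OF p] by simp
  with cv show "\<exists>C\<ge>0. opfam (conv T U) (\<lambda>s. C * kern p s)" by blast
  show "bop (conv T U t)" for t
    unfolding bop_def
  proof (intro conjI allI)
    show "bounded_linear (conv T U t)" by (rule opfam_linear[OF cv])
    fix c x
    have sm: "smeas (\<lambda>s. T s (U (t - s) x))"
      by (rule smeas_family[OF opfam_smeas[OF C(2)] opfam_linear[OF C(2)] smeas_reflect[OF opfam_smeas[OF D(2)]]])
    have le1: "norm (U r x) \<le> D * norm x" for r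
      using scaled_kern[OF p D(2,1) order_refl, of r x] kern_le_1[of p r] D(1) p
        mult_left_mono[of "kern p r" 1 "D * norm x"] by simp
    have "(\<lambda>s. T s (U (t - s) x)) integrable_on UNIV"
      by (rule kern_dom_integrable(1)[OF p sm scaled_kern[OF p C(2,1) le1]])
    then have "integral UNIV (cscale c \<circ> (\<lambda>s. T s (U (t - s) x))) = cscale c (integral UNIV (\<lambda>s. T s (U (t - s) x)))"
      by (rule integral_linear[OF _ bounded_linear_cscale])
    moreover have "T s (U r (cscale c x)) = cscale c (T s (U r x))" for s r
      using T U by (simp add: nice_def[OF p] bop_def)
    ultimately show "conv T U t (cscale c x) = cscale c (conv T U t x)"
      by (simp add: conv_def comp_def)
  qed
qed

text \<open>An instance of \<open>fubini_conv\<close>, with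
  \<open>g u = V (t - u) x\<close>.\<close>

lemma conv_assoc:
  assumes T: "nice p T" and U: "nice p U" and V: "nice p V"
  shows "conv T (conv U V) t x = conv (conv T U) V t x"
proof -
  obtain C where C: "0 \<le> C" "opfam T (\<lambda>s. C * kern p s)" using T by (auto simp: nice_def[OF p])
  obtain D where D: "0 \<le> D" "opfam U (\<lambda>s. D * kern p s)" using U by (auto simp: nice_def[OF p])
  obtain E where E: "0 \<le> E" "opfam V (\<lambda>s. E * kern p s)" using V by (auto simp: nice_def[OF p])
  have "norm (V (t - u) x) \<le> E * norm x" for u
    using scaled_kern[OF p E(2,1) order_refl, of "t - u" x] kern_le_1[of p "t - u"] E(1) p
      mult_left_mono[of "kern p (t - u)" 1 "E * norm x"] by simp
  from fubini_conv[OF p C(2,1) D(2,1) smeas_reflect[OF opfam_smeas[OF E(2), of x], of t] this]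
  show ?thesis by (simp add: conv_def diff_diff_eq)
qed

lemma nice_conv_power: "nice p T \<Longrightarrow> 0 < n \<Longrightarrow> nice p (conv_power T n)"
proof (induction n)
  case (Suc n)
  then show ?case by (cases n) (auto intro: nice_conv)
qed simp

end

section \<open>Convolution operators on bounded continuous functions\<close>

instance bcontfun :: (metric_space, banach) banach ..

lemmas bcontfun_le = Bounded_Continuous_Function.norm_bounded

abbreviation ev :: "(real \<Rightarrow>\<^sub>C 'a::real_normed_vector) endo \<Rightarrow> (real \<Rightarrow>\<^sub>C 'a) \<Rightarrow> real \<Rightarrow> 'a"
  where "ev A f t \<equiv> apply_bcontfun (eapp A f) t"

lemma ev_ext: "(\<And>f t. ev A f t = ev B f t) \<Longrightarrow> A = B"
  by (rule eapp_ext, rule bcontfun_eqI)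

lemma apply_bcontfun_sum:
  "apply_bcontfun (\<Sum>i\<in>I. f i :: real \<Rightarrow>\<^sub>C 'a::real_normed_vector) t = (\<Sum>i\<in>I. apply_bcontfun (f i) t)"
  by (induction I rule: infinite_finite_induct) auto

lemma norm_ev: "norm (ev A f t) \<le> norm A * norm f"
  using bcontfun_le[of "eapp A f" t] norm_eapp[of A f] by linarith

lemma norm_endo_ev_le: "0 \<le> b \<Longrightarrow> (\<And>f t. norm (ev A f t) \<le> b * norm f) \<Longrightarrow> norm A \<le> b"
  by (intro norm_endo_le Bounded_Continuous_Function.norm_bound)

text \<open>Both constructors are total, so this represents \<Phi> only if \<Phi> maps bounded
  continuous functions linearly and boundedly to such functions; the lemma \<open>mkop\<close>
  collects these conditions.\<close>

definition mkop :: "((real \<Rightarrow> 'a) \<Rightarrow> real \<Rightarrow> 'a) \<Rightarrow> (real \<Rightarrow>\<^sub>C 'a::real_normed_vector) endo"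
  where "mkop \<Phi> = Endo (Blinfun (\<lambda>f. Bcontfun (\<Phi> (apply_bcontfun f))))"

lemma mkop:
  fixes \<Phi> :: "(real \<Rightarrow> 'a) \<Rightarrow> real \<Rightarrow> 'a::real_normed_vector"
  assumes cont: "\<And>f. continuous_on UNIV (\<Phi> (apply_bcontfun f))"
    and bound: "\<And>f t. norm (\<Phi> (apply_bcontfun f) t) \<le> K * norm f"
    and add: "\<And>f g t. \<Phi> (apply_bcontfun (f + g)) t = \<Phi> (apply_bcontfun f) t + \<Phi> (apply_bcontfun g) t"
    and scale: "\<And>f r t. \<Phi> (apply_bcontfun (r *\<^sub>R f)) t = r *\<^sub>R \<Phi> (apply_bcontfun f) t"
    and K: "0 \<le> K"
  shows "ev (mkop \<Phi>) f t = \<Phi> (apply_bcontfun f) t" "norm (mkop \<Phi>) \<le> K"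
proof -
  have B: "apply_bcontfun (Bcontfun (\<Phi> (apply_bcontfun f))) = \<Phi> (apply_bcontfun f)" for f
    by (rule Bcontfun_inverse, rule bcontfun_normI[OF cont bound])
  have "bounded_linear (\<lambda>f. Bcontfun (\<Phi> (apply_bcontfun f)))"
  proof (rule bounded_linear_intro[where K = K])
    show "norm (Bcontfun (\<Phi> (apply_bcontfun f))) \<le> norm f * K" for f :: "real \<Rightarrow>\<^sub>C 'a"
      by (rule Bounded_Continuous_Function.norm_bound) (simp add: B bound mult.commute[of _ K])
    show "Bcontfun (\<Phi> (apply_bcontfun (f + g))) = Bcontfun (\<Phi> (apply_bcontfun f)) + Bcontfun (\<Phi> (apply_bcontfun g))" for f g
      by (rule bcontfun_eqI) (simp only: B add plus_bcontfun.rep_eq[of "Bcontfun _"])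
    show "Bcontfun (\<Phi> (apply_bcontfun (r *\<^sub>R f))) = r *\<^sub>R Bcontfun (\<Phi> (apply_bcontfun f))" for r f
      by (rule bcontfun_eqI) (simp only: B scale scaleR_bcontfun.rep_eq[of _ "Bcontfun _"])
  qed
  from eapp_Endo[OF this] show *: "ev (mkop \<Phi>) f t = \<Phi> (apply_bcontfun f) t" for f t
    by (simp add: mkop_def B)
  show "norm (mkop \<Phi>) \<le> K"
    by (rule norm_endo_ev_le[OF K]) (simp add: * bound)
qed

section \<open>Translations, pointwise operators and their commutant\<close>

definition Tr :: "real \<Rightarrow> (real \<Rightarrow>\<^sub>C 'a::real_normed_vector) endo"
  where "Tr a = mkop (\<lambda>f t. f (t - a))"

lemma Tr: "ev (Tr a) f t = f (t - a)" "norm (Tr a :: (real \<Rightarrow>\<^sub>C 'a::real_normed_vector) endo) \<le> 1"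
  unfolding Tr_def
  by (rule mkop[where K = 1]; auto intro!: continuous_on_compose2[OF continuous_on_apply_bcontfun]
      continuous_intros bcontfun_le)+

definition Kc :: "('a \<Rightarrow> 'a) \<Rightarrow> (real \<Rightarrow>\<^sub>C 'a::real_normed_vector) endo"
  where "Kc B = mkop (\<lambda>f t. B (f t))"

lemma Kc:
  assumes B: "bounded_linear B"
  shows "ev (Kc B) f t = B (f t)" "0 \<le> b \<Longrightarrow> (\<And>x. norm (B x) \<le> b * norm x) \<Longrightarrow> norm (Kc B) \<le> b"
proof -
  have *: "norm (B (apply_bcontfun f t)) \<le> b * norm f" if "0 \<le> b" "\<And>x. norm (B x) \<le> b * norm x"
    for b and f :: "real \<Rightarrow>\<^sub>C 'a" and t
    using order_trans[OF that(2) mult_left_mono[OF bcontfun_le that(1)]] .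
  have **: "ev (Kc B) f t = B (f t) \<and> norm (Kc B) \<le> b" if "0 \<le> b" "\<And>x. norm (B x) \<le> b * norm x" for b f t
    unfolding Kc_def
    using mkop[of "\<lambda>f t. B (f t)" b, OF _ *[OF that] _ _ that(1)] B
    by (auto simp: linear_add[OF bounded_linear.linear[OF B]] linear_scale[OF bounded_linear.linear[OF B]]
        intro!: bounded_linear.continuous_on)
  show "ev (Kc B) f t = B (f t)" using **[OF onorm_pos_le[OF B] onorm[OF B]] by blast
  show "0 \<le> b \<Longrightarrow> (\<And>x. norm (B x) \<le> b * norm x) \<Longrightarrow> norm (Kc B) \<le> b" using ** by blast
qed

text \<open>Testing on constant functions brings bounds from the operator algebra back to X.\<close>

lemma Kc_ge:
  fixes B :: "'a::real_normed_vector \<Rightarrow> 'a"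
  assumes B: "bounded_linear B"
  shows "norm (B x) \<le> norm (Kc B) * norm x"
proof -
  have "norm (const_bcontfun x :: real \<Rightarrow>\<^sub>C 'a) \<le> norm x"
    by (rule Bounded_Continuous_Function.norm_bound) simp
  then show ?thesis
    using norm_ev[of "Kc B" "const_bcontfun x" 0] Kc(1)[OF B, of "const_bcontfun x" 0]
      mult_left_mono[of "norm (const_bcontfun x :: real \<Rightarrow>\<^sub>C 'a)" "norm x" "norm (Kc B)"] by simp
qed

definition Mc :: "complex \<Rightarrow> (real \<Rightarrow>\<^sub>C 'a::complex_banach) endo"
  where "Mc c = Kc (cscale c)"

lemma Mc: "ev (Mc c) f t = cscale c (f t)" "norm (Mc c :: (real \<Rightarrow>\<^sub>C 'a::complex_banach) endo) \<le> cmod c"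
  unfolding Mc_def by (auto intro!: Kc simp: bounded_linear_cscale norm_cscale)

lemma bop_bl: "bop B \<Longrightarrow> bounded_linear B" and bop_cscale: "bop B \<Longrightarrow> B (cscale c x) = cscale c (B x)"
  by (auto simp: bop_def)

lemma rotation_Tr: "rotation (Tr h) (Tr (- h)) (Mc :: complex \<Rightarrow> (real \<Rightarrow>\<^sub>C 'a::complex_banach) endo)"
proof
  show "Mc (complex_of_real r) = (r *\<^sub>R 1 :: (real \<Rightarrow>\<^sub>C 'a) endo)" for r
    by (rule ev_ext) (simp add: Mc cscale_of_real)
qed (auto intro!: ev_ext simp: Mc Tr cscale_add_left cscale_assoc)

text \<open>All translations are included because the step is chosen only later, and complex
  linearity is included because an \<open>endo\<close> is merely real linear.\<close>

definition ti :: "(real \<Rightarrow>\<^sub>C 'a::complex_banach) endo \<Rightarrow> bool"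
  where "ti e \<longleftrightarrow> (\<forall>h. e * Tr h = Tr h * e) \<and> (\<forall>c. e * Mc c = Mc c * e)"

lemma ti_comm: "ti e \<Longrightarrow> rotation.comm (Tr h) Mc e"
  using rotation.comm_def[OF rotation_Tr, of h e] by (auto simp: ti_def)

lemma ti_iff: "ti e \<longleftrightarrow> (\<forall>h. rotation.comm (Tr h) Mc e)"
  using rotation.comm_def[OF rotation_Tr] by (auto simp: ti_def)

lemma ti_closed:
  assumes "ti x" "ti y"
  shows "ti (x + y)" "ti (x - y)" "ti (x * y)" "ti (- x)" "ti (r *\<^sub>R x)"
  using assms rotation.comm_closed[OF rotation_Tr] unfolding ti_iff by metis+

lemma ti_basic: "ti 1" "ti 0" "ti (Tr a)" "ti (Mc c)" and ti_Kc: "bop B \<Longrightarrow> ti (Kc B)"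
  by (auto simp: ti_def intro!: ev_ext simp: Tr Mc Kc bop_bl cscale_assoc mult.commute bop_cscale algebra_simps)

lemma ti_sum: "(\<And>i. i \<in> I \<Longrightarrow> ti (f i)) \<Longrightarrow> ti (sum f I)"
  by (induction I rule: infinite_finite_induct) (auto simp: ti_basic ti_closed)

lemma ti_power: "ti x \<Longrightarrow> ti (x ^ n)"
  by (induction n) (auto simp: ti_basic ti_closed)

context
  fixes p :: real
  assumes p: "1 < p"
begin

definition cop :: "(real \<Rightarrow> 'a \<Rightarrow> 'a) \<Rightarrow> (real \<Rightarrow>\<^sub>C 'a::complex_banach) endo"
  where "cop T = mkop (\<lambda>f t. integral UNIV (\<lambda>s. T s (f (t - s))))"

lemma nice_bop: "nice p T \<Longrightarrow> bop (T s)"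
  by (auto simp: nice_def[OF p])

lemma nice_opfam:
  assumes "nice p T" obtains C where "0 \<le> C" "opfam T (\<lambda>s. C * kern p s)"
  using assms by (auto simp: nice_def[OF p])

lemma conv_fun:
  fixes f :: "real \<Rightarrow>\<^sub>C 'a::complex_banach"
  assumes T: "opfam T (\<lambda>s. C * kern p s)" and C: "0 \<le> C"
  shows "smeas (\<lambda>s. T s (f (t - s)))" "norm (T s (f (t - s))) \<le> (C * norm f) * kern p s"
    "(\<lambda>s. T s (f (t - s))) integrable_on UNIV"
proof -
  show 1: "smeas (\<lambda>s. T s (f (t - s)))"
    by (rule smeas_family[OF opfam_smeas[OF T] opfam_linear[OF T] smeas_reflect[OF smeas_continuous]]) simp
  show 2: "norm (T s (f (t - s))) \<le> (C * norm f) * kern p s" for s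
    by (rule scaled_kern[OF p T C bcontfun_le])
  show "(\<lambda>s. T s (f (t - s))) integrable_on UNIV" by (rule kern_dom_integrable(1)[OF p 1 2])
qed

lemma cop:
  assumes "nice p T"
  shows "ev (cop T) f t = integral UNIV (\<lambda>s. T s (f (t - s)))"
proof -
  obtain C where C: "0 \<le> C" and T: "opfam T (\<lambda>s. C * kern p s)" using nice_opfam[OF assms] .
  note cf = conv_fun[OF T C]
  show ?thesis unfolding cop_def
  proof (rule mkop(1)[where K = "C * kint p"])
    show "continuous_on UNIV (\<lambda>t. integral UNIV (\<lambda>s. T s (apply_bcontfun f (t - s))))" for f
      by (rule conv_bounded_continuous[OF p T C _ bcontfun_le]) simp
    show "norm (integral UNIV (\<lambda>s. T s (apply_bcontfun f (t - s)))) \<le> C * kint p * norm f" for f t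
      using kern_dom_integrable(3)[OF p cf(1,2)] by (simp add: mult_ac)
    show "integral UNIV (\<lambda>s. T s (apply_bcontfun (f + g) (t - s))) =
      integral UNIV (\<lambda>s. T s (apply_bcontfun f (t - s))) + integral UNIV (\<lambda>s. T s (apply_bcontfun g (t - s)))" for f g t
      by (simp add: opfam_add[OF T]) (intro integral_add cf)
    show "integral UNIV (\<lambda>s. T s (apply_bcontfun (r *\<^sub>R f) (t - s))) = r *\<^sub>R integral UNIV (\<lambda>s. T s (apply_bcontfun f (t - s)))" for r f t
      by (simp add: opfam_scale[OF T])
  qed (use C kint_nonneg[OF p] in simp)
qed

lemma cop_ti: assumes T: "nice p T" shows "ti (cop T)"
  unfolding ti_def
proof (intro conjI allI ev_ext)
  obtain C where C: "0 \<le> C" and T': "opfam T (\<lambda>s. C * kern p s)" using nice_opfam[OF T] .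
  fix f :: "real \<Rightarrow>\<^sub>C 'a" and t
  show "ev (cop T * Tr h) f t = ev (Tr h * cop T) f t" for h
    by (simp add: cop[OF T] Tr algebra_simps)
  show "ev (cop T * Mc c) f t = ev (Mc c * cop T) f t" for c
    using integral_linear[OF conv_fun(3)[OF T' C, of f t] bounded_linear_cscale[of c]]
    by (simp add: cop[OF T] Mc bop_cscale[OF nice_bop[OF T]] comp_def)
qed

lemma cop_mult:
  assumes T: "nice p T" and U: "nice p U"
  shows "cop T * cop U = cop (conv T U)"
proof (rule ev_ext)
  obtain C where C: "0 \<le> C" "opfam T (\<lambda>s. C * kern p s)" using nice_opfam[OF T] .
  obtain D where D: "0 \<le> D" "opfam U (\<lambda>s. D * kern p s)" using nice_opfam[OF U] .
  fix f :: "real \<Rightarrow>\<^sub>C 'a" and t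
  have "smeas (\<lambda>u. f (t - u))" by (rule smeas_reflect[OF smeas_continuous]) simp
  from fubini_conv[OF p C(2,1) D(2,1) this bcontfun_le]
  show "ev (cop T * cop U) f t = ev (cop (conv T U)) f t"
    by (simp add: cop[OF T] cop[OF U] cop[OF nice_conv[OF p T U]] conv_def diff_diff_eq)
qed

lemma cop_power:
  assumes T: "nice p T" and "0 < n"
  shows "cop T ^ n = cop (conv_power T n)"
  using \<open>0 < n\<close>
proof (induction n)
  case (Suc n)
  then show ?case
    by (cases n) (simp_all add: cop_mult[OF T nice_conv_power[OF p T]] del: power_Suc add: power_Suc[of _ "Suc _"])
qed simp

text \<open>\<open>Tr \<delta> * cop V\<close> is convolution with the translated family
  \<open>V (s - \<delta>)\<close>. Integrating the pointwise bound thus turns continuity in the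
  weighted supremum norm into continuity in operator norm.\<close>

lemma translation_modulus:
  assumes V: "nice p V" and \<epsilon>: "0 \<le> \<epsilon>"
    and ae: "AE s in lebesgue. \<forall>x. norm (V s x - V (s - \<delta>) x) \<le> \<epsilon> * kern p s * norm x"
  shows "norm (Tr \<delta> * cop V - cop V) \<le> \<epsilon> * kint p"
proof (rule norm_endo_ev_le)
  show "0 \<le> \<epsilon> * kint p" using \<epsilon> kint_nonneg[OF p] by simp
  fix f :: "real \<Rightarrow>\<^sub>C 'a" and t
  obtain C where C: "0 \<le> C" and V': "opfam V (\<lambda>s. C * kern p s)" using nice_opfam[OF V] .
  obtain N where N: "negligible N" and le: "\<And>s x. s \<notin> N \<Longrightarrow> norm (V s x - V (s - \<delta>) x) \<le> \<epsilon> * kern p s * norm x"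
    using ae unfolding eventually_ae_filter by (auto simp: negligible_iff_null_sets)
  have i1: "(\<lambda>s. V s (f (t - s))) integrable_on UNIV" by (rule conv_fun[OF V' C])
  have i2: "(\<lambda>s. V (s - \<delta>) (f (t - s))) integrable_on UNIV"
    using conv_fun(3)[OF V' C, of f "t - \<delta>"] integrable_UNIV_shift[of "\<lambda>s. V s (f (t - \<delta> - s))" "- \<delta>"] by simp
  have "ev (Tr \<delta> * cop V) f t = integral UNIV (\<lambda>s. V (s - \<delta>) (f (t - s)))"
    using integral_UNIV_shift[of "\<lambda>s. V s (f (t - \<delta> - s))" "- \<delta>"] by (simp add: Tr cop[OF V])
  then have "ev (Tr \<delta> * cop V - cop V) f t = integral UNIV (\<lambda>s. V (s - \<delta>) (f (t - s)) - V s (f (t - s)))"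
    using i1 i2 by (simp add: integral_diff cop[OF V])
  also have "\<dots> = integral UNIV (\<lambda>s. if s \<in> N then 0 else V (s - \<delta>) (f (t - s)) - V s (f (t - s)))"
    by (rule integral_spike[OF N]) simp
  also have "norm \<dots> \<le> integral UNIV (\<lambda>s. \<epsilon> * norm f * kern p s)"
  proof (rule integral_norm_bound_integral)
    show "(\<lambda>s. if s \<in> N then 0 else V (s - \<delta>) (f (t - s)) - V s (f (t - s))) integrable_on UNIV"
      by (rule integrable_spike[OF integrable_diff[OF i2 i1] N]) simp
    show "norm (if s \<in> N then 0 else V (s - \<delta>) (f (t - s)) - V s (f (t - s))) \<le> \<epsilon> * norm f * kern p s" for s
    proof (cases "s \<in> N")
      case True then show ?thesis using \<epsilon> by (simp add: kern_nonneg)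
    next
      case False
      have "norm (V s (f (t - s)) - V (s - \<delta>) (f (t - s))) \<le> \<epsilon> * kern p s * norm (f (t - s))" by (rule le[OF False])
      also have "\<dots> \<le> \<epsilon> * kern p s * norm f"
        using \<epsilon> kern_nonneg by (intro mult_left_mono bcontfun_le) auto
      finally show ?thesis using False by (simp add: norm_minus_commute mult_ac)
    qed
  qed (intro integrable_on_mult_right kern_integrable p)
  also have "\<dots> = \<epsilon> * kint p * norm f" by (simp add: kint_def[OF p])
  finally show "norm (ev (Tr \<delta> * cop V - cop V) f t) \<le> \<epsilon> * kint p * norm f" .
qed

end

section \<open>Inversion on bounded continuous functions\<close>

lemma cmod_cis_diff_le: "cmod (cis a - cis b) \<le> \<bar>a - b\<bar>"
proof -
  have "(cmod (cis a - cis b))\<^sup>2 = (cos a - cos b)\<^sup>2 + (sin a - sin b)\<^sup>2"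
    by (simp add: cmod_power2)
  also have "\<dots> = 2 - 2 * cos (a - b)"
    using sin_cos_squared_add[of a] sin_cos_squared_add[of b]
    by (simp add: cos_diff power2_eq_square algebra_simps)
  also have "\<dots> = (2 * sin ((a - b) / 2))\<^sup>2"
  proof -
    have "cos (a - b) = cos (2 * ((a - b) / 2))" by (rule arg_cong[where f = cos]) simp
    also have "\<dots> = 1 - 2 * (sin ((a - b) / 2))\<^sup>2" by (rule cos_double_sin)
    finally show ?thesis by (simp add: power_mult_distrib)
  qed
  finally have sq: "(cmod (cis a - cis b))\<^sup>2 = (2 * sin ((a - b) / 2))\<^sup>2" .
  have "cmod (cis a - cis b) = sqrt ((cmod (cis a - cis b))\<^sup>2)" by simp
  also have "\<dots> = \<bar>2 * sin ((a - b) / 2)\<bar>" by (simp only: sq real_sqrt_abs)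
  also have "\<dots> \<le> 2 * \<bar>(a - b) / 2\<bar>"
    unfolding abs_mult using abs_sin_x_le_abs_x[of "(a - b) / 2"] by simp
  finally show ?thesis by simp
qed

lemma norm_cscale_diff_left: "norm (cscale a x - cscale b x) = cmod (a - b) * norm x"
proof -
  have "cscale a x = cscale (a - b) x + cscale b x" by (simp add: cscale_add_left[symmetric])
  then show ?thesis by (simp add: norm_cscale)
qed

lemma continuous_on_cscale_left:
  assumes "continuous_on S c" shows "continuous_on S (\<lambda>t. cscale (c t) x)"
proof (rule continuous_on_compose2[OF _ assms subset_UNIV])
  show "continuous_on UNIV (\<lambda>c. cscale c x)"
  proof (rule continuous_onI)
    fix c e assume e: "(0::real) < e"
    show "\<exists>d>0. \<forall>x'\<in>UNIV. dist x' c < d \<longrightarrow> dist (cscale x' x) (cscale c x) \<le> e"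
    proof (intro exI[of _ "e / (norm x + 1)"] conjI ballI impI)
      show "0 < e / (norm x + 1)" using e by (simp add: add_nonneg_pos)
      fix x' assume "dist x' c < e / (norm x + 1)"
      then have "cmod (x' - c) * (norm x + 1) < e" by (simp add: dist_norm pos_less_divide_eq add_nonneg_pos)
      then show "dist (cscale x' x) (cscale c x) \<le> e" unfolding dist_norm norm_cscale_diff_left
        using mult_left_mono[of "norm x" "norm x + 1" "cmod (x' - c)"] by simp
    qed
  qed
qed

lemma geometric_factor:
  fixes X :: "'b::real_normed_vector endo"
  shows "1 - X ^ n = (1 - X) * (\<Sum>k<n. X ^ k)" "1 - X ^ n = (\<Sum>k<n. X ^ k) * (1 - X)"
proof -
  show 1: "1 - X ^ n = (1 - X) * (\<Sum>k<n. X ^ k)"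
  proof (induction n)
    case (Suc n)
    have "(1 - X) * (\<Sum>k<Suc n. X ^ k) = (1 - X) * (\<Sum>k<n. X ^ k) + (1 - X) * X ^ n"
      by (simp add: distrib_left)
    also have "\<dots> = 1 - X ^ n + (X ^ n - X * X ^ n)" using Suc by (simp add: left_diff_distrib)
    finally show ?case by simp
  qed simp
  have "X * (\<Sum>k<n. X ^ k) = (\<Sum>k<n. X ^ k) * X"
    by (simp add: sum_distrib_left sum_distrib_right power_commutes)
  then show "1 - X ^ n = (\<Sum>k<n. X ^ k) * (1 - X)"
    unfolding 1 by (simp add: left_diff_distrib right_diff_distrib)
qed

lemma Tr_add: "Tr a * Tr b = Tr (a + b)"
  by (rule ev_ext) (simp add: Tr algebra_simps)

lemma Mc_mult: "Mc c * Mc d = Mc (c * d)" and Mc_one: "Mc 1 = 1"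
  by (rule ev_ext, simp add: Mc cscale_assoc) (rule ev_ext, simp add: Mc cscale_of_real[of 1, simplified])

lemma Tr_0: "Tr 0 = 1"
  by (rule ev_ext) (simp add: Tr)

lemma ti_mult_Tr: "ti v \<Longrightarrow> (1 - Mc c * Tr h) * v = v * (1 - Mc c * Tr h)"
  using rotation.comm_mt[OF rotation_Tr ti_comm] .

lemma ti_swap:
  assumes "ti v"
  shows "v * ((1 - Mc c * Tr h) * w) = (1 - Mc c * Tr h) * (v * w)"
proof -
  have "v * ((1 - Mc c * Tr h) * w) = (v * (1 - Mc c * Tr h)) * w" by (rule mult.assoc[symmetric])
  also have "\<dots> = (1 - Mc c * Tr h) * v * w" by (simp only: ti_mult_Tr[OF assms])
  finally show ?thesis by (simp only: mult.assoc)
qed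

text \<open>\<open>Tr (k h)\<close> acts on \<open>exp (i lam t)\<close> as the scalar \<open>exp (- i k h lam)\<close>, and \<open>1 - Mc (cis (h lam)) Tr h\<close>
  annihilates that function.\<close>

lemma Tr_diff_factor:
  fixes lam h :: real and k :: int
  shows "\<exists>v :: (real \<Rightarrow>\<^sub>C 'a::complex_banach) endo. Tr (of_int k * h) - Mc (cis (- (of_int k * h * lam)))
    = (1 - Mc (cis (h * lam)) * Tr h) * v \<and> ti v \<and> norm v \<le> \<bar>of_int k\<bar>"
proof -
  define D where "D x = Tr (x * h) - (Mc (cis (- (x * h * lam))) :: (real \<Rightarrow>\<^sub>C 'a) endo)" for x :: real
  define z where "z = 1 - (Mc (cis (h * lam)) * Tr h :: (real \<Rightarrow>\<^sub>C 'a) endo)"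
  have nat: "\<exists>v. D (real j) = z * v \<and> ti v \<and> norm v \<le> real j" for j
  proof (induction j)
    case 0
    then show ?case by (intro exI[of _ 0]) (simp add: D_def Tr_0 Mc_one ti_basic)
  next
    case (Suc j)
    then obtain v where v: "D (real j) = z * v" "ti v" "norm v \<le> real j" by blast
    let ?M = "\<lambda>x. Mc (cis (- (x * h * lam))) :: (real \<Rightarrow>\<^sub>C 'a) endo"
    have M1: "?M (real (Suc j)) = ?M (real j) * ?M 1" by (simp add: Mc_mult cis_mult algebra_simps)
    have T1: "Tr (real (Suc j) * h) = Tr h * (Tr (real j * h) :: (real \<Rightarrow>\<^sub>C 'a) endo)"
      by (simp add: Tr_add algebra_simps)
    have MT: "?M (real j) * Tr h = Tr h * ?M (real j)" using ti_basic(4) unfolding ti_def by blast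
    have "?M 1 * z = ?M 1 - ?M 1 * Mc (cis (h * lam)) * Tr h"
      by (simp add: z_def right_diff_distrib mult.assoc)
    also have "\<dots> = ?M 1 - Tr h" by (simp add: Mc_mult cis_mult Mc_one)
    finally have Mz: "?M 1 * z = ?M 1 - Tr h" .
    \<comment> \<open>Telescoping: the new summand contains \<open>?M 1 - Tr h\<close>, which equals
      \<open>?M 1 * z\<close>. Each step adds at most 1 to the norm of the cofactor, which gives the
      linear bound.\<close>
    have "D (real (Suc j)) = Tr h * D (real j) - ?M (real j) * (?M 1 - Tr h)"
      unfolding D_def M1 T1 by (simp add: right_diff_distrib MT)
    also have "\<dots> = Tr h * (z * v) - ?M (real j) * (?M 1 * z)" by (simp only: v(1) Mz)
    also have "\<dots> = z * (Tr h * v - ?M (real (Suc j)))"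
    proof -
      have "Tr h * (z * v) = z * (Tr h * v)"
        unfolding z_def by (rule ti_swap[OF ti_basic(3)])
      moreover have "?M (real j) * (?M 1 * z) = z * ?M (real (Suc j))"
      proof -
        have "?M (real j) * (?M 1 * z) = ?M (real (Suc j)) * z" by (subst M1) (rule mult.assoc[symmetric])
        also have "\<dots> = z * ?M (real (Suc j))" unfolding z_def by (rule ti_mult_Tr[OF ti_basic(4), symmetric])
        finally show ?thesis .
      qed
      ultimately show ?thesis by (simp add: right_diff_distrib)
    qed
    finally have "D (real (Suc j)) = z * (Tr h * v - ?M (real (Suc j)))" .
    moreover have "ti (Tr h * v - ?M (real (Suc j)))" by (intro ti_closed ti_basic v)
    moreover have "norm (Tr h * v - ?M (real (Suc j))) \<le> real (Suc j)"
    proof -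
      have "norm (Tr h * v) \<le> 1 * real j"
        by (rule order_trans[OF norm_mult_ineq]) (intro mult_mono Tr v, auto)
      moreover have "norm (?M (real (Suc j))) \<le> 1" using Mc(2)[of "cis (- (real (Suc j) * h * lam))"] by simp
      ultimately show ?thesis using norm_triangle_ineq4[of "Tr h * v" "?M (real (Suc j))"] by simp
    qed
    ultimately show ?case by blast
  qed
  have "\<exists>v. D (of_int k) = z * v \<and> ti v \<and> norm v \<le> \<bar>of_int k\<bar>"
  proof (cases "0 \<le> k")
    case True
    then show ?thesis using nat[of "nat k"] by simp
  next
    case False
    define j where "j = nat (- k)"
    have kj: "(of_int k :: real) = - real j" using False by (simp add: j_def)
    obtain v where v: "D (real j) = z * v" "ti v" "norm v \<le> real j" using nat by blast
    \<comment> \<open>Negative multiples are reduced to positive ones by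
      \<open>D (- j) = - P * D j\<close>, where \<open>P\<close> is a contraction commuting with
      \<open>z\<close>.\<close>
    define P where "P = Tr (- real j * h) * (Mc (cis (real j * h * lam)) :: (real \<Rightarrow>\<^sub>C 'a) endo)"
    have P: "ti P" unfolding P_def by (intro ti_closed ti_basic)
    have nP: "norm P \<le> 1 * 1" unfolding P_def
      by (rule order_trans[OF norm_mult_ineq]) (intro mult_mono Tr order_trans[OF Mc(2)], auto)
    have "D (of_int k) = - (P * D (real j))"
      by (rule ev_ext) (simp add: D_def kj P_def Tr Mc cscale_assoc cis_mult linear_diff[OF bounded_linear.linear[OF bounded_linear_cscale]] cscale_of_real[of 1, simplified])
    also have "P * D (real j) = z * (P * v)"
      unfolding v(1) z_def by (rule ti_swap[OF P])
    finally have "D (of_int k) = z * (- (P * v))" by simp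
    moreover have "norm (- (P * v)) \<le> \<bar>of_int k\<bar>"
    proof -
      have "norm (P * v) \<le> 1 * real j"
        by (rule order_trans[OF norm_mult_ineq]) (rule mult_mono, use nP v in auto)
      then show ?thesis by (simp add: kj)
    qed
    ultimately show ?thesis using ti_closed(4)[OF ti_closed(3)[OF P v(2)] ti_basic(2)] by blast
  qed
  then show ?thesis unfolding D_def z_def by simp
qed

section \<open>Lattice approximation of convolution operators\<close>

context
  fixes p :: real
  assumes p: "1 < p"
begin

definition tail :: "real \<Rightarrow> real"
  where "tail R = integral UNIV (\<lambda>s. indicator {s. R \<le> \<bar>s\<bar>} s *\<^sub>R kern p s)"

lemma smeas_tail: "smeas (\<lambda>s. indicator {s. R \<le> \<bar>s\<bar>} s *\<^sub>R kern p s)"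
proof (rule smeas_indicator[OF smeas_continuous[OF kern_continuous]])
  have "closed {s::real. R \<le> \<bar>s\<bar>}" by (intro closed_Collect_le continuous_intros)
  then show "{s::real. R \<le> \<bar>s\<bar>} \<in> sets lebesgue" by (intro sets_completionI_sets) auto
qed

lemma norm_tail: "norm (indicator {s. R \<le> \<bar>s\<bar>} s *\<^sub>R kern p s) \<le> 1 * kern p s"
  by (auto simp: indicator_def kern_nonneg)

lemma tail_integrable: "(\<lambda>s. indicator {s. R \<le> \<bar>s\<bar>} s *\<^sub>R kern p s) integrable_on UNIV"
  by (rule kern_dom_integrable(1)[OF p smeas_tail norm_tail])

lemma tail_nonneg: "0 \<le> tail R"
  unfolding tail_def by (rule integral_nonneg[OF tail_integrable]) (simp add: kern_nonneg)

lemma tail_small: assumes "0 < \<epsilon>" shows "\<exists>R>0. tail R < \<epsilon>"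
proof -
  have "(\<lambda>n. tail (real n)) \<longlonglongrightarrow> integral UNIV (\<lambda>s::real. 0::real)"
    unfolding tail_def
  proof (rule kern_dom_convergence(1)[OF p smeas_zero _ smeas_tail norm_tail negligible_empty])
    fix s :: real
    obtain k where k: "\<bar>s\<bar> < real k" using reals_Archimedean2 by blast
    have "indicator {s. real n \<le> \<bar>s\<bar>} s *\<^sub>R kern p s = 0" if "n \<ge> k" for n
      using that k by (auto simp: indicator_def)
    then show "(\<lambda>n. indicator {s. real n \<le> \<bar>s\<bar>} s *\<^sub>R kern p s) \<longlonglongrightarrow> 0"
      by (intro tendsto_eventually) (auto simp: eventually_sequentially)
  qed (simp add: kern_nonneg)
  then have "\<forall>\<^sub>F n in sequentially. tail (real n) < \<epsilon>"
    using order_tendstoD(2)[of _ 0 sequentially \<epsilon>] assms by simp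
  then obtain n0 where "\<And>n. n \<ge> n0 \<Longrightarrow> tail (real n) < \<epsilon>" by (auto simp: eventually_sequentially)
  from this[of "Suc n0"] show ?thesis by (intro exI[of _ "real (Suc n0)"]) (auto simp del: of_nat_Suc)
qed

text \<open>The operator weight that \<open>T\<close> assigns to the cell of length \<open>h\<close>
  starting at \<open>k * h\<close>. The lattice sum of \<open>Kc (cell T h k) * Tr (k * h)\<close>
  is the discrete substitute for \<open>cop T\<close>.\<close>

definition cell :: "(real \<Rightarrow> 'a \<Rightarrow> 'a) \<Rightarrow> real \<Rightarrow> int \<Rightarrow> 'a \<Rightarrow> 'a::complex_banach"
  where "cell T h k y = integral UNIV (\<lambda>s. (indicator {of_int k * h..<(of_int k + 1) * h} s :: real) *\<^sub>R T s y)"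

lemma cell_integrand:
  fixes T :: "real \<Rightarrow> 'a::complex_banach \<Rightarrow> 'a"
  assumes T: "opfam T (\<lambda>s. C * kern p s)" and C: "0 \<le> C"
  shows "smeas (\<lambda>s. (indicator {of_int k * h..<(of_int k + 1) * h} s :: real) *\<^sub>R T s y)"
    "norm ((indicator {of_int k * h..<(of_int k + 1) * h} s :: real) *\<^sub>R T s y) \<le> (C * norm y) * kern p s"
    "(\<lambda>s. (indicator {of_int k * h..<(of_int k + 1) * h} s :: real) *\<^sub>R T s y) integrable_on UNIV"
proof -
  show 1: "smeas (\<lambda>s. (indicator {of_int k * h..<(of_int k + 1) * h} s :: real) *\<^sub>R T s y)"
    by (rule smeas_indicator[OF opfam_smeas[OF T]]) simp
  show 2: "norm ((indicator {of_int k * h..<(of_int k + 1) * h} s :: real) *\<^sub>R T s y) \<le> (C * norm y) * kern p s" for s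
    using scaled_kern[OF p T C order_refl, of s y] C kern_nonneg[of p s] by (auto simp: indicator_def)
  show "(\<lambda>s. (indicator {of_int k * h..<(of_int k + 1) * h} s :: real) *\<^sub>R T s y) integrable_on UNIV"
    by (rule kern_dom_integrable(1)[OF p]) (rule 1, rule 2)
qed

lemma cell_bop:
  fixes T :: "real \<Rightarrow> 'a::complex_banach \<Rightarrow> 'a"
  assumes T: "nice p T" shows "bop (cell T h k)"
proof -
  obtain C where C: "0 \<le> C" and T': "opfam T (\<lambda>s. C * kern p s)" using nice_opfam[OF p T] .
  note ci = cell_integrand[OF T' C, of k h]
  show ?thesis unfolding bop_def
  proof (intro conjI allI)
    show "bounded_linear (cell T h k)"
    proof (rule bounded_linear_intro[where K = "C * kint p"])
      show "cell T h k (x + y) = cell T h k x + cell T h k y" for x y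
        by (simp add: cell_def opfam_add[OF T'] scaleR_add_right) (intro integral_add ci)
      show "cell T h k (r *\<^sub>R x) = r *\<^sub>R cell T h k x" for r x
      proof -
        have "(\<lambda>s. (indicator {of_int k * h..<(of_int k + 1) * h} s :: real) *\<^sub>R T s (r *\<^sub>R x)) =
          (\<lambda>s. r *\<^sub>R (indicator {of_int k * h..<(of_int k + 1) * h} s :: real) *\<^sub>R T s x)"
          by (simp add: opfam_scale[OF T'] fun_eq_iff mult.commute)
        then show ?thesis by (simp only: cell_def integral_cmul)
      qed
      show "norm (cell T h k x) \<le> norm x * (C * kint p)" for x
        using kern_dom_integrable(3)[OF p ci(1,2)[where y = x]] by (simp add: cell_def mult_ac)
    qed
    show "cell T h k (cscale c x) = cscale c (cell T h k x)" for c x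
      using integral_linear[OF ci(3)[where y = x] bounded_linear_cscale[of c]]
      by (simp add: cell_def bop_cscale[OF nice_bop[OF p T]] comp_def
          linear_scale[OF bounded_linear.linear[OF bounded_linear_cscale[of c]]])
  qed
qed

text \<open>On each cell \<open>F (t - s)\<close> is replaced by its value at the left end of the
  cell. Only the modulus of \<open>F\<close> enters, never that of \<open>T\<close>; the lemma
  serves both for functions in the range of \<open>G\<close>, whose translates are close, and for
  exponentials.\<close>

lemma lattice_approx:
  fixes T :: "real \<Rightarrow> 'a::complex_banach \<Rightarrow> 'a"
  assumes T: "opfam T (\<lambda>s. C * kern p s)" and C: "0 \<le> C"
    and F: "continuous_on UNIV F" "\<And>t. norm (F t) \<le> M" and h: "0 < h" and \<eta>: "0 \<le> \<eta>"
    and md: "\<And>t \<delta>. 0 \<le> \<delta> \<Longrightarrow> \<delta> \<le> h \<Longrightarrow> norm (F (t - \<delta>) - F t) \<le> \<eta>"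
  shows "norm (integral UNIV (\<lambda>s. T s (F (t - s))) - (\<Sum>k\<in>{- int n..<int n}. cell T h k (F (t - of_int k * h))))
    \<le> C * (\<eta> * kint p + M * tail (real n * h))"
proof -
  define ind where "ind k s = (indicator {of_int k * h..<(of_int k + 1) * h} s :: real)" for k :: int and s
  have i1: "(\<lambda>s. T s (F (t - s))) integrable_on UNIV"
    by (rule kern_dom_integrable(1)[OF p _ scaled_kern[OF p T C F(2)]])
      (rule smeas_family[OF opfam_smeas[OF T] opfam_linear[OF T] smeas_reflect[OF smeas_continuous[OF F(1)]]])
  have i2: "(\<lambda>s. \<Sum>k\<in>{- int n..<int n}. ind k s *\<^sub>R T s (F (t - of_int k * h))) integrable_on UNIV"
    unfolding ind_def by (intro integrable_sum cell_integrand(3)[OF T C]) auto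
  have 1: "integral UNIV (\<lambda>s. T s (F (t - s))) - (\<Sum>k\<in>{- int n..<int n}. cell T h k (F (t - of_int k * h)))
    = integral UNIV (\<lambda>s. T s (F (t - s)) - (\<Sum>k\<in>{- int n..<int n}. ind k s *\<^sub>R T s (F (t - of_int k * h))))"
    using integral_diff[OF i1 i2] integral_sum[of "{- int n..<int n}" "\<lambda>k s. ind k s *\<^sub>R T s (F (t - of_int k * h))" UNIV]
      cell_integrand(3)[OF T C]
    by (simp add: cell_def ind_def)
  have 2: "norm (integral UNIV (\<lambda>s. T s (F (t - s)) - (\<Sum>k\<in>{- int n..<int n}. ind k s *\<^sub>R T s (F (t - of_int k * h)))))
    \<le> integral UNIV (\<lambda>s. C * (\<eta> * kern p s + M * (indicator {s. real n * h \<le> \<bar>s\<bar>} s *\<^sub>R kern p s)))"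
  proof (rule integral_norm_bound_integral)
    show "(\<lambda>s. T s (F (t - s)) - (\<Sum>k\<in>{- int n..<int n}. ind k s *\<^sub>R T s (F (t - of_int k * h)))) integrable_on UNIV"
      by (rule integrable_diff[OF i1 i2])
    show "(\<lambda>s. C * (\<eta> * kern p s + M * (indicator {s. real n * h \<le> \<bar>s\<bar>} s *\<^sub>R kern p s))) integrable_on UNIV"
      by (intro integrable_on_mult_right integrable_add kern_integrable p tail_integrable)
    fix s
    define k0 where "k0 = \<lfloor>s / h\<rfloor>"
    have k0: "of_int k0 * h \<le> s" "s < (of_int k0 + 1) * h"
      using floor_correct[of "s / h"] pos_le_divide_eq[OF h, of "of_int k0" s] pos_divide_less_eq[OF h, of s "of_int k0 + 1"]
      by (auto simp: k0_def)
    have ind: "ind k s = (if k = k0 then 1 else 0)" for k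
    proof -
      have "k = k0" if "of_int k * h \<le> s" "s < (of_int k + 1) * h"
        unfolding k0_def by (rule floor_unique[symmetric]) (use that in \<open>simp_all only: pos_le_divide_eq[OF h] pos_divide_less_eq[OF h]\<close>)
      then have "s \<in> {of_int k * h..<(of_int k + 1) * h} \<longleftrightarrow> k = k0"
        using k0 unfolding atLeastLessThan_iff by blast
      then show ?thesis unfolding ind_def indicator_def by (simp only: of_bool_def)
    qed
    have sum: "(\<Sum>k\<in>{- int n..<int n}. ind k s *\<^sub>R T s (F (t - of_int k * h))) =
      (if k0 \<in> {- int n..<int n} then T s (F (t - of_int k0 * h)) else 0)"
    proof -
      have "(\<Sum>k\<in>{- int n..<int n}. ind k s *\<^sub>R T s (F (t - of_int k * h))) =
        (\<Sum>k\<in>{- int n..<int n}. if k = k0 then T s (F (t - of_int k * h)) else 0)"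
        by (intro sum.cong) (auto simp: ind)
      then show ?thesis by (simp add: sum.delta)
    qed
    have M: "0 \<le> M" using F(2)[of 0] norm_ge_zero order_trans by blast
    show "norm (T s (F (t - s)) - (\<Sum>k\<in>{- int n..<int n}. ind k s *\<^sub>R T s (F (t - of_int k * h))))
      \<le> C * (\<eta> * kern p s + M * (indicator {s. real n * h \<le> \<bar>s\<bar>} s *\<^sub>R kern p s))"
    proof (cases "k0 \<in> {- int n..<int n}")
      case True
      have "norm (F (t - of_int k0 * h - (s - of_int k0 * h)) - F (t - of_int k0 * h)) \<le> \<eta>"
        by (rule md) (use k0 in \<open>auto simp: algebra_simps\<close>)
      then have "norm (F (t - s) - F (t - of_int k0 * h)) \<le> \<eta>" by simp
      then have "norm (T s (F (t - s) - F (t - of_int k0 * h))) \<le> (C * \<eta>) * kern p s"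
        by (rule scaled_kern[OF p T C])
      also have "\<dots> \<le> C * (\<eta> * kern p s + M * (indicator {s. real n * h \<le> \<bar>s\<bar>} s *\<^sub>R kern p s))"
        using C M kern_nonneg[of p s] by (simp add: distrib_left)
      finally show ?thesis using True
        by (simp add: sum linear_diff[OF bounded_linear.linear[OF opfam_linear[OF T]]])
    next
      case False
      \<comment> \<open>The cells with indices from \<open>- n\<close> to \<open>n - 1\<close> tile
        exactly the half-open interval from \<open>- n * h\<close> to \<open>n * h\<close>, so any
        other index forces \<open>s\<close> into the tail.\<close>
      then have "k0 < - int n \<or> int n \<le> k0" by auto
      then have "real n * h \<le> \<bar>s\<bar>"
      proof
        assume "k0 < - int n"
        then have "(of_int k0 + 1 :: real) \<le> - real n" by linarith
        then have "(of_int k0 + 1) * h \<le> - real n * h" using h by (intro mult_right_mono) auto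
        then show ?thesis using k0 by auto
      next
        assume "int n \<le> k0"
        then have "real n \<le> (of_int k0 :: real)" by linarith
        then have "real n * h \<le> of_int k0 * h" using h by (intro mult_right_mono) auto
        then show ?thesis using k0 by auto
      qed
      moreover have "norm (T s (F (t - s))) \<le> (C * M) * kern p s" by (rule scaled_kern[OF p T C F(2)])
      ultimately show ?thesis using False C \<eta> kern_nonneg[of p s]
        by (simp only: sum if_False diff_zero) (simp add: distrib_left add_increasing)
    qed
  qed
  have 3: "integral UNIV (\<lambda>s. C * (\<eta> * kern p s + M * (indicator {s. real n * h \<le> \<bar>s\<bar>} s *\<^sub>R kern p s)))
     = C * (\<eta> * kint p + M * tail (real n * h))"
  proof -
    have "integral UNIV (\<lambda>s. \<eta> * kern p s + M * (indicator {s. real n * h \<le> \<bar>s\<bar>} s *\<^sub>R kern p s)) =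
      \<eta> * kint p + M * tail (real n * h)"
      unfolding kint_def[OF p] tail_def
      by (subst integral_add) (auto intro!: integrable_on_mult_right kern_integrable p tail_integrable[simplified])
    then show ?thesis by simp
  qed
  show ?thesis unfolding 1 using 2 unfolding 3 .
qed

text \<open>The right-hand side is the convolution of \<open>T\<close> with \<open>t \<mapsto> exp (i lam t) x\<close>, evaluated at 0.\<close>

lemma fourier_eq:
  assumes T: "nice p T"
  shows "fourier T lam x = integral UNIV (\<lambda>s. T s (cscale (cis ((0 - s) * lam)) x))"
  by (simp add: fourier_def bop_cscale[OF nice_bop[OF p T]] cis_conv_exp algebra_simps)

text \<open>\<open>cop T * G\<close> and the Fourier transform are approximated by lattice sums with
  the same cell weights. Their difference consists of the terms \<open>Tr (k * h)\<close> minus a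
  scalar, each divisible by \<open>1 - Mc (cis (h * lam)) * Tr h\<close>. The first half of the
  error bound uses the modulus of \<open>G\<close>, the second that of the exponential.\<close>

lemma delta_split:
  fixes T :: "real \<Rightarrow> 'a::complex_banach \<Rightarrow> 'a" and G :: "(real \<Rightarrow>\<^sub>C 'a) endo"
  assumes nT: "nice p T" and T: "opfam T (\<lambda>s. C * kern p s)" and C: "0 \<le> C"
    and A: "bop (fourier T lam)" and G: "ti G" and h: "0 < h" and \<eta>: "0 \<le> \<eta>"
    and md: "\<And>\<delta>. 0 \<le> \<delta> \<Longrightarrow> \<delta> \<le> h \<Longrightarrow> norm (Tr \<delta> * G - G) \<le> \<eta>"
  shows "\<exists>v e. (cop T - Kc (fourier T lam)) * G = (1 - Mc (cis (h * lam)) * Tr h) * v + e \<and> ti v \<and> ti e \<and>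
    norm v \<le> (\<Sum>k\<in>{- int n..<int n}. norm (Kc (cell T h k)) * \<bar>of_int k\<bar>) * norm G \<and>
    norm e \<le> C * (\<eta> * kint p + norm G * tail (real n * h)) + C * (h * \<bar>lam\<bar> * kint p + tail (real n * h)) * norm G"
proof -
  let ?I = "{- int n..<int n}"
  define K where "K k = Kc (cell T h k)" for k
  define M where "M k = (Mc (cis (- (of_int k * h * lam))) :: (real \<Rightarrow>\<^sub>C 'a) endo)" for k :: int
  define z where "z = 1 - (Mc (cis (h * lam)) * Tr h :: (real \<Rightarrow>\<^sub>C 'a) endo)"
  have Kti: "ti (K k)" for k unfolding K_def by (rule ti_Kc[OF cell_bop[OF nT]])
  have "\<exists>v. Tr (of_int k * h) - M k = z * v \<and> ti v \<and> norm v \<le> \<bar>of_int k\<bar>" for k :: int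
    using Tr_diff_factor[of k h lam] by (simp add: M_def z_def)
  then obtain V where V: "\<And>k. Tr (of_int k * h) - M k = z * V k" "\<And>k. ti (V k)" "\<And>k. norm (V k) \<le> \<bar>of_int k\<bar>"
    by metis
  define e1 where "e1 = (cop T - (\<Sum>k\<in>?I. K k * Tr (of_int k * h))) * G"
  define e2 where "e2 = Kc (fourier T lam) - (\<Sum>k\<in>?I. K k * M k)"
  define v where "v = (\<Sum>k\<in>?I. K k * V k) * G"
  have "(\<Sum>k\<in>?I. K k * Tr (of_int k * h)) - (\<Sum>k\<in>?I. K k * M k) = z * (\<Sum>k\<in>?I. K k * V k)"
  proof -
    have "K k * (z * V k) = z * (K k * V k)" for k
      unfolding z_def by (rule ti_swap[OF Kti])
    then show ?thesis by (simp add: sum_subtractf[symmetric] right_diff_distrib[symmetric] V(1) sum_distrib_left)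
  qed
  then have "(cop T - Kc (fourier T lam)) = (cop T - (\<Sum>k\<in>?I. K k * Tr (of_int k * h))) - e2 + z * (\<Sum>k\<in>?I. K k * V k)"
    by (simp add: e2_def algebra_simps)
  then have eq: "(cop T - Kc (fourier T lam)) * G = z * v + (e1 - e2 * G)"
    by (simp only:) (simp add: e1_def v_def distrib_right left_diff_distrib mult.assoc)
  have tv: "ti v" unfolding v_def by (intro ti_closed ti_sum Kti V G)
  have te: "ti (e1 - e2 * G)" unfolding e1_def e2_def M_def
    by (intro ti_closed ti_sum Kti G ti_basic cop_ti[OF p nT] ti_Kc A)
  have nv: "norm v \<le> (\<Sum>k\<in>?I. norm (K k) * \<bar>of_int k\<bar>) * norm G"
  proof -
    have "norm (\<Sum>k\<in>?I. K k * V k) \<le> (\<Sum>k\<in>?I. norm (K k) * \<bar>of_int k\<bar>)"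
      by (intro sum_norm_le order_trans[OF norm_mult_ineq] mult_left_mono V) auto
    then show ?thesis unfolding v_def by (intro order_trans[OF norm_mult_ineq] mult_right_mono) auto
  qed
  have ne1: "norm e1 \<le> C * (\<eta> * kint p + norm G * tail (real n * h))"
  proof (rule norm_endo_ev_le)
    show "0 \<le> C * (\<eta> * kint p + norm G * tail (real n * h))" using C \<eta> kint_nonneg[OF p] tail_nonneg by simp
    fix f t
    have "ev e1 f t = integral UNIV (\<lambda>s. T s (ev G f (t - s))) - (\<Sum>k\<in>?I. cell T h k (ev G f (t - of_int k * h)))"
      by (simp add: e1_def K_def cop[OF p nT] apply_bcontfun_sum Kc[OF bop_bl[OF cell_bop[OF nT]]] Tr)
    also have "norm \<dots> \<le> C * ((\<eta> * norm f) * kint p + (norm G * norm f) * tail (real n * h))"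
    proof (rule lattice_approx[OF T C _ norm_ev h])
      show "norm (ev G f (t - \<delta>) - ev G f t) \<le> \<eta> * norm f" if "0 \<le> \<delta>" "\<delta> \<le> h" for t \<delta>
        using norm_ev[of "Tr \<delta> * G - G" f t] mult_right_mono[OF md[OF that], of "norm f"] by (simp add: Tr)
    qed (use \<eta> in auto)
    finally show "norm (ev e1 f t) \<le> C * (\<eta> * kint p + norm G * tail (real n * h)) * norm f"
      by (simp add: algebra_simps)
  qed
  have ne2: "norm e2 \<le> C * (h * \<bar>lam\<bar> * kint p + tail (real n * h))"
  proof (rule norm_endo_ev_le)
    show "0 \<le> C * (h * \<bar>lam\<bar> * kint p + tail (real n * h))" using C h kint_nonneg[OF p] tail_nonneg by simp
    fix f :: "real \<Rightarrow>\<^sub>C 'a" and t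
    define x where "x = f t"
    have "ev e2 f t = integral UNIV (\<lambda>s. T s (cscale (cis ((0 - s) * lam)) x)) -
        (\<Sum>k\<in>?I. cell T h k (cscale (cis ((0 - of_int k * h) * lam)) x))"
      by (simp add: e2_def K_def M_def fourier_eq[OF nT] apply_bcontfun_sum Kc[OF bop_bl[OF cell_bop[OF nT]]]
          Kc[OF bop_bl[OF A]] Mc x_def)
    also have "norm \<dots> \<le> C * ((h * \<bar>lam\<bar> * norm x) * kint p + norm x * tail (real n * h))"
    proof (rule lattice_approx[OF T C, where F = "\<lambda>t. cscale (cis (t * lam)) x" and t = 0])
      have *: "norm (cscale (cis a) x - cscale (cis b) x) \<le> \<bar>a - b\<bar> * norm x" for a b
        using mult_right_mono[OF cmod_cis_diff_le[of a b], of "norm x"] by (simp add: norm_cscale_diff_left)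
      show "norm (cscale (cis ((t - \<delta>) * lam)) x - cscale (cis (t * lam)) x) \<le> h * \<bar>lam\<bar> * norm x"
        if "0 \<le> \<delta>" "\<delta> \<le> h" for t \<delta>
      proof -
        have "\<bar>(t - \<delta>) * lam - t * lam\<bar> = \<delta> * \<bar>lam\<bar>" using that by (simp add: left_diff_distrib abs_mult)
        moreover have "\<delta> * \<bar>lam\<bar> * norm x \<le> h * \<bar>lam\<bar> * norm x" using that by (intro mult_right_mono) auto
        ultimately show ?thesis using *[of "(t - \<delta>) * lam" "t * lam"] by simp
      qed
      show "continuous_on UNIV (\<lambda>t. cscale (cis (t * lam)) x)"
        by (rule continuous_on_cscale_left) (auto intro!: continuous_intros)
    qed (use h in \<open>auto simp: norm_cscale\<close>)
    also have "\<dots> = C * (h * \<bar>lam\<bar> * kint p + tail (real n * h)) * norm x" by (simp add: algebra_simps)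
    also have "\<dots> \<le> C * (h * \<bar>lam\<bar> * kint p + tail (real n * h)) * norm f"
      unfolding x_def using C h kint_nonneg[OF p] tail_nonneg
      by (intro mult_left_mono bcontfun_le) auto
    finally show "norm (ev e2 f t) \<le> C * (h * \<bar>lam\<bar> * kint p + tail (real n * h)) * norm f" .
  qed
  have "norm (e1 - e2 * G) \<le> norm e1 + norm e2 * norm G"
    using norm_triangle_ineq4[of e1 "e2 * G"] norm_mult_ineq[of e2 G] by linarith
  then have "norm (e1 - e2 * G) \<le> C * (\<eta> * kint p + norm G * tail (real n * h)) + C * (h * \<bar>lam\<bar> * kint p + tail (real n * h)) * norm G"
    using ne1 mult_right_mono[OF ne2, of "norm G"] by simp
  then show ?thesis using eq tv te nv unfolding z_def K_def by blast
qed

end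

lemma invertible_fourier_bop:
  assumes "invertible_bop (\<lambda>x. x + fourier T lam x)"
  shows "bop (fourier T lam)"
proof -
  have A: "bop (\<lambda>x. x + fourier T lam x)" using assms by (simp add: invertible_bop_def)
  have eq: "fourier T lam = (\<lambda>x. (x + fourier T lam x) - x)" by auto
  show ?thesis unfolding bop_def
  proof (intro conjI allI)
    show "bounded_linear (fourier T lam)"
      by (subst eq) (rule bounded_linear_sub[OF bop_bl[OF A] bounded_linear_ident])
    show "fourier T lam (cscale c x) = cscale c (fourier T lam x)" for c x
      using bop_cscale[OF A, of c x] by (simp add: cscale_add_right)
  qed
qed

lemma cos_le_half: assumes "pi / 3 \<le> x" "x \<le> 4 * pi / 3" shows "cos x \<le> 1 / 2"
proof (cases "x \<le> pi")
  case True
  then show ?thesis using cos_monotone_0_pi_le[of "pi / 3" x] assms cos_60 by simp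
next
  case False
  then have "cos (pi / 3) \<le> cos (x - pi)" using assms by (intro cos_monotone_0_pi_le) auto
  then show ?thesis using cos_60 by (simp add: cos_diff)
qed

section \<open>Uniform invertibility of the Fourier transform and the global inverse\<close>

context
  fixes p :: real
  assumes p: "1 < p"
begin

text \<open>The difference of the exponentials is at most \<open>R * r\<close> for
  \<open>\<bar>s\<bar> < R\<close>, and at most 2 elsewhere, where the kernel has small mass. The
  bound is uniform in \<open>x\<close>, hence holds in operator norm.\<close>

lemma fourier_continuous:
  fixes T :: "real \<Rightarrow> 'a::complex_banach \<Rightarrow> 'a"
  assumes nT: "nice p T" and \<epsilon>: "0 < \<epsilon>"
  shows "\<exists>r>0. \<forall>lam lam' x. \<bar>lam - lam'\<bar> < r \<longrightarrow> norm (fourier T lam x - fourier T lam' x) \<le> \<epsilon> * norm x"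
proof -
  obtain C where C: "0 \<le> C" and T: "opfam T (\<lambda>s. C * kern p s)" using nice_opfam[OF p nT] .
  \<comment> \<open>Makes \<open>2 * C * tail p R\<close> at most \<open>\<epsilon> / 2\<close>; the
    summand 1 covers \<open>C = 0\<close>.\<close>
  obtain R where R: "0 < R" "tail p R < \<epsilon> / (4 * C + 1)" using tail_small[OF p, of "\<epsilon> / (4 * C + 1)"] C \<epsilon> by (auto simp: add_nonneg_pos)
  have R': "C * (2 * tail p R) \<le> \<epsilon> / 2"
    using R(2) C tail_nonneg[OF p, of R] by (simp add: pos_less_divide_eq add_nonneg_pos algebra_simps)
  define r where "r = \<epsilon> / (2 * C * R * kint p + 1)"
  have d1: "0 < 2 * C * R * kint p + 1" using C R kint_nonneg[OF p] by (intro add_nonneg_pos) auto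
  have r: "0 < r" using d1 \<epsilon> by (simp add: r_def)
  have r': "C * (R * r * kint p) \<le> \<epsilon> / 2"
  proof -
    have "r * (2 * C * R * kint p + 1) = \<epsilon>" using d1 by (simp add: r_def)
    then show ?thesis using r by (simp add: algebra_simps)
  qed
  have "norm (fourier T lam x - fourier T lam' x) \<le> \<epsilon> * norm x" if d: "\<bar>lam - lam'\<bar> < r" for lam lam' x
  proof -
    have int: "(\<lambda>s. T s (cscale (cis ((0 - s) * l)) x)) integrable_on UNIV" for l
    proof (rule kern_dom_integrable(1)[OF p])
      show "smeas (\<lambda>s. T s (cscale (cis ((0 - s) * l)) x))"
        by (intro smeas_family[OF opfam_smeas[OF T] opfam_linear[OF T]] smeas_continuous continuous_on_cscale_left continuous_intros)
      show "norm (T s (cscale (cis ((0 - s) * l)) x)) \<le> (C * norm x) * kern p s" for s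
        by (rule scaled_kern[OF p T C]) (simp add: norm_cscale)
    qed
    have pt: "norm (T s (cscale (cis ((0 - s) * lam)) x) - T s (cscale (cis ((0 - s) * lam')) x)) \<le>
        C * norm x * ((R * r) * kern p s + 2 * (indicator {s. R \<le> \<bar>s\<bar>} s *\<^sub>R kern p s))" for s
    proof -
      have c1: "cmod (cis ((0 - s) * lam) - cis ((0 - s) * lam')) \<le> R * r + 2 * indicator {s. R \<le> \<bar>s\<bar>} s"
      proof (cases "R \<le> \<bar>s\<bar>")
        case True
        have "cmod (cis ((0 - s) * lam) - cis ((0 - s) * lam')) \<le> 1 + 1"
          by (rule order_trans[OF norm_triangle_ineq4]) simp
        then show ?thesis using True R r by (simp add: add_increasing)
      next
        case False
        have "cmod (cis ((0 - s) * lam) - cis ((0 - s) * lam')) \<le> \<bar>s\<bar> * \<bar>lam - lam'\<bar>"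
          using cmod_cis_diff_le[of "(0 - s) * lam" "(0 - s) * lam'"] by (simp add: abs_mult[symmetric] algebra_simps abs_minus_commute)
        also have "\<dots> \<le> R * r" using False d R by (intro mult_mono) auto
        finally show ?thesis using False by simp
      qed
      have "norm (T s (cscale (cis ((0 - s) * lam)) x - cscale (cis ((0 - s) * lam')) x))
        \<le> C * kern p s * (cmod (cis ((0 - s) * lam) - cis ((0 - s) * lam')) * norm x)"
        using opfam_le[OF T, of s "cscale (cis ((0 - s) * lam)) x - cscale (cis ((0 - s) * lam')) x"]
        unfolding norm_cscale_diff_left .
      also have "\<dots> \<le> C * kern p s * ((R * r + 2 * indicator {s. R \<le> \<bar>s\<bar>} s) * norm x)"
        using C kern_nonneg by (intro mult_left_mono mult_right_mono c1) auto
      finally show ?thesis by (simp add: linear_diff[OF bounded_linear.linear[OF opfam_linear[OF T]]] algebra_simps)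
    qed
    have ri: "(\<lambda>s. (R * r) * kern p s + 2 * (indicator {s. R \<le> \<bar>s\<bar>} s *\<^sub>R kern p s)) integrable_on UNIV"
      by (intro integrable_add integrable_on_mult_right kern_integrable p tail_integrable)
    have "norm (fourier T lam x - fourier T lam' x) =
      norm (integral UNIV (\<lambda>s. T s (cscale (cis ((0 - s) * lam)) x) - T s (cscale (cis ((0 - s) * lam')) x)))"
      unfolding fourier_eq[OF p nT] by (subst integral_diff[OF int int]) simp
    moreover have "norm (integral UNIV (\<lambda>s. T s (cscale (cis ((0 - s) * lam)) x) - T s (cscale (cis ((0 - s) * lam')) x)))
      \<le> integral UNIV (\<lambda>s. C * norm x * ((R * r) * kern p s + 2 * (indicator {s. R \<le> \<bar>s\<bar>} s *\<^sub>R kern p s)))"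
      by (rule integral_norm_bound_integral[OF integrable_diff[OF int int] integrable_on_mult_right[OF ri] pt])
    moreover have "integral UNIV (\<lambda>s. C * norm x * ((R * r) * kern p s + 2 * (indicator {s. R \<le> \<bar>s\<bar>} s *\<^sub>R kern p s)))
      = C * norm x * (R * r * kint p + 2 * tail p R)"
    proof -
      have "integral UNIV (\<lambda>s. (R * r) * kern p s + 2 * (indicator {s. R \<le> \<bar>s\<bar>} s *\<^sub>R kern p s))
        = R * r * kint p + 2 * tail p R"
        unfolding kint_def[OF p] tail_def[OF p]
        by (subst integral_add) (auto intro!: integrable_on_mult_right kern_integrable p tail_integrable[OF p, simplified])
      then show ?thesis by simp
    qed
    moreover have "C * norm x * (R * r * kint p + 2 * tail p R) \<le> \<epsilon> * norm x"
    proof -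
      have "C * (R * r * kint p + 2 * tail p R) \<le> \<epsilon>" using R' r' by (simp add: distrib_left)
      from mult_right_mono[OF this, of "norm x"] show ?thesis by (simp add: mult_ac)
    qed
    ultimately show ?thesis by linarith
  qed
  then show ?thesis using r by blast
qed

text \<open>If the transform moves by at most \<open>1 / (2 * \<beta> lam)\<close>, then a solution
  \<open>y\<close> of the perturbed equation satisfies
  \<open>norm y \<le> \<beta> lam * norm x + norm y / 2\<close>, so inverses are locally bounded;
  compactness makes the bound uniform for \<open>\<bar>lam\<bar> \<le> L\<close>.\<close>

lemma inverse_bound:
  fixes T :: "real \<Rightarrow> 'a::complex_banach \<Rightarrow> 'a"
  assumes nT: "nice p T" and inv: "\<And>lam. invertible_bop (\<lambda>x. x + fourier T lam x)"
  shows "\<exists>b\<ge>1. \<forall>lam. \<bar>lam\<bar> \<le> L \<longrightarrow> (\<exists>B. bop B \<and> (\<forall>x. B (x + fourier T lam x) = x) \<and>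
    (\<forall>x. B x + fourier T lam (B x) = x) \<and> norm (Kc B) \<le> b)"
proof -
  have "\<forall>lam. \<exists>B. bop B \<and> (\<forall>x. B (x + fourier T lam x) = x) \<and> (\<forall>x. B x + fourier T lam (B x) = x)"
    using inv unfolding invertible_bop_def by blast
  then obtain B where B: "\<And>lam. bop (B lam)" "\<And>lam x. B lam (x + fourier T lam x) = x"
    "\<And>lam x. B lam x + fourier T lam (B lam x) = x" by metis
  define \<beta> where "\<beta> lam = norm (Kc (B lam)) + 1" for lam
  have \<beta>: "0 < \<beta> lam" for lam by (simp add: \<beta>_def add_nonneg_pos)
  have B_le: "norm (B lam y) \<le> \<beta> lam * norm y" for lam y
    using Kc_ge[OF bop_bl[OF B(1)], of lam y] mult_right_mono[of "norm (Kc (B lam))" "\<beta> lam" "norm y"]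
    by (simp add: \<beta>_def)
  have "\<exists>r>0. \<forall>lam'. \<bar>lam - lam'\<bar> < r \<longrightarrow> norm (Kc (B lam')) \<le> 2 * \<beta> lam" for lam
  proof -
    obtain r where r: "r > 0" "\<And>lam' x. \<bar>lam - lam'\<bar> < r \<Longrightarrow> norm (fourier T lam x - fourier T lam' x) \<le> 1 / (2 * \<beta> lam) * norm x"
    proof -
      have "0 < 1 / (2 * \<beta> lam)" using \<beta>[of lam] by simp
      from fourier_continuous[OF nT this] show ?thesis using that by blast
    qed
    have "norm (Kc (B lam')) \<le> 2 * \<beta> lam" if d: "\<bar>lam - lam'\<bar> < r" for lam'
    proof (rule Kc(2)[OF bop_bl[OF B(1)]])
      fix x
      define y where "y = B lam' x"
      have yx: "y + fourier T lam' y = x" using B(3) by (simp add: y_def)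
      have "norm y = norm (B lam (y + fourier T lam y))" by (simp add: B(2))
      also have "\<dots> \<le> \<beta> lam * norm (y + fourier T lam y)" by (rule B_le)
      also have "\<dots> \<le> \<beta> lam * (norm x + 1 / (2 * \<beta> lam) * norm y)"
      proof (rule mult_left_mono)
        have "y + fourier T lam y = x + (fourier T lam y - fourier T lam' y)" using yx by (simp add: algebra_simps)
        then show "norm (y + fourier T lam y) \<le> norm x + 1 / (2 * \<beta> lam) * norm y"
          using norm_triangle_ineq[of x "fourier T lam y - fourier T lam' y"] r(2)[OF d, of y] by (metis add_left_mono order_trans)
      qed (use \<beta>[of lam] in simp)
      also have "\<dots> = \<beta> lam * norm x + norm y / 2" using \<beta>[of lam] by (simp add: field_simps)
      finally show "norm (B lam' x) \<le> 2 * \<beta> lam * norm x" by (simp add: y_def)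
    qed (use \<beta>[of lam] in simp)
    then show ?thesis using r(1) by blast
  qed
  then obtain r where r: "\<And>lam. 0 < r lam" "\<And>lam lam'. \<bar>lam - lam'\<bar> < r lam \<Longrightarrow> norm (Kc (B lam')) \<le> 2 * \<beta> lam"
    by metis
  have cover: "{-L..L} \<subseteq> (\<Union>c\<in>{-L..L}. ball c (r c))" using r(1) by force
  obtain D where D: "D \<subseteq> {-L..L}" "finite D" "{-L..L} \<subseteq> (\<Union>c\<in>D. ball c (r c))"
    by (rule compactE_image[OF compact_Icc _ cover]) auto
  define b where "b = 1 + (\<Sum>c\<in>D. 2 * \<beta> c)"
  have b1: "b \<ge> 1" unfolding b_def using \<beta> by (simp add: sum_nonneg less_imp_le)
  have "norm (Kc (B lam)) \<le> b" if "\<bar>lam\<bar> \<le> L" for lam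
  proof -
    have "lam \<in> {-L..L}" using that by auto
    then obtain c where c: "c \<in> D" "\<bar>c - lam\<bar> < r c" using D(3) by (auto simp: dist_real_def)
    have "2 * \<beta> c \<le> (\<Sum>c\<in>D. 2 * \<beta> c)" using \<beta> by (intro member_le_sum c D) (auto simp: less_imp_le)
    then show ?thesis using r(2)[OF c(2)] by (simp add: b_def)
  qed
  then show ?thesis using b1 B by blast
qed

text \<open>The order of choices is what makes the constants consistent: \<delta>0 from the modulus
  of \<open>G\<close>, then the frequency cut \<open>L\<close>, the bound \<open>b\<close> of the
  inverses, the radius \<open>R\<close> and the precision \<epsilon>, and only then the step
  \<open>h\<close>. The final bound \<open>Cv\<close> depends on \<open>h\<close> but not on
  \<nu>.\<close>

lemma cop_inverse:
  fixes T :: "real \<Rightarrow> 'a::complex_banach \<Rightarrow> 'a"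
  assumes nT: "nice p T" and inv: "\<And>lam. invertible_bop (\<lambda>x. x + fourier T lam x)"
    and modulus: "\<And>\<epsilon>. 0 < \<epsilon> \<Longrightarrow> \<exists>\<eta>>0. \<forall>\<delta>. \<bar>\<delta>\<bar> < \<eta> \<longrightarrow> norm (Tr \<delta> * cop T ^ N - cop T ^ N) \<le> \<epsilon>"
  shows "\<exists>J. J * (1 + cop T) = 1 \<and> (1 + cop T) * J = 1"
proof -
  obtain C where C: "0 \<le> C" and T: "opfam T (\<lambda>s. C * kern p s)" using nice_opfam[OF p nT] .
  note J0 = kint_nonneg[OF p]
  define a where "a = 1 + cop T"
  define G where "G = (- cop T) ^ N"
  define w0 where "w0 = (\<Sum>k<N. (- cop T) ^ k)"
  have w0: "1 - G = a * w0" "1 - G = w0 * a"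
    using geometric_factor[of "- cop T" N] by (simp_all add: a_def G_def w0_def)
  have aG: "a * G = G * a"
  proof -
    have "(- cop T) * G = G * (- cop T)" unfolding G_def by (rule power_commutes[symmetric])
    then show ?thesis by (simp add: a_def distrib_left distrib_right)
  qed
  have tT: "ti (cop T)" by (rule cop_ti[OF p nT])
  have ta: "ti a" unfolding a_def by (intro ti_closed ti_basic tT)
  have tG: "ti G" unfolding G_def by (intro ti_power ti_closed(4)[OF tT tT])
  have GP: "G = (-1) ^ N *\<^sub>R cop T ^ N" unfolding G_def by (induction N) auto
  have GN: "norm (Tr \<delta> * G - G) = norm (Tr \<delta> * cop T ^ N - cop T ^ N)" for \<delta>
  proof -
    have "Tr \<delta> * G - G = (-1) ^ N *\<^sub>R (Tr \<delta> * cop T ^ N - cop T ^ N)" by (simp add: GP scaleR_diff_right)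
    then show ?thesis by (simp add: power_abs)
  qed
  define g where "g = norm G"
  have g: "0 \<le> g" by (simp add: g_def)
  obtain \<eta>1 where \<eta>1: "\<eta>1 > 0" "\<And>\<delta>. \<bar>\<delta>\<bar> < \<eta>1 \<Longrightarrow> norm (Tr \<delta> * G - G) \<le> 1/2"
    using modulus[of "1/2"] unfolding GN by auto
  define \<delta>0 where "\<delta>0 = \<eta>1 / 2"
  have \<delta>0: "0 < \<delta>0" "\<And>\<delta>. \<bar>\<delta>\<bar> \<le> \<delta>0 \<Longrightarrow> norm (Tr \<delta> * G - G) \<le> 1/2"
    using \<eta>1 by (auto simp: \<delta>0_def)
  \<comment> \<open>With this cut, \<open>pi / (3 * L) = pi * \<delta>0 / 9\<close> is less than
    \<open>\<delta>0 / 2\<close>; together with \<open>h \<le> \<delta>0 / 2\<close> it keeps the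
    translation used at high frequency within \<delta>0.\<close>
  define L where "L = 3 / \<delta>0"
  have L: "0 < L" using \<delta>0 by (simp add: L_def)
  obtain b where b: "1 \<le> b" and binv: "\<And>lam. \<bar>lam\<bar> \<le> L \<Longrightarrow> \<exists>B. bop B \<and> (\<forall>x. B (x + fourier T lam x) = x) \<and>
    (\<forall>x. B x + fourier T lam (B x) = x) \<and> norm (Kc B) \<le> b" using inverse_bound[OF nT inv, of L] by blast
  \<comment> \<open>Three error terms of at most 1/6 each have to add up to 1/2. The summand 1 in
    the denominator covers the case that the coefficient vanishes.\<close>
  have frac: "x * (1 / (6 * x + 1)) \<le> 1/6" "0 < 1 / (6 * x + 1)" if "0 \<le> x" for x :: real
  proof -
    have "0 < 6 * x + 1" using that by simp
    then show "x * (1 / (6 * x + 1)) \<le> 1/6" "0 < 1 / (6 * x + 1)" by (simp_all add: divide_le_eq)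
  qed
  have nn: "0 \<le> 2 * b * C * g" "0 \<le> b * C * kint p" "0 \<le> b * C * L * kint p * g"
    using b C g J0 L by auto
  obtain R where R: "0 < R" "tail p R < 1 / (6 * (2 * b * C * g) + 1)"
    using tail_small[OF p frac(2)[OF nn(1)]] by blast
  have e1: "2 * b * C * g * tail p R \<le> 1/6"
    using mult_left_mono[OF less_imp_le[OF R(2)] nn(1)] frac(1)[OF nn(1)] by linarith
  define \<epsilon> where "\<epsilon> = 1 / (6 * (b * C * kint p) + 1)"
  have \<epsilon>: "0 < \<epsilon>" "b * C * kint p * \<epsilon> \<le> 1/6" using frac[OF nn(2)] by (auto simp: \<epsilon>_def)
  obtain \<eta>2 where \<eta>2: "\<eta>2 > 0" "\<And>\<delta>. \<bar>\<delta>\<bar> < \<eta>2 \<Longrightarrow> norm (Tr \<delta> * G - G) \<le> \<epsilon>"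
    using modulus[OF \<epsilon>(1)] unfolding GN by auto
  \<comment> \<open>The three constraints on the step: translations below it move \<open>G\<close>
    by at most \<epsilon>, it fits into half of \<delta>0, and the exponential error
    \<open>h * L\<close> stays small after multiplication by its coefficient.\<close>
  define hm where "hm = min (\<eta>2) (min (\<delta>0 / 2) (1 / (6 * (b * C * L * kint p * g) + 1)))"
  have hm: "0 < hm" unfolding hm_def using \<eta>2 \<delta>0 frac(2)[OF nn(3)] by auto
  obtain n :: nat where n: "R / hm < real n" using reals_Archimedean2 by blast
  have n0: "0 < real n" using n R hm by (meson divide_pos_pos order_less_trans)
  \<comment> \<open>\<open>h\<close> divides \<open>R\<close> exactly, so the lattice window ends at
    \<open>R\<close> and \<open>tail p R\<close> is the tail occurring in
    \<open>delta_split\<close>.\<close>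
  define h where "h = R / real n"
  have h: "0 < h" using R n0 by (simp add: h_def)
  have hhm: "h < hm" using n n0 hm by (simp add: h_def divide_less_eq mult.commute)
  have nh: "real n * h = R" using n0 by (simp add: h_def)
  have e3: "b * C * L * kint p * g * h \<le> 1/6"
  proof -
    have "h \<le> 1 / (6 * (b * C * L * kint p * g) + 1)" using hhm by (simp add: hm_def)
    from mult_left_mono[OF this nn(3)] frac(1)[OF nn(3)] show ?thesis by linarith
  qed
  have md: "norm (Tr \<delta> * G - G) \<le> \<epsilon>" if "0 \<le> \<delta>" "\<delta> \<le> h" for \<delta>
    using \<eta>2(2)[of \<delta>] that hhm by (simp add: hm_def)
  have E: "b * (C * (\<epsilon> * kint p + g * tail p R) + C * (h * \<bar>lam\<bar> * kint p + tail p R) * g) \<le> 1/2" if "\<bar>lam\<bar> \<le> L" for lam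
  proof -
    have "b * C * kint p * g * h * \<bar>lam\<bar> \<le> b * C * kint p * g * h * L"
      using that b C J0 g h by (intro mult_left_mono) auto
    then have "b * C * kint p * g * h * \<bar>lam\<bar> \<le> 1/6" using e3 by (simp add: mult_ac)
    then show ?thesis using e1 \<epsilon>(2) by (simp add: algebra_simps)
  qed
  define S where "S = (\<Sum>k\<in>{- int n..<int n}. norm (Kc (cell T h k)) * \<bar>of_int k :: real\<bar>)"
  have S: "0 \<le> S" unfolding S_def by (intro sum_nonneg) auto
  \<comment> \<open>The first summand serves low frequencies, where the cofactor is a sum over
    cells. The second serves high frequencies, where a translation by \<open>k\<close> steps has
    \<open>k \<le> \<delta>0 / h\<close>.\<close>
  define Cv where "Cv = b * S * g + \<delta>0 / h * g"
  have Cv: "0 \<le> Cv" "b * S * g \<le> Cv" "\<delta>0 / h * g \<le> Cv"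
    using b S g \<delta>0 h by (auto simp: Cv_def)
  txt \<open>At low frequency \<open>cop T\<close> is replaced by its Fourier transform, at the cost of a multiple of
    \<open>1 - \<nu> Tr h\<close> and of an error that is small because \<open>G\<close> makes translations by less than \<open>h\<close> negligible.\<close>
  have low: "\<exists>w w' v v' e e'. 1 = w * a + (1 - Mc \<nu> * Tr h) * v + e \<and> 1 = a * w' + (1 - Mc \<nu> * Tr h) * v' + e' \<and>
      ti v \<and> ti v' \<and> ti e \<and> ti e' \<and> norm v \<le> Cv \<and> norm v' \<le> Cv \<and> norm e \<le> 1/2 \<and> norm e' \<le> 1/2"
    if lam: "\<bar>lam\<bar> \<le> L" and \<nu>: "\<nu> = cis (h * lam)" for \<nu> lam
  proof -
    obtain B where B: "bop B" "\<And>x. B (x + fourier T lam x) = x" "\<And>x. B x + fourier T lam (B x) = x" "norm (Kc B) \<le> b"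
      using binv[OF lam] by blast
    define A where "A = Kc (fourier T lam)"
    define z where "z = 1 - (Mc \<nu> * Tr h :: (real \<Rightarrow>\<^sub>C 'a) endo)"
    have fb: "bop (fourier T lam)" by (rule invertible_fourier_bop[OF inv])
    have BA: "Kc B * (1 + A) = 1" "(1 + A) * Kc B = 1"
      by (rule ev_ext, simp add: A_def Kc[OF bop_bl[OF B(1)]] Kc[OF bop_bl[OF fb]] B)+
    have tB: "ti (Kc B)" by (rule ti_Kc[OF B(1)])
    have tBG: "ti (Kc B * G)" by (rule ti_closed(3)[OF tB tG])
    have nBG: "norm (Kc B * G) \<le> b * g" unfolding g_def
      by (rule order_trans[OF norm_mult_ineq]) (intro mult_right_mono B, auto)
    have mdB: "norm (Tr \<delta> * (Kc B * G) - Kc B * G) \<le> b * \<epsilon>" if "0 \<le> \<delta>" "\<delta> \<le> h" for \<delta>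
    proof -
      have "Tr \<delta> * (Kc B * G) = (Kc B * Tr \<delta>) * G" using tB by (simp add: ti_def mult.assoc)
      then have "Tr \<delta> * (Kc B * G) - Kc B * G = Kc B * (Tr \<delta> * G - G)" by (simp add: right_diff_distrib mult.assoc)
      then have "norm (Tr \<delta> * (Kc B * G) - Kc B * G) \<le> norm (Kc B) * norm (Tr \<delta> * G - G)" by (simp add: norm_mult_ineq)
      also have "\<dots> \<le> b * \<epsilon>" using b by (intro mult_mono B md that) auto
      finally show ?thesis .
    qed
    obtain v e where ve: "(cop T - A) * G = z * v + e" "ti v" "ti e" "norm v \<le> S * g"
      "norm e \<le> C * (\<epsilon> * kint p + g * tail p R) + C * (h * \<bar>lam\<bar> * kint p + tail p R) * g"
      using delta_split[OF p nT T C fb tG h less_imp_le[OF \<epsilon>(1)] md, of n]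
      unfolding \<nu>[symmetric] z_def[symmetric] A_def[symmetric] S_def[symmetric] g_def[symmetric] nh by blast
    have b\<epsilon>: "0 \<le> b * \<epsilon>" using b \<epsilon> by simp
    \<comment> \<open>For the right-sided identity the inverse must stand to the right of
      \<open>cop T - A\<close>, so the splitting is applied to \<open>Kc B * G\<close> in place of
      \<open>G\<close>; its modulus is \<open>mdB\<close>.\<close>
    obtain v' e' where ve': "(cop T - A) * (Kc B * G) = z * v' + e'" "ti v'" "ti e'" "norm v' \<le> S * norm (Kc B * G)"
      "norm e' \<le> C * (b * \<epsilon> * kint p + norm (Kc B * G) * tail p R) + C * (h * \<bar>lam\<bar> * kint p + tail p R) * norm (Kc B * G)"
      using delta_split[OF p nT T C fb tBG h b\<epsilon> mdB, of n]
      unfolding \<nu>[symmetric] z_def[symmetric] A_def[symmetric] S_def[symmetric] nh by blast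
    have "G = Kc B * (1 + A) * G" by (simp add: BA)
    also have "\<dots> = Kc B * (a * G) - Kc B * ((cop T - A) * G)"
      by (simp add: a_def algebra_simps)
    also have "\<dots> = Kc B * G * a - (z * (Kc B * v) + Kc B * e)"
      unfolding ve(1) aG by (simp only: distrib_left z_def ti_swap[OF tB] mult.assoc)
    finally have G1: "G = Kc B * G * a - (z * (Kc B * v) + Kc B * e)" .
    have "1 = (1 - G) + G" by simp
    also have "\<dots> = w0 * a + (Kc B * G * a - (z * (Kc B * v) + Kc B * e))" using G1 w0(2) by simp
    also have "\<dots> = (w0 + Kc B * G) * a + z * (- (Kc B * v)) + (- (Kc B * e))" by (simp add: algebra_simps)
    finally have l: "1 = (w0 + Kc B * G) * a + z * (- (Kc B * v)) + (- (Kc B * e))" .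
    have "G = (1 + A) * Kc B * G" by (simp add: BA)
    also have "\<dots> = a * (Kc B * G) - (cop T - A) * (Kc B * G)" by (simp add: a_def algebra_simps)
    finally have G2: "G = a * (Kc B * G) - (z * v' + e')" unfolding ve'(1) .
    have "1 = (1 - G) + G" by simp
    also have "\<dots> = a * w0 + (a * (Kc B * G) - (z * v' + e'))" using G2 w0(1) by simp
    also have "\<dots> = a * (w0 + Kc B * G) + z * (- v') + (- e')" by (simp add: algebra_simps)
    finally have r: "1 = a * (w0 + Kc B * G) + z * (- v') + (- e')" .
    have n1: "norm (- (Kc B * v)) \<le> Cv"
    proof -
      have "norm (Kc B * v) \<le> b * (S * g)"
        by (rule order_trans[OF norm_mult_ineq]) (rule mult_mono, use B ve b in auto)
      then show ?thesis using Cv(2) by (simp add: mult_ac)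
    qed
    have n2: "norm (- v') \<le> Cv"
      using ve'(4) mult_left_mono[OF nBG S] Cv(2) by (simp add: mult_ac)
    have n3: "norm (- (Kc B * e)) \<le> 1/2"
    proof -
      have "norm (Kc B * e) \<le> b * (C * (\<epsilon> * kint p + g * tail p R) + C * (h * \<bar>lam\<bar> * kint p + tail p R) * g)"
        by (rule order_trans[OF norm_mult_ineq]) (rule mult_mono, use B ve b in auto)
      then show ?thesis using E[OF lam] by simp
    qed
    have n4: "norm (- e') \<le> 1/2"
    proof -
      have "C * (b * \<epsilon> * kint p + norm (Kc B * G) * tail p R) + C * (h * \<bar>lam\<bar> * kint p + tail p R) * norm (Kc B * G)
        \<le> C * (b * \<epsilon> * kint p + (b * g) * tail p R) + C * (h * \<bar>lam\<bar> * kint p + tail p R) * (b * g)"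
        using C h J0 tail_nonneg[OF p, of R] by (intro add_mono mult_left_mono mult_right_mono nBG order_refl) auto
      also have "\<dots> = b * (C * (\<epsilon> * kint p + g * tail p R) + C * (h * \<bar>lam\<bar> * kint p + tail p R) * g)" by (simp add: algebra_simps)
      finally show ?thesis using ve'(5) E[OF lam] by simp
    qed
    show ?thesis
      using l r n1 n2 n3 n4 ti_closed(4)[OF ti_closed(3)[OF tB ve(2)] tB] ti_closed(4)[OF ti_closed(3)[OF tB ve(3)] tB]
        ti_closed(4)[OF ve'(2) tB] ti_closed(4)[OF ve'(3) tB]
      unfolding z_def by blast
  qed
  txt \<open>At high frequency some \<open>Tr (k h)\<close> with \<open>k h \<le> \<delta>0\<close> is congruent to a scalar at distance at least 1
    from 1, although it nearly fixes \<open>G\<close>.\<close>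
  have high: "\<exists>w w' v v' e e'. 1 = w * a + (1 - Mc \<nu> * Tr h) * v + e \<and> 1 = a * w' + (1 - Mc \<nu> * Tr h) * v' + e' \<and>
      ti v \<and> ti v' \<and> ti e \<and> ti e' \<and> norm v \<le> Cv \<and> norm v' \<le> Cv \<and> norm e \<le> 1/2 \<and> norm e' \<le> 1/2"
    if lam: "\<not> \<bar>lam\<bar> \<le> L" and lh: "\<bar>lam\<bar> * h \<le> pi" and \<nu>: "\<nu> = cis (h * lam)" for \<nu> lam
  proof -
    define c where "c = \<bar>lam\<bar> * h"
    have c: "0 < c" "c \<le> pi" using lam L h lh by (auto simp: c_def)
    \<comment> \<open>The least number of steps for which the phase \<open>k * c\<close> reaches
      \<open>pi / 3\<close>. As \<open>c \<le> pi\<close>, it overshoots to at most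
      \<open>4 * pi / 3\<close>, so the cosine is at most 1/2 and the scalar \<zeta> stays at
      distance at least 1 from 1.\<close>
    define k where "k = \<lceil>pi / (3 * c)\<rceil>"
    have k: "pi / (3 * c) \<le> of_int k" "of_int k < pi / (3 * c) + 1" by (auto simp: k_def) linarith+
    have k0: "(0::real) < of_int k" using k(1) c by (meson divide_pos_pos mult_pos_pos order_less_le_trans pi_gt_zero zero_less_numeral)
    have kc: "pi / 3 \<le> of_int k * c" "of_int k * c \<le> 4 * pi / 3"
    proof -
      show "pi / 3 \<le> of_int k * c" using mult_right_mono[OF k(1), of c] c by simp
      have "of_int k * c \<le> (pi / (3 * c) + 1) * c" using k(2) c by (intro mult_right_mono) auto
      then show "of_int k * c \<le> 4 * pi / 3" using c by (simp add: distrib_right)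
    qed
    have kh: "of_int k * h \<le> \<delta>0"
    proof -
      have "of_int k * h \<le> (pi / (3 * c) + 1) * h" using k(2) h by (intro mult_right_mono) auto
      also have "\<dots> = pi / (3 * \<bar>lam\<bar>) + h" using h c by (simp add: c_def field_simps)
      also have "\<dots> \<le> pi / (3 * L) + \<delta>0 / 2"
        using lam L hhm by (intro add_mono divide_left_mono) (auto simp: hm_def)
      also have "\<dots> \<le> \<delta>0"
      proof -
        have "pi / (3 * L) = pi * \<delta>0 / 9" using \<delta>0 by (simp add: L_def)
        moreover have "pi * \<delta>0 \<le> 4 * \<delta>0" using pi_less_4 \<delta>0 by (intro mult_right_mono) auto
        ultimately show ?thesis using \<delta>0(1) by linarith
      qed
      finally show ?thesis .
    qed
    define \<zeta> where "\<zeta> = cis (- (of_int k * h * lam))"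
    have z1: "1 \<le> cmod (\<zeta> - 1)"
    proof -
      have "Re \<zeta> = cos (of_int k * c)"
        using h by (simp add: \<zeta>_def c_def abs_if mult_ac)
      then have "Re \<zeta> \<le> 1/2" using cos_le_half[OF kc] by simp
      moreover have "(cmod (\<zeta> - 1))\<^sup>2 = 2 - 2 * Re \<zeta>"
      proof -
        have "(cmod \<zeta>)\<^sup>2 = (Re \<zeta>)\<^sup>2 + (Im \<zeta>)\<^sup>2" by (rule cmod_power2)
        moreover have "cmod \<zeta> = 1" by (simp add: \<zeta>_def)
        moreover have "(cmod (\<zeta> - 1))\<^sup>2 = (Re \<zeta> - 1)\<^sup>2 + (Im \<zeta>)\<^sup>2" by (simp add: cmod_power2)
        ultimately show ?thesis by (simp add: power2_eq_square algebra_simps)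
      qed
      ultimately have "1\<^sup>2 \<le> (cmod (\<zeta> - 1))\<^sup>2" by simp
      then show ?thesis by (rule power2_le_imp_le) simp
    qed
    then have z0: "\<zeta> - 1 \<noteq> 0" by auto
    define q where "q = 1 / (\<zeta> - 1)"
    have q: "cmod q \<le> 1" using z1 by (simp add: q_def norm_divide divide_le_eq)
    obtain v0 :: "(real \<Rightarrow>\<^sub>C 'a) endo" where v0: "Tr (of_int k * h) - Mc \<zeta> = (1 - Mc \<nu> * Tr h) * v0" "ti v0" "norm v0 \<le> \<bar>of_int k\<bar>"
      using Tr_diff_factor[of k h lam, where 'a='a] unfolding \<zeta>_def[symmetric] \<nu>[symmetric] by blast
    define z where "z = 1 - (Mc \<nu> * Tr h :: (real \<Rightarrow>\<^sub>C 'a) endo)"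
    define e where "e = Mc q * (Tr (of_int k * h) * G - G)"
    define v where "v = - (Mc q * (v0 * G))"
    have "Mc q * Mc \<zeta> - Mc q = (1 :: (real \<Rightarrow>\<^sub>C 'a) endo)"
    proof (rule ev_ext)
      fix f :: "real \<Rightarrow>\<^sub>C 'a" and t
      have "cscale (q * \<zeta>) (f t) = cscale (q * (\<zeta> - 1) + q) (f t)" by (simp add: algebra_simps)
      also have "\<dots> = f t + cscale q (f t)" using z0 cscale_of_real[of 1 "apply_bcontfun f t"] by (simp add: cscale_add_left q_def)
      finally show "ev (Mc q * Mc \<zeta> - Mc q) f t = ev 1 f t" by (simp add: Mc cscale_assoc)
    qed
    then have "G = (Mc q * Mc \<zeta> - Mc q) * G" by simp
    also have "\<dots> = Mc q * (Tr (of_int k * h) * G - G) - Mc q * ((Tr (of_int k * h) - Mc \<zeta>) * G)"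
      by (simp add: algebra_simps)
    also have "\<dots> = e - Mc q * (z * (v0 * G))" by (simp only: v0(1) e_def z_def mult.assoc)
    also have "\<dots> = z * v + e" unfolding z_def v_def by (simp only: ti_swap[OF ti_basic(4)]) simp
    finally have Ge: "G = z * v + e" .
    have "1 = w0 * a + z * v + e" "1 = a * w0 + z * v + e"
      using Ge w0 by (metis add.assoc diff_add_cancel)+
    moreover have "ti v" "ti e" unfolding v_def e_def
      by (intro ti_closed(4)[OF _ ti_basic(1)] ti_closed(2) ti_closed(3) ti_basic v0 tG)+
    moreover have "norm e \<le> 1/2"
    proof -
      have "norm e \<le> 1 * (1/2)" unfolding e_def
        using \<delta>0(2)[of "of_int k * h"] kh k0 h
        by (intro order_trans[OF norm_mult_ineq] mult_mono order_trans[OF Mc(2) q]) auto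
      then show ?thesis by simp
    qed
    moreover have "norm v \<le> Cv"
    proof -
      have "norm (v0 * G) \<le> of_int k * g" unfolding g_def
        using v0(3) k0 by (intro order_trans[OF norm_mult_ineq] mult_right_mono) auto
      then have "norm v \<le> 1 * (of_int k * g)" unfolding v_def norm_minus_cancel
        by (rule order_trans[OF norm_mult_ineq mult_mono[OF order_trans[OF Mc(2) q]]]) simp_all
      moreover have "of_int k * g \<le> \<delta>0 / h * g" using kh h g by (intro mult_right_mono) (auto simp: pos_le_divide_eq)
      ultimately show ?thesis using Cv(3) by simp
    qed
    ultimately show ?thesis unfolding z_def by blast
  qed
  have loc: "\<exists>w w' v v' e e'. 1 = w * a + (1 - Mc \<nu> * Tr h) * v + e \<and> 1 = a * w' + (1 - Mc \<nu> * Tr h) * v' + e' \<and>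
      ti v \<and> ti v' \<and> ti e \<and> ti e' \<and> norm v \<le> Cv \<and> norm v' \<le> Cv \<and> norm e \<le> 1/2 \<and> norm e' \<le> 1/2"
    if \<nu>: "cmod \<nu> = 1" for \<nu>
  proof -
    \<comment> \<open>Every unimodular \<nu> is \<open>cis (h * lam)\<close> for a frequency with
      \<open>\<bar>lam\<bar> * h \<le> pi\<close>, and this bound is what the high frequency case
      relies on.\<close>
    define lam where "lam = Arg \<nu> / h"
    have "\<nu> \<noteq> 0" using \<nu> by auto
    then have "\<nu> = cis (Arg \<nu>)" using cis_Arg[of \<nu>] \<nu> by (simp add: sgn_div_norm)
    then have n: "\<nu> = cis (h * lam)" using h by (simp add: lam_def)
    have lh: "\<bar>lam\<bar> * h \<le> pi" using h Arg_bounded[of \<nu>] by (auto simp: lam_def abs_if)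
    show ?thesis using low[OF _ n] high[OF _ lh n] by blast
  qed
  interpret rotation "Tr h" "Tr (- h)" "Mc :: complex \<Rightarrow> (real \<Rightarrow>\<^sub>C 'a) endo" by (rule rotation_Tr)
  obtain l where l: "norm (1 - l * a) < 1"
    using left_inverse[OF Cv(1), of a] loc ti_comm by metis
  obtain r where r: "norm (1 - a * r) < 1"
    using right_inverse[OF Cv(1) ti_comm[OF ta]] loc ti_comm by metis
  obtain yl where yl: "yl * (l * a) = 1" using neumann_inverse[OF l] by auto
  obtain yr where yr: "(a * r) * yr = 1" using neumann_inverse[OF r] by auto
  have L1: "(yl * l) * a = 1" and R1: "a * (r * yr) = 1" using yl yr by (simp_all add: mult.assoc)
  have "yl * l = (yl * l) * (a * (r * yr))" by (simp only: R1 mult_1_right)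
  also have "\<dots> = ((yl * l) * a) * (r * yr)" by (rule mult.assoc[symmetric])
  also have "\<dots> = r * yr" by (simp only: L1 mult_1_left)
  finally have "a * (yl * l) = 1" using R1 by simp
  with L1 show ?thesis unfolding a_def[symmetric] by blast
qed

end

section \<open>Decay of the inverse\<close>

text \<open>The weight varies slowly: a shift by at most \<open>R\<close> costs a factor that tends
  to 1 as \<kappa> tends to 0.\<close>

lemma kern_ratio_le:
  assumes p: "0 \<le> p" and k: "0 < \<kappa>" and sR: "\<bar>s\<bar> \<le> R"
  shows "kern p (\<kappa> * (t - s)) \<le> (1 + \<kappa> * R) powr p * kern p (\<kappa> * t)"
    "kern p (\<kappa> * t) \<le> (1 + \<kappa> * R) powr p * kern p (\<kappa> * (t - s))"
proof -
  have *: "kern p (\<kappa> * y) \<le> (1 + \<kappa> * R) powr p * kern p (\<kappa> * x)" if xy: "\<bar>x\<bar> \<le> \<bar>y\<bar> + R" for x y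
  proof -
    have R: "0 \<le> R" using sR by linarith
    have "1 + \<bar>\<kappa> * x\<bar> \<le> (1 + \<kappa> * R) * (1 + \<bar>\<kappa> * y\<bar>)"
    proof -
      have "\<bar>\<kappa> * x\<bar> \<le> \<kappa> * (\<bar>y\<bar> + R)" using k mult_left_mono[OF xy, of \<kappa>] by (simp add: abs_mult)
      moreover have "0 \<le> \<kappa> * R * (\<kappa> * \<bar>y\<bar>)" using k R by simp
      ultimately show ?thesis using k by (simp add: abs_mult algebra_simps)
    qed
    then have "(1 + \<bar>\<kappa> * x\<bar>) / (1 + \<kappa> * R) \<le> 1 + \<bar>\<kappa> * y\<bar>"
      using k R by (simp add: divide_le_eq add_pos_nonneg mult.commute)
    then have "kern p (\<kappa> * y) \<le> ((1 + \<bar>\<kappa> * x\<bar>) / (1 + \<kappa> * R)) powr (- p)"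
      unfolding kern_def using p k R by (intro powr_mono2') (auto simp: add_pos_nonneg)
    also have "\<dots> = (1 + \<kappa> * R) powr p * kern p (\<kappa> * x)"
      unfolding kern_def using k R by (subst powr_divide) (auto simp: powr_minus_divide)
    finally show ?thesis .
  qed
  show "kern p (\<kappa> * (t - s)) \<le> (1 + \<kappa> * R) powr p * kern p (\<kappa> * t)" by (rule *) (use sR in linarith)
  show "kern p (\<kappa> * t) \<le> (1 + \<kappa> * R) powr p * kern p (\<kappa> * (t - s))" by (rule *) (use sR in linarith)
qed

lemma powr_add_le:
  fixes x y :: real
  assumes "0 \<le> p" "0 \<le> x" "0 \<le> y"
  shows "(x + y) powr p \<le> 2 powr p * (x powr p + y powr p)"
proof -
  have "(x + y) powr p \<le> (2 * max x y) powr p" using assms by (intro powr_mono2) auto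
  also have "\<dots> = 2 powr p * max x y powr p" using assms by (simp add: powr_mult)
  also have "\<dots> \<le> 2 powr p * (x powr p + y powr p)" by (intro mult_left_mono) (auto simp: max_def)
  finally show ?thesis .
qed

text \<open>Rests on \<open>(1 + \<kappa> * \<bar>s\<bar>) / (1 + \<bar>s\<bar>) \<le> \<kappa> + 1
  / (1 + \<bar>s\<bar>)\<close>. The quotient of the two kernels thus splits into a small constant
  and an integrable function of \<open>s\<close>.\<close>

lemma kern_quotient_le:
  assumes p: "0 \<le> p" and k: "0 < \<kappa>"
  shows "kern p s \<le> 2 powr p * (\<kappa> powr p + kern p s) * kern p (\<kappa> * s)"
proof -
  have d: "0 < 1 + \<bar>s\<bar>" "0 < 1 + \<bar>\<kappa> * s\<bar>" by auto
  have "((1 + \<bar>\<kappa> * s\<bar>) / (1 + \<bar>s\<bar>)) powr p \<le> (\<kappa> + 1 / (1 + \<bar>s\<bar>)) powr p"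
    using k p by (intro powr_mono2) (auto simp: field_simps abs_mult)
  also have "\<dots> \<le> 2 powr p * (\<kappa> powr p + (1 / (1 + \<bar>s\<bar>)) powr p)" using k p by (intro powr_add_le) auto
  finally have "(1 + \<bar>\<kappa> * s\<bar>) powr p * kern p s \<le> 2 powr p * (\<kappa> powr p + kern p s)"
    by (simp add: kern_def powr_divide powr_minus_divide)
  from mult_right_mono[OF this kern_nonneg[of p "\<kappa> * s"]]
  have "((1 + \<bar>\<kappa> * s\<bar>) powr p * kern p (\<kappa> * s)) * kern p s \<le> 2 powr p * (\<kappa> powr p + kern p s) * kern p (\<kappa> * s)"
    by (simp only: mult_ac)
  moreover have "(1 + \<bar>\<kappa> * s\<bar>) powr p * kern p (\<kappa> * s) = 1" using d(2) by (simp add: kern_def powr_minus)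
  ultimately show ?thesis by simp
qed

context
  fixes p :: real
  assumes p: "1 < p"
begin

text \<open>Near \<open>s = 0\<close> the ratio of weights is close to 1, and far out the mass of
  \<open>kern p\<close> is small. The last term pays for \<open>t\<close> far away at scale
  \<kappa>: its integral in \<open>s\<close> is of order \<open>\<kappa> powr (p - 1)\<close>, small
  because \<open>p > 1\<close>.\<close>

lemma weight_pointwise:
  assumes k: "0 < \<kappa>" and R: "0 < R"
  shows "kern p s * \<bar>kern p (\<kappa> * (t - s)) / kern p (\<kappa> * t) - 1\<bar> \<le>
    ((1 + \<kappa> * R) powr p - 1) * kern p s
    + (1 + 2 powr p + 4 powr p) * (indicator {s. R \<le> \<bar>s\<bar>} s *\<^sub>R kern p s)
    + 4 powr p * \<kappa> powr p * kern p (\<kappa> * (t - s))"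
proof -
  define \<rho> where "\<rho> = kern p (\<kappa> * (t - s)) / kern p (\<kappa> * t)"
  define \<Omega> where "\<Omega> = (1 + \<kappa> * R) powr p"
  have p0: "0 \<le> p" using p by simp
  have \<Omega>: "1 \<le> \<Omega>" unfolding \<Omega>_def using k R p by (intro ge_one_powr_ge_zero) auto
  have \<rho>0: "0 < \<rho>" by (simp add: \<rho>_def kern_pos)
  have last0: "0 \<le> 4 powr p * \<kappa> powr p * kern p (\<kappa> * (t - s))" by (simp add: kern_nonneg)
  show ?thesis unfolding \<rho>_def[symmetric] \<Omega>_def[symmetric]
  proof (cases "R \<le> \<bar>s\<bar>")
    case False
    have 1: "\<rho> \<le> \<Omega>" unfolding \<rho>_def \<Omega>_def using kern_ratio_le(1)[OF p0 k, of s R t] False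
      by (simp add: divide_le_eq kern_pos)
    have 2: "1 \<le> \<Omega> * \<rho>" unfolding \<rho>_def \<Omega>_def using kern_ratio_le(2)[OF p0 k, of s R t] False
      by (simp add: le_divide_eq kern_pos)
    \<comment> \<open>From \<open>\<rho> \<ge> 1 / \<Omega>\<close> and
      \<open>1 / \<Omega> \<ge> 2 - \<Omega>\<close>, the latter being a square in disguise.\<close>
    have "1 - \<rho> \<le> \<Omega> - 1"
    proof (rule ccontr)
      assume "\<not> 1 - \<rho> \<le> \<Omega> - 1"
      then have "\<rho> < 2 - \<Omega>" by simp
      then have "\<Omega> * \<rho> < \<Omega> * (2 - \<Omega>)" using \<Omega> by (intro mult_strict_left_mono) auto
      then have "1 < \<Omega> * (2 - \<Omega>)" using 2 by linarith
      moreover have "\<Omega> * (2 - \<Omega>) = 1 - (\<Omega> - 1)\<^sup>2" by (simp add: power2_eq_square algebra_simps)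
      ultimately show False using zero_le_power2[of "\<Omega> - 1"] by linarith
    qed
    then have "\<bar>\<rho> - 1\<bar> \<le> \<Omega> - 1" using 1 by linarith
    then have "kern p s * \<bar>\<rho> - 1\<bar> \<le> (\<Omega> - 1) * kern p s"
      using mult_right_mono[OF _ kern_nonneg[of p s], of "\<bar>\<rho> - 1\<bar>" "\<Omega> - 1"] by (simp add: mult.commute)
    then show "kern p s * \<bar>\<rho> - 1\<bar> \<le> (\<Omega> - 1) * kern p s + (1 + 2 powr p + 4 powr p) * (indicator {s. R \<le> \<bar>s\<bar>} s *\<^sub>R kern p s)
      + 4 powr p * \<kappa> powr p * kern p (\<kappa> * (t - s))"
      using False last0 by simp
  next
    case True
    have "\<bar>t\<bar> \<le> \<bar>s\<bar> + \<bar>t - s\<bar>" by linarith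
    then have kt: "\<kappa> * \<bar>t\<bar> \<le> \<kappa> * \<bar>s\<bar> + \<kappa> * \<bar>t - s\<bar>"
      using mult_left_mono[of "\<bar>t\<bar>" "\<bar>s\<bar> + \<bar>t - s\<bar>" \<kappa>] k by (simp add: distrib_left)
    \<comment> \<open>The alternative of \<open>kern_mult_le\<close> at scale \<kappa>. If
      \<open>t - s\<close> is the large part, the ratio is bounded; if \<open>s\<close> is, the
      decay of \<open>kern p s\<close> itself must compensate through
      \<open>kern_quotient_le\<close>.\<close>
    have "1 + \<bar>\<kappa> * t\<bar> \<le> 2 * (1 + \<bar>\<kappa> * s\<bar>) \<or> 1 + \<bar>\<kappa> * t\<bar> \<le> 2 * (1 + \<bar>\<kappa> * (t - s)\<bar>)"
      using kt k by (simp add: abs_mult) linarith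
    then have "kern p s * \<rho> \<le> 2 powr p * kern p s + 4 powr p * (\<kappa> powr p + kern p s) * kern p (\<kappa> * (t - s))"
    proof
      assume "1 + \<bar>\<kappa> * t\<bar> \<le> 2 * (1 + \<bar>\<kappa> * s\<bar>)"
      from kern_half[OF p0 this] have "kern p (\<kappa> * s) / kern p (\<kappa> * t) \<le> 2 powr p" by (simp add: divide_le_eq kern_pos)
      then have "2 powr p * (\<kappa> powr p + kern p s) * kern p (\<kappa> * (t - s)) * (kern p (\<kappa> * s) / kern p (\<kappa> * t))
        \<le> 2 powr p * (\<kappa> powr p + kern p s) * kern p (\<kappa> * (t - s)) * 2 powr p"
        by (intro mult_left_mono) (auto simp: kern_nonneg)
      moreover have "kern p s * \<rho> \<le> (2 powr p * (\<kappa> powr p + kern p s) * kern p (\<kappa> * s)) * \<rho>"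
        using \<rho>0 by (intro mult_right_mono kern_quotient_le p0 k) auto
      moreover have "(2 powr p * (\<kappa> powr p + kern p s) * kern p (\<kappa> * s)) * \<rho> =
        2 powr p * (\<kappa> powr p + kern p s) * kern p (\<kappa> * (t - s)) * (kern p (\<kappa> * s) / kern p (\<kappa> * t))"
        by (simp add: \<rho>_def)
      moreover have "2 powr p * (\<kappa> powr p + kern p s) * kern p (\<kappa> * (t - s)) * 2 powr p
        = 4 powr p * (\<kappa> powr p + kern p s) * kern p (\<kappa> * (t - s))"
        using powr_mult[of 2 2 p] by simp
      ultimately show ?thesis using kern_nonneg[of p s] by (simp add: add_increasing)
    next
      assume "1 + \<bar>\<kappa> * t\<bar> \<le> 2 * (1 + \<bar>\<kappa> * (t - s)\<bar>)"
      from kern_half[OF p0 this] have "\<rho> \<le> 2 powr p" by (simp add: \<rho>_def divide_le_eq kern_pos)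
      then have "kern p s * \<rho> \<le> kern p s * 2 powr p" by (intro mult_left_mono) (auto simp: kern_nonneg)
      moreover have "0 \<le> 4 powr p * (\<kappa> powr p + kern p s) * kern p (\<kappa> * (t - s))" by (simp add: kern_nonneg)
      ultimately show ?thesis by (simp add: mult.commute)
    qed
    moreover have "4 powr p * (\<kappa> powr p + kern p s) * kern p (\<kappa> * (t - s)) \<le>
      4 powr p * \<kappa> powr p * kern p (\<kappa> * (t - s)) + 4 powr p * kern p s"
      using kern_le_1[OF p0, of "\<kappa> * (t - s)"] kern_nonneg[of p s]
      by (simp add: distrib_left distrib_right mult_left_le)
    ultimately have "kern p s * \<rho> \<le> (2 powr p + 4 powr p) * kern p s + 4 powr p * \<kappa> powr p * kern p (\<kappa> * (t - s))"
      by (simp add: distrib_right)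
    moreover have "kern p s * \<bar>\<rho> - 1\<bar> \<le> kern p s * (\<rho> + 1)"
      using \<rho>0 by (intro mult_left_mono kern_nonneg) auto
    moreover have "0 \<le> (\<Omega> - 1) * kern p s" using \<Omega> kern_nonneg by simp
    ultimately show "kern p s * \<bar>\<rho> - 1\<bar> \<le> (\<Omega> - 1) * kern p s + (1 + 2 powr p + 4 powr p) * (indicator {s. R \<le> \<bar>s\<bar>} s *\<^sub>R kern p s)
      + 4 powr p * \<kappa> powr p * kern p (\<kappa> * (t - s))"
      using True by (simp add: algebra_simps)
  qed
qed

text \<open>Conjugation by the slowly varying weight \<open>(1 + \<kappa>\<bar>t\<bar>) powr p\<close> moves the convolution operator by an
  arbitrarily small amount in operator norm.\<close>

lemma weight_conjugation:
  fixes T :: "real \<Rightarrow> 'a::complex_banach \<Rightarrow> 'a"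
  assumes T: "opfam T (\<lambda>s. C * kern p s)" and C: "0 \<le> C" and \<epsilon>: "0 < \<epsilon>"
  shows "\<exists>\<kappa>. 0 < \<kappa> \<and> \<kappa> \<le> 1 \<and> (\<forall>(f :: real \<Rightarrow>\<^sub>C 'a) t.
    norm ((1 / kern p (\<kappa> * t)) *\<^sub>R integral UNIV (\<lambda>s. T s (kern p (\<kappa> * (t - s)) *\<^sub>R apply_bcontfun f (t - s)))
      - integral UNIV (\<lambda>s. T s (apply_bcontfun f (t - s)))) \<le> \<epsilon> * norm f)"
proof -
  define c where "c = 1 + 2 powr p + 4 powr p"
  have c: "0 < c" by (simp add: c_def add_pos_nonneg)
  obtain R where R: "0 < R" "tail p R < \<epsilon> / (2 * c * C + 1)"
    using tail_small[OF p, of "\<epsilon> / (2 * c * C + 1)"] \<epsilon> c C by (auto simp: add_nonneg_pos)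
  have R2: "C * (c * tail p R) \<le> \<epsilon> / 2"
  proof -
    have "0 < 2 * c * C + 1" using c C by (simp add: add_nonneg_pos)
    then have "tail p R * (2 * c * C + 1) < \<epsilon>" using R(2) by (simp add: pos_less_divide_eq)
    then show ?thesis using tail_nonneg[OF p, of R] by (simp add: algebra_simps)
  qed
  \<comment> \<open>The part of the error that vanishes as \<kappa> tends to 0. The tail beyond
    \<open>R\<close> does not depend on \<kappa> and has been made small first.\<close>
  define E where "E \<kappa> = C * (((1 + \<kappa> * R) powr p - 1) * kint p + 4 powr p * \<kappa> powr (p - 1) * kint p)" for \<kappa>
  have t1: "((\<lambda>\<kappa>. \<kappa> powr (p - 1)) \<longlongrightarrow> 0) (at_right (0::real))"
  proof (rule tendsto_zero_powrI[OF tendsto_ident_at tendsto_const])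
    show "\<forall>\<^sub>F x in at_right 0. (0::real) \<le> x" by (auto simp: eventually_at_right_field intro: exI[of _ 1])
  qed (use p in simp)
  have t2: "((\<lambda>\<kappa>. (1 + \<kappa> * R) powr p) \<longlongrightarrow> (1 + 0 * R) powr p) (at_right (0::real))"
    by (intro tendsto_intros) simp
  have "(E \<longlongrightarrow> C * (((1 + 0 * R) powr p - 1) * kint p + 4 powr p * 0 * kint p)) (at_right 0)"
    unfolding E_def by (intro tendsto_mult tendsto_add tendsto_diff tendsto_const t1 t2)
  then have "(E \<longlongrightarrow> 0) (at_right 0)" by simp
  then have "\<forall>\<^sub>F \<kappa> in at_right 0. E \<kappa> < \<epsilon> / 2" by (rule order_tendstoD(2)) (use \<epsilon> in simp)
  then obtain b where b: "0 < b" "\<And>\<kappa>. 0 < \<kappa> \<Longrightarrow> \<kappa> < b \<Longrightarrow> E \<kappa> < \<epsilon> / 2"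
    unfolding eventually_at_right_field by auto
  define \<kappa> where "\<kappa> = min 1 (b / 2)"
  have k: "0 < \<kappa>" "\<kappa> \<le> 1" "E \<kappa> < \<epsilon> / 2" using b by (auto simp: \<kappa>_def)
  have "norm ((1 / kern p (\<kappa> * t)) *\<^sub>R integral UNIV (\<lambda>s. T s (kern p (\<kappa> * (t - s)) *\<^sub>R apply_bcontfun f (t - s)))
      - integral UNIV (\<lambda>s. T s (apply_bcontfun f (t - s)))) \<le> \<epsilon> * norm f" for f :: "real \<Rightarrow>\<^sub>C 'a" and t
  proof -
    define \<rho> where "\<rho> s = kern p (\<kappa> * (t - s)) / kern p (\<kappa> * t)" for s
    define bd where "bd s = ((1 + \<kappa> * R) powr p - 1) * kern p s + c * (indicator {s. R \<le> \<bar>s\<bar>} s *\<^sub>R kern p s)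
      + 4 powr p * \<kappa> powr p * kern p (\<kappa> * (t - s))" for s
    have kc: "continuous_on UNIV (\<lambda>x. kern p (\<kappa> * x) *\<^sub>R apply_bcontfun f x)"
      by (intro continuous_intros continuous_on_compose2[OF kern_continuous]) auto
    have kb: "norm (kern p (\<kappa> * x) *\<^sub>R apply_bcontfun f x) \<le> norm f" for x
      using mult_mono[OF kern_le_1[of p "\<kappa> * x"] bcontfun_le[of f x]] p kern_nonneg[of p "\<kappa> * x"] by simp
    have i1: "(\<lambda>s. T s (kern p (\<kappa> * (t - s)) *\<^sub>R apply_bcontfun f (t - s))) integrable_on UNIV"
      by (rule kern_dom_integrable(1)[OF p _ scaled_kern[OF p T C kb]])
        (rule smeas_family[OF opfam_smeas[OF T] opfam_linear[OF T] smeas_reflect[OF smeas_continuous[OF kc]]])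
    have i1': "(\<lambda>s. (1 / kern p (\<kappa> * t)) *\<^sub>R T s (kern p (\<kappa> * (t - s)) *\<^sub>R apply_bcontfun f (t - s))) integrable_on UNIV"
      by (rule integrable_cmul[OF i1])
    have i2: "(\<lambda>s. T s (apply_bcontfun f (t - s))) integrable_on UNIV" by (rule conv_fun(3)[OF p T C])
    \<comment> \<open>Scaling by \<kappa> multiplies the mass of the kernel by
      \<open>1 / \<kappa>\<close>, which lowers the exponent of \<kappa> from \<open>p\<close> to
      \<open>p - 1\<close>.\<close>
    have sc: "((\<lambda>s. kern p (\<kappa> * (t - s))) has_integral (1 / \<kappa>) * kint p) UNIV"
      using has_integral_UNIV_affine[OF integrable_integral[OF kern_integrable[OF p]], of "- \<kappa>" "\<kappa> * t"] k
      by (simp add: kint_def[OF p] algebra_simps)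
    have bi: "bd integrable_on UNIV" unfolding bd_def
      using sc by (intro integrable_add integrable_on_mult_right kern_integrable p tail_integrable) auto
    have "integral UNIV bd = ((1 + \<kappa> * R) powr p - 1) * kint p + c * tail p R + 4 powr p * \<kappa> powr p * ((1 / \<kappa>) * kint p)"
      unfolding bd_def kint_def[OF p] tail_def[OF p]
      using sc[unfolded kint_def[OF p]]
      by (intro integral_unique has_integral_add has_integral_mult_right integrable_integral kern_integrable p tail_integrable)
    also have "4 powr p * \<kappa> powr p * ((1 / \<kappa>) * kint p) = 4 powr p * \<kappa> powr (p - 1) * kint p"
      using k by (simp add: powr_diff)
    finally have ib: "integral UNIV bd = ((1 + \<kappa> * R) powr p - 1) * kint p + c * tail p R + 4 powr p * \<kappa> powr (p - 1) * kint p" .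
    have "C * integral UNIV bd = E \<kappa> + C * (c * tail p R)" unfolding ib E_def by (simp add: distrib_left)
    then have Cb: "C * integral UNIV bd \<le> \<epsilon>" using k(3) R2 by linarith
    have "(1 / kern p (\<kappa> * t)) *\<^sub>R integral UNIV (\<lambda>s. T s (kern p (\<kappa> * (t - s)) *\<^sub>R apply_bcontfun f (t - s)))
      - integral UNIV (\<lambda>s. T s (apply_bcontfun f (t - s))) =
      integral UNIV (\<lambda>s. (1 / kern p (\<kappa> * t)) *\<^sub>R T s (kern p (\<kappa> * (t - s)) *\<^sub>R apply_bcontfun f (t - s)) - T s (apply_bcontfun f (t - s)))"
      by (subst integral_diff[OF i1' i2]) (simp only: integral_cmul)
    moreover have "norm (integral UNIV (\<lambda>s. (1 / kern p (\<kappa> * t)) *\<^sub>R T s (kern p (\<kappa> * (t - s)) *\<^sub>R apply_bcontfun f (t - s)) - T s (apply_bcontfun f (t - s))))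
      \<le> integral UNIV (\<lambda>s. (C * norm f) * bd s)"
    proof (rule integral_norm_bound_integral[OF integrable_diff[OF i1' i2] integrable_on_mult_right[OF bi]])
      fix s
      have "(1 / kern p (\<kappa> * t)) *\<^sub>R T s (kern p (\<kappa> * (t - s)) *\<^sub>R apply_bcontfun f (t - s)) - T s (apply_bcontfun f (t - s))
        = T s ((\<rho> s - 1) *\<^sub>R apply_bcontfun f (t - s))"
        unfolding opfam_scale[OF T] \<rho>_def by (simp add: scaleR_left_diff_distrib)
      also have "norm \<dots> \<le> C * kern p s * (\<bar>\<rho> s - 1\<bar> * norm f)"
        using order_trans[OF opfam_le[OF T] mult_left_mono[of "norm ((\<rho> s - 1) *\<^sub>R apply_bcontfun f (t - s))" "\<bar>\<rho> s - 1\<bar> * norm f" "C * kern p s"]]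
          C kern_nonneg[of p s] by (simp add: mult_left_mono bcontfun_le)
      also have "\<dots> = (C * norm f) * (kern p s * \<bar>\<rho> s - 1\<bar>)" by simp
      also have "\<dots> \<le> (C * norm f) * bd s"
        unfolding bd_def \<rho>_def c_def using C by (intro mult_left_mono weight_pointwise k R) auto
      finally show "norm ((1 / kern p (\<kappa> * t)) *\<^sub>R T s (kern p (\<kappa> * (t - s)) *\<^sub>R apply_bcontfun f (t - s)) - T s (apply_bcontfun f (t - s)))
        \<le> (C * norm f) * bd s" .
    qed
    moreover have "integral UNIV (\<lambda>s. (C * norm f) * bd s) \<le> \<epsilon> * norm f"
      using mult_right_mono[OF Cb, of "norm f"] by (simp add: mult_ac)
    ultimately show ?thesis by simp
  qed
  then show ?thesis using k by blast
qed

text \<open>The conjugated operator is \<open>1 + cop T + V\<close> with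
  \<open>norm (J * V) < 1\<close>, so it factors as \<open>(1 + cop T) * (1 + J * V)\<close> and has
  a right inverse \<open>W\<close>. Dividing \<open>g\<close> by the weight, applying
  \<open>W\<close> and multiplying back gives a decaying solution of the original equation.\<close>

lemma cop_inverse_decay:
  fixes T :: "real \<Rightarrow> 'a::complex_banach \<Rightarrow> 'a"
  assumes nT: "nice p T" and J: "J * (1 + cop T) = 1" "(1 + cop T) * J = 1"
  shows "\<exists>K\<ge>0. \<forall>g M. (\<forall>t. norm (apply_bcontfun g t) \<le> M * kern p t) \<longrightarrow> (\<forall>t. norm (ev J g t) \<le> K * M * kern p t)"
proof -
  obtain C where C: "0 \<le> C" and T: "opfam T (\<lambda>s. C * kern p s)" using nice_opfam[OF p nT] .
  define \<epsilon> where "\<epsilon> = 1 / (norm J + 1)"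
  have nJ: "0 < norm J + 1" by (simp add: add_nonneg_pos)
  then have \<epsilon>: "0 < \<epsilon>" by (simp add: \<epsilon>_def)
  obtain \<kappa> where k: "0 < \<kappa>" "\<kappa> \<le> 1" and kb: "\<And>(f :: real \<Rightarrow>\<^sub>C 'a) t.
    norm ((1 / kern p (\<kappa> * t)) *\<^sub>R integral UNIV (\<lambda>s. T s (kern p (\<kappa> * (t - s)) *\<^sub>R apply_bcontfun f (t - s)))
      - integral UNIV (\<lambda>s. T s (apply_bcontfun f (t - s)))) \<le> \<epsilon> * norm f"
    using weight_conjugation[OF T C \<epsilon>] by blast
  define \<Phi> where "\<Phi> f t = (1 / kern p (\<kappa> * t)) *\<^sub>R integral UNIV (\<lambda>s. T s (kern p (\<kappa> * (t - s)) *\<^sub>R f (t - s)))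
      - integral UNIV (\<lambda>s. T s (f (t - s)))" for f :: "real \<Rightarrow> 'a" and t
  have kcont: "continuous_on UNIV (\<lambda>x. kern p (\<kappa> * x))"
    by (intro continuous_on_compose2[OF kern_continuous] continuous_intros) auto
  have kn: "kern p x \<noteq> 0" for x using kern_pos[of p x] by simp
  have wc: "continuous_on UNIV (\<lambda>x. kern p (\<kappa> * x) *\<^sub>R apply_bcontfun f x)" for f :: "real \<Rightarrow>\<^sub>C 'a"
    by (intro continuous_intros kcont) auto
  have wb: "norm (kern p (\<kappa> * x) *\<^sub>R apply_bcontfun f x) \<le> norm f" for x and f :: "real \<Rightarrow>\<^sub>C 'a"
    using mult_mono[OF kern_le_1[of p "\<kappa> * x"] bcontfun_le[of f x]] p kern_nonneg[of p "\<kappa> * x"] by simp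
  have i1: "(\<lambda>s. T s (kern p (\<kappa> * (t - s)) *\<^sub>R apply_bcontfun f (t - s))) integrable_on UNIV" for f :: "real \<Rightarrow>\<^sub>C 'a" and t
    by (rule kern_dom_integrable(1)[OF p _ scaled_kern[OF p T C wb]])
      (rule smeas_family[OF opfam_smeas[OF T] opfam_linear[OF T] smeas_reflect[OF smeas_continuous[OF wc]]])
  define V where "V = mkop \<Phi>"
  have \<Phi>_cont: "continuous_on UNIV (\<Phi> (apply_bcontfun f))" for f unfolding \<Phi>_def
    by (intro continuous_intros kcont conv_bounded_continuous[OF p T C wc wb]
        conv_bounded_continuous[OF p T C _ bcontfun_le]) (auto simp: kn)
  have \<Phi>_add: "\<Phi> (apply_bcontfun (f + g)) t = \<Phi> (apply_bcontfun f) t + \<Phi> (apply_bcontfun g) t" for f g t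
    unfolding \<Phi>_def using integral_add[OF i1[where f=f and t=t] i1[where f=g and t=t]]
      integral_add[OF conv_fun(3)[OF p T C, where f=f and t=t] conv_fun(3)[OF p T C, where f=g and t=t]]
    by (simp add: scaleR_add_right opfam_add[OF T])
  have \<Phi>_scale: "\<Phi> (apply_bcontfun (r *\<^sub>R f)) t = r *\<^sub>R \<Phi> (apply_bcontfun f) t" for f r t
  proof -
    have "T s (kern p (\<kappa> * (t - s)) *\<^sub>R apply_bcontfun (r *\<^sub>R f) (t - s)) = r *\<^sub>R T s (kern p (\<kappa> * (t - s)) *\<^sub>R apply_bcontfun f (t - s))"
      "T s (apply_bcontfun (r *\<^sub>R f) (t - s)) = r *\<^sub>R T s (apply_bcontfun f (t - s))" for s
      by (simp_all add: opfam_scale[OF T] mult.commute)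
    then show ?thesis unfolding \<Phi>_def by (simp only: integral_cmul scaleR_diff_right scaleR_left_commute[of r])
  qed
  note V = mkop[of \<Phi> \<epsilon>, OF \<Phi>_cont kb[folded \<Phi>_def] \<Phi>_add \<Phi>_scale less_imp_le[OF \<epsilon>], folded V_def]
  have "norm (- (J * V)) < 1"
  proof -
    have "norm (J * V) \<le> norm J * \<epsilon>"
      by (rule order_trans[OF norm_mult_ineq]) (intro mult_left_mono V, auto)
    also have "\<dots> < 1" using nJ by (simp add: \<epsilon>_def)
    finally show ?thesis by simp
  qed
  from neumann_inverse[OF this] obtain y where y: "(1 + J * V) * y = 1" by auto
  define W where "W = y * J"
  have W: "(1 + cop T + V) * W = 1"
  proof -
    have "1 + cop T + V = (1 + cop T) * (1 + J * V)"
      unfolding distrib_left[of "1 + cop T" 1] mult.assoc[symmetric] J(2) by simp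
    then have "(1 + cop T + V) * W = (1 + cop T) * ((1 + J * V) * y) * J" by (simp only: W_def mult.assoc)
    then show ?thesis by (simp add: y J)
  qed
  define K where "K = (1 / \<kappa>) powr p * norm W"
  have "norm (ev J g t) \<le> K * M * kern p t" if g: "\<And>t. norm (apply_bcontfun g t) \<le> M * kern p t" for g M t
  proof -
    have M: "0 \<le> M" using g[of 0] kern_pos[of p 0] by (metis norm_ge_zero order_trans zero_le_mult_iff not_less)
    define gw where "gw = Bcontfun (\<lambda>t. (1 / kern p (\<kappa> * t)) *\<^sub>R apply_bcontfun g t)"
    have gle: "norm ((1 / kern p (\<kappa> * t)) *\<^sub>R apply_bcontfun g t) \<le> M" for t
    proof -
      \<comment> \<open>Here \<open>\<kappa> \<le> 1\<close> matters: the slow weight is weaker than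
        the given decay, so the quotient remains bounded.\<close>
      have "kern p t \<le> kern p (\<kappa> * t)" using p k by (intro kern_antimono) (auto simp: abs_mult mult_left_le_one_le)
      then have "norm (apply_bcontfun g t) \<le> M * kern p (\<kappa> * t)" using g[of t] mult_left_mono[OF _ M] order_trans by blast
      then show ?thesis using kern_pos[of p "\<kappa> * t"] by (simp add: divide_le_eq)
    qed
    have gw: "apply_bcontfun gw = (\<lambda>t. (1 / kern p (\<kappa> * t)) *\<^sub>R apply_bcontfun g t)" unfolding gw_def
      by (rule Bcontfun_inverse, rule bcontfun_normI[OF _ gle]) (intro continuous_intros kcont, auto simp: kn)
    define F where "F = eapp W gw"
    have nF: "norm F \<le> norm W * M" unfolding F_def
      by (rule order_trans[OF norm_eapp]) (intro mult_left_mono Bounded_Continuous_Function.norm_bound, auto simp: gw gle[simplified])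
    define f where "f = Bcontfun (\<lambda>t. kern p (\<kappa> * t) *\<^sub>R apply_bcontfun F t)"
    have f: "apply_bcontfun f = (\<lambda>t. kern p (\<kappa> * t) *\<^sub>R apply_bcontfun F t)" unfolding f_def
      by (rule Bcontfun_inverse, rule bcontfun_normI[OF wc wb])
    have "eapp (1 + cop T) f = g"
    proof (rule bcontfun_eqI)
      fix t
      have "ev ((1 + cop T + V) * W) gw t = (1 / kern p (\<kappa> * t)) *\<^sub>R apply_bcontfun g t" by (simp add: W gw)
      then have "apply_bcontfun F t + (1 / kern p (\<kappa> * t)) *\<^sub>R integral UNIV (\<lambda>s. T s (apply_bcontfun f (t - s)))
        = (1 / kern p (\<kappa> * t)) *\<^sub>R apply_bcontfun g t"
        by (simp add: F_def[symmetric] V(1) \<Phi>_def cop[OF p nT] f)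
      from arg_cong[OF this, of "scaleR (kern p (\<kappa> * t))"]
      show "ev (1 + cop T) f t = apply_bcontfun g t" by (simp add: scaleR_add_right kn cop[OF p nT] f)
    qed
    \<comment> \<open>\<open>J\<close> is a left inverse, so the weighted solution is the same
      function as the one delivered by \<open>J\<close>.\<close>
    then have "eapp J g = eapp (J * (1 + cop T)) f" by simp
    then have Jf: "eapp J g = f" by (simp only: J(1) eapp_simps)
    have "norm (ev J g t) = kern p (\<kappa> * t) * norm (apply_bcontfun F t)" by (simp add: Jf f kern_nonneg)
    also have "\<dots> \<le> ((1 / \<kappa>) powr p * kern p t) * (norm W * M)"
    proof (intro mult_mono order_trans[OF bcontfun_le nF])
      have "kern p (\<kappa> * t) \<le> (\<kappa> * (1 + \<bar>t\<bar>)) powr (- p)" unfolding kern_def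
        using k p by (intro powr_mono2') (auto simp: abs_mult distrib_left add_pos_nonneg)
      also have "\<dots> = (1 / \<kappa>) powr p * kern p t" unfolding kern_def
        using k by (simp add: powr_mult powr_divide powr_minus_divide)
      finally show "kern p (\<kappa> * t) \<le> (1 / \<kappa>) powr p * kern p t" .
    qed (auto simp: kern_nonneg)
    finally show ?thesis by (simp add: K_def mult_ac)
  qed
  moreover have "0 \<le> K" by (simp add: K_def)
  ultimately show ?thesis by blast
qed

end

section \<open>Construction of the inverse in the weighted algebra\<close>

context
  fixes p :: real
  assumes p: "1 < p"
begin

lemma opfam_diff:
  assumes "opfam T (\<lambda>s. C * kern p s)" "opfam U (\<lambda>s. D * kern p s)"
  shows "opfam (\<lambda>t x. T t x - U t x) (\<lambda>s. (C + D) * kern p s)"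
  unfolding opfam_def
proof (intro conjI allI)
  show "smeas (\<lambda>s. T s y - U s y)" for y by (intro smeas_diff opfam_smeas[OF assms(1)] opfam_smeas[OF assms(2)])
  show "bounded_linear (\<lambda>x. T s x - U s x)" for s
    by (intro bounded_linear_sub opfam_linear[OF assms(1)] opfam_linear[OF assms(2)])
  show "norm (T s y - U s y) \<le> (C + D) * kern p s * norm y" for s y
    using norm_triangle_ineq4[of "T s y" "U s y"] opfam_le[OF assms(1), of s y] opfam_le[OF assms(2), of s y]
    by (simp add: algebra_simps)
qed

lemma nice_diff:
  assumes T: "nice p T" and U: "nice p U" shows "nice p (\<lambda>t x. T t x - U t x)"
  unfolding nice_def[OF p]
proof (intro conjI allI)
  obtain C where C: "0 \<le> C" "opfam T (\<lambda>s. C * kern p s)" using nice_opfam[OF p T] .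
  obtain D where D: "0 \<le> D" "opfam U (\<lambda>s. D * kern p s)" using nice_opfam[OF p U] .
  show "\<exists>E\<ge>0. opfam (\<lambda>t x. T t x - U t x) (\<lambda>s. E * kern p s)"
    using opfam_diff[OF C(2) D(2)] C(1) D(1) by (intro exI[of _ "C + D"]) auto
  show "bop (\<lambda>x. T t x - U t x)" for t
  proof -
    have "cscale c (T t x) - cscale c (U t x) = cscale c (T t x - U t x)" for c x
      by (rule linear_diff[OF bounded_linear.linear[OF bounded_linear_cscale], symmetric])
    then show ?thesis unfolding bop_def
      using nice_bop[OF p T, of t] nice_bop[OF p U, of t] by (auto simp: bop_def intro: bounded_linear_sub)
  qed
qed

lemma nice_bounded:
  assumes T: "nice p T" shows "\<exists>D\<ge>0. \<forall>t x. norm (T t x) \<le> D * norm x * kern p t"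
proof -
  obtain C where C: "0 \<le> C" "opfam T (\<lambda>s. C * kern p s)" using nice_opfam[OF p T] .
  then show ?thesis using scaled_kern[OF p C(2,1) order_refl] by blast
qed

lemma nice_conv_integrable:
  assumes T: "nice p T" and U: "nice p U"
  shows "(\<lambda>s. T s (U (t - s) x)) integrable_on UNIV" "continuous_on UNIV (\<lambda>t. conv T U t x)"
proof -
  obtain C where C: "0 \<le> C" "opfam T (\<lambda>s. C * kern p s)" using nice_opfam[OF p T] .
  obtain D where D: "0 \<le> D" "opfam U (\<lambda>s. D * kern p s)" using nice_opfam[OF p U] .
  have le: "norm (U r x) \<le> D * norm x" for r
    using scaled_kern[OF p D(2,1) order_refl, of r x] kern_le_1[of p r] D(1) p
      mult_left_mono[of "kern p r" 1 "D * norm x"] by simp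
  show "(\<lambda>s. T s (U (t - s) x)) integrable_on UNIV"
    by (rule kern_dom_integrable(1)[OF p smeas_family[OF opfam_smeas[OF C(2)] opfam_linear[OF C(2)] smeas_reflect[OF opfam_smeas[OF D(2)]]]
          scaled_kern[OF p C(2,1) le]])
  show "continuous_on UNIV (\<lambda>t. conv T U t x)" unfolding conv_def
    by (rule conv_continuous[OF p C(2,1) opfam_smeas[OF D(2)] scaled_kern[OF p D(2,1) order_refl]])
qed

lemma conv_diff:
  assumes T: "nice p T" and U: "nice p U" and V: "nice p V"
  shows "conv T (\<lambda>t x. U t x - V t x) t x = conv T U t x - conv T V t x"
    "conv (\<lambda>t x. U t x - V t x) T t x = conv U T t x - conv V T t x"
  unfolding conv_def
  using integral_diff[OF nice_conv_integrable(1)[OF T U] nice_conv_integrable(1)[OF T V], of t x t x]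
    integral_diff[OF nice_conv_integrable(1)[OF U T] nice_conv_integrable(1)[OF V T], of t x t x]
  by (simp_all add: linear_diff[OF bounded_linear.linear[OF bop_bl[OF nice_bop[OF p T]]]])

text \<open>\<open>F t x\<close> is the inverse of \<open>1 + cop T\<close> applied to \<open>conv T T _ x\<close>, which is continuous in \<open>t\<close> even if
  \<open>T\<close> is not; hence \<open>F t\<close> is a linear operator for every \<open>t\<close>, not just almost everywhere.\<close>

lemma resolvent_exists:
  fixes T :: "real \<Rightarrow> 'a::complex_banach \<Rightarrow> 'a"
  assumes T: "nice p T" and J: "J * (1 + cop T) = 1" "(1 + cop T) * J = 1"
  shows "\<exists>F. nice p F \<and> (\<forall>x. continuous_on UNIV (\<lambda>t. F t x)) \<and>
    (\<forall>t x. T t x + (F t x - T t x) + conv T (\<lambda>t x. F t x - T t x) t x = 0) \<and>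
    (\<forall>t x. (F t x - T t x) + T t x + conv (\<lambda>t x. F t x - T t x) T t x = 0)"
proof -
  let ?U = "conv T T"
  have U: "nice p ?U" by (rule nice_conv[OF p T T])
  obtain D where D: "0 \<le> D" "\<And>t x. norm (?U t x) \<le> D * norm x * kern p t" using nice_bounded[OF U] by blast
  obtain K where K: "0 \<le> K" "\<And>g M t. (\<And>t. norm (apply_bcontfun g t) \<le> M * kern p t) \<Longrightarrow> norm (ev J g t) \<le> K * M * kern p t"
    using cop_inverse_decay[OF p T J] by blast
  have kle: "M * kern p t \<le> M" if "0 \<le> M" for M t
    using mult_left_mono[OF kern_le_1[of p t] that] p by simp
  define g where "g x = Bcontfun (\<lambda>t. ?U t x)" for x
  have g: "apply_bcontfun (g x) t = ?U t x" for x t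
  proof -
    have "norm (?U t x) \<le> D * norm x" for t using order_trans[OF D(2) kle, of x t] D(1) by simp
    then have "(\<lambda>t. ?U t x) \<in> bcontfun" by (rule bcontfun_normI[OF nice_conv_integrable(2)[OF T T]])
    then show ?thesis by (simp add: g_def Bcontfun_inverse)
  qed
  have Ubl: "bounded_linear (?U t)" for t by (rule bop_bl[OF nice_bop[OF p U]])
  have g_add: "g (x + y) = g x + g y" for x y
    by (rule bcontfun_eqI) (simp add: g linear_add[OF bounded_linear.linear[OF Ubl]])
  have g_scale: "g (r *\<^sub>R x) = r *\<^sub>R g x" for r x
    by (rule bcontfun_eqI) (simp add: g linear_scale[OF bounded_linear.linear[OF Ubl]])
  have g_cscale: "g (cscale c x) = eapp (Mc c) (g x)" for c x
    by (rule bcontfun_eqI) (simp add: g Mc bop_cscale[OF nice_bop[OF p U]])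
  have JM: "J * Mc c = Mc c * J" for c
  proof -
    have "(1 + cop T) * Mc c = Mc c * (1 + cop T)"
      using ti_closed(1)[OF ti_basic(1) cop_ti[OF p T]] by (simp add: ti_def)
    then have "J * ((1 + cop T) * Mc c) * J = J * (Mc c * (1 + cop T)) * J" by simp
    then have "(J * (1 + cop T)) * Mc c * J = J * Mc c * ((1 + cop T) * J)" by (simp only: mult.assoc)
    then show ?thesis by (simp add: J)
  qed
  define F where "F t x = ev J (g x) t" for t x
  have F_le: "norm (F t x) \<le> K * (D * norm x) * kern p t" for t x
    unfolding F_def by (rule K(2)) (simp add: g D(2))
  have F_cont: "continuous_on UNIV (\<lambda>t. F t x)" for x unfolding F_def by simp
  have Fbl: "bounded_linear (F t)" for t
  proof (rule bounded_linear_intro[where K = "K * D * kern p t"])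
    show "F t (x + y) = F t x + F t y" for x y by (simp add: F_def g_add eapp_add)
    show "F t (r *\<^sub>R x) = r *\<^sub>R F t x" for r x by (simp add: F_def g_scale eapp_scaleR)
    show "norm (F t x) \<le> norm x * (K * D * kern p t)" for x using F_le[of t x] by (simp add: mult_ac)
  qed
  have F: "nice p F" unfolding nice_def[OF p]
  proof (intro conjI allI)
    have "F t (cscale c x) = cscale c (F t x)" for t c x
    proof -
      have "F t (cscale c x) = ev (J * Mc c) (g x) t" by (simp add: F_def g_cscale)
      also have "\<dots> = cscale c (F t x)" by (simp add: JM Mc F_def)
      finally show ?thesis .
    qed
    then show "bop (F t)" for t using Fbl by (simp add: bop_def)
    show "\<exists>C\<ge>0. opfam F (\<lambda>s. C * kern p s)"
      using K(1) D(1) F_le Fbl by (intro exI[of _ "K * D"]) (auto simp: opfam_def mult_ac intro!: smeas_continuous F_cont)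
  qed
  have eq1: "F t x + conv T F t x = ?U t x" for t x
  proof -
    have "ev ((1 + cop T) * J) (g x) t = ?U t x" by (simp only: J eapp_simps g)
    then show ?thesis by (simp add: cop[OF p T] F_def conv_def)
  qed
  have S: "nice p (\<lambda>t x. F t x - T t x)" by (rule nice_diff[OF F T])
  have eq2: "F t x - ?U t x + conv F T t x = 0" for t x
  proof -
    have UF: "nice p (\<lambda>t x. ?U t x - F t x)" by (rule nice_diff[OF U F])
    have FT: "nice p (conv F T)" by (rule nice_conv[OF p F T])
    \<comment> \<open>\<open>J\<close> inverts left convolution by \<open>1 + T\<close>, while the
      second equation involves \<open>F * T\<close>. Its defect \<open>E\<close> satisfies
      \<open>T * E = - E\<close> by associativity and the first equation; \<open>E\<close> is
      bounded and continuous in \<open>t\<close>, so injectivity of \<open>1 + cop T\<close> forces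
      it to vanish.\<close>
    define E where "E t x = conv F T t x - (?U t x - F t x)" for t x
    have E: "nice p E" unfolding E_def[abs_def] by (rule nice_diff[OF FT UF])
    obtain B where B: "0 \<le> B" "\<And>t x. norm (E t x) \<le> B * norm x * kern p t" using nice_bounded[OF E] by blast
    have E_cont: "continuous_on UNIV (\<lambda>t. E t x)" unfolding E_def
      by (intro continuous_intros nice_conv_integrable(2) F T F_cont)
    have TF: "conv T F = (\<lambda>t x. ?U t x - F t x)" using eq1 by (intro ext) (simp add: algebra_simps)
    have "conv T E t x = conv T (conv F T) t x - (conv T ?U t x - conv T F t x)" for t
      using conv_diff(1)[OF T FT UF, of t x] conv_diff(1)[OF T U F, of t x] by (simp add: E_def[abs_def])
    also have "\<dots> t = - E t x" for t
    proof -
      have "conv T (conv F T) t x = conv ?U T t x - conv F T t x"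
        using conv_assoc[OF p T F T, of t x] conv_diff(2)[OF T U F, of t x] by (simp add: TF)
      then show ?thesis using conv_assoc[OF p T T T, of t x] by (simp add: TF E_def)
    qed
    finally have TE: "conv T E t x = - E t x" for t .
    define d where "d = Bcontfun (\<lambda>t. E t x)"
    have d: "apply_bcontfun d t = E t x" for t
    proof -
      have "norm (E t x) \<le> B * norm x" for t using order_trans[OF B(2) kle, of x t] B(1) by simp
      then have "(\<lambda>t. E t x) \<in> bcontfun" by (rule bcontfun_normI[OF E_cont])
      then show ?thesis by (simp add: d_def Bcontfun_inverse)
    qed
    have "eapp (1 + cop T) d = 0"
      by (rule bcontfun_eqI) (use TE in \<open>simp add: cop[OF p T] d conv_def\<close>)
    then have "eapp (J * (1 + cop T)) d = 0"
      using linear_0[OF bounded_linear.linear[OF bounded_linear_eapp[of J]]] by simp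
    then have "d = 0" by (simp only: J eapp_simps)
    then have "E t x = 0" using d[of t] by simp
    then show ?thesis by (simp add: E_def)
  qed
  have "T t x + (F t x - T t x) + conv T (\<lambda>t x. F t x - T t x) t x = 0" for t x
  proof -
    have "conv T F t x = ?U t x - F t x" using eq1[of t x] by (simp add: eq_diff_eq add.commute)
    then show ?thesis by (simp add: conv_diff(1)[OF T F T])
  qed
  moreover have "(F t x - T t x) + T t x + conv (\<lambda>t x. F t x - T t x) T t x = 0" for t x
    unfolding conv_diff(2)[OF T F T] using eq2[of t x] by (simp add: algebra_simps)
  ultimately show ?thesis using F F_cont by blast
qed

end

section \<open>Comparison of the weights and reduction of the theorem\<close>

lemma jbr_bounds: "0 < jbr t" "1 + \<bar>t\<bar> \<le> 2 * jbr t" "jbr t \<le> 1 + \<bar>t\<bar>"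
proof -
  show "0 < jbr t" by (simp add: jbr_def add_pos_nonneg)
  have "(1 + \<bar>t\<bar>)\<^sup>2 \<le> (2 * jbr t)\<^sup>2"
    using zero_le_power2[of "1 - \<bar>t\<bar>"] by (simp add: jbr_def power2_eq_square algebra_simps)
  then show "1 + \<bar>t\<bar> \<le> 2 * jbr t" by (rule power2_le_imp_le) (use \<open>0 < jbr t\<close> in simp)
  have "(jbr t)\<^sup>2 \<le> (1 + \<bar>t\<bar>)\<^sup>2" by (simp add: jbr_def power2_eq_square algebra_simps)
  then show "jbr t \<le> 1 + \<bar>t\<bar>" by (rule power2_le_imp_le) simp
qed

lemma jbr_powr_imp_kern:
  assumes p: "0 \<le> p" and "jbr t powr p * x \<le> C" "0 \<le> C"
  shows "x \<le> 2 powr p * C * kern p t"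
proof -
  have "x \<le> C * jbr t powr (- p)"
    using assms(2) jbr_bounds(1)[of t] by (simp add: powr_minus field_simps)
  also have "\<dots> \<le> C * (2 powr p * kern p t)"
  proof (rule mult_left_mono[OF _ assms(3)])
    have "jbr t powr (- p) \<le> ((1 + \<bar>t\<bar>) / 2) powr (- p)"
      using jbr_bounds(2)[of t] p by (intro powr_mono2') auto
    also have "\<dots> = 2 powr p * kern p t"
      unfolding kern_def by (subst powr_divide) (auto simp: powr_minus_divide)
    finally show "jbr t powr (- p) \<le> 2 powr p * kern p t" .
  qed
  finally show ?thesis by (simp add: mult_ac)
qed

lemma kern_imp_jbr_powr:
  assumes p: "0 \<le> p" and "x \<le> C * kern p t" "0 \<le> C"
  shows "jbr t powr p * x \<le> C"
proof -
  have "jbr t powr p * x \<le> jbr t powr p * (C * kern p t)" using assms(2) by (intro mult_left_mono) auto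
  also have "\<dots> \<le> (1 + \<bar>t\<bar>) powr p * (C * kern p t)"
    using jbr_bounds[of t] p assms(3) by (intro mult_right_mono powr_mono2) (auto simp: kern_nonneg)
  also have "(1 + \<bar>t\<bar>) powr p * (C * kern p t) = C" by (simp add: kern_def powr_minus)
  finally show ?thesis .
qed

theorem mainTheorem10:
  fixes T :: "real \<Rightarrow> 'a::complex_banach \<Rightarrow> 'a" and p :: real and N :: nat
  assumes p: "p > 1"
    and TW: "in_W p T"
    and N: "N \<ge> 1"
    and cont: "\<forall>\<epsilon>>0. \<exists>\<eta>>0. \<forall>\<delta>. \<bar>\<delta>\<bar> < \<eta> \<longrightarrow>
                 (AE t in lebesgue. jbr t powr p *
                    onorm (\<lambda>x. conv_power T N t x - conv_power T N (t - \<delta>) x) \<le> \<epsilon>)"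
    and inv: "\<forall>lam. invertible_bop (\<lambda>x. x + fourier T lam x)"
  shows "\<exists>S. in_W p S \<and>
           (AE t in lebesgue. \<forall>x. T t x + S t x + conv T S t x = 0) \<and>
           (AE t in lebesgue. \<forall>x. S t x + T t x + conv S T t x = 0)"
proof -
  have p0: "0 \<le> p" using p by simp
  have Tbop: "bop (T t)" for t using TW by (simp add: in_W_def)
  have Tsm: "strongly_measurable T" using TW by (simp add: in_W_def)
  obtain C0 where C0: "AE t in lebesgue. jbr t powr p * onorm (T t) \<le> C0" using TW by (auto simp: in_W_def)
  have aeD: "\<exists>N. negligible N \<and> (\<forall>t. t \<notin> N \<longrightarrow> P t)" if "AE t in lebesgue. P t" for P :: "real \<Rightarrow> bool"
    using that unfolding eventually_ae_filter by (auto simp: negligible_iff_null_sets)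
  have aeI: "AE t in lebesgue. P t" if "negligible N" "\<And>t. t \<notin> N \<Longrightarrow> P t" for P :: "real \<Rightarrow> bool" and N
    using that unfolding eventually_ae_filter by (auto simp: negligible_iff_null_sets)
  obtain Z where Z: "negligible Z" "\<And>t. t \<notin> Z \<Longrightarrow> jbr t powr p * onorm (T t) \<le> C0" using aeD[OF C0] by blast
  define C where "C = 2 powr p * max C0 0"
  have C: "0 \<le> C" by (simp add: C_def)
  \<comment> \<open>Setting \<open>T\<close> to 0 on the exceptional null set makes the decay hold
    everywhere; convolutions and the Fourier transform do not see the change.\<close>
  define T' where "T' t x = (if t \<in> Z then 0 else T t x)" for t x
  have T'_le: "norm (T' t x) \<le> C * kern p t * norm x" for t x
  proof (cases "t \<in> Z")
    case True then show ?thesis using C by (simp add: T'_def kern_nonneg)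
  next
    case False
    then have "jbr t powr p * onorm (T t) \<le> max C0 0" using Z(2) by fastforce
    from jbr_powr_imp_kern[OF p0 this] have "onorm (T t) \<le> C * kern p t" by (simp add: C_def)
    then have "norm (T t x) \<le> C * kern p t * norm x"
      using onorm[OF bop_bl[OF Tbop], of t x] mult_right_mono[of "onorm (T t)" "C * kern p t" "norm x"] by simp
    then show ?thesis using False by (simp add: T'_def)
  qed
  have T'bop: "bop (T' t)" for t
  proof -
    have "cscale c (0 :: 'a) = 0" for c
      using linear_0[OF bounded_linear.linear[OF bounded_linear_cscale]] .
    then have "bop (\<lambda>x :: 'a. 0)" by (simp add: bop_def bounded_linear_zero)
    moreover have "T' t = (if t \<in> Z then (\<lambda>x. 0) else T t)" by (auto simp: T'_def)
    ultimately show ?thesis using Tbop[of t] by simp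
  qed
  have T'sm: "smeas (\<lambda>t. T' t x)" for x
    by (rule smeas.lim[of "\<lambda>_ t. T t x" Z, OF strongly_measurable_smeas[OF Tsm] Z(1)]) (simp add: T'_def)
  have T': "nice p T'" unfolding nice_def[OF p] opfam_def
    using C T'_le T'bop T'sm by (auto simp: bop_bl)
  \<comment> \<open>At each fixed \<open>t\<close> the integrands differ only on \<open>Z\<close>
    and on its reflection, so the convolutions agree at every \<open>t\<close>, not just almost
    everywhere.\<close>
  have conv_spike: "conv A B t x = conv A' B' t x"
    if "\<And>s. s \<notin> Z \<Longrightarrow> A s = A' s" "\<And>s. s \<notin> Z \<Longrightarrow> B s = B' s" for A B A' B' :: "real \<Rightarrow> 'a \<Rightarrow> 'a" and t x
    unfolding conv_def
    by (rule integral_spike[OF negligible_Un[OF Z(1) negligible_reflect[OF Z(1), of t]]]) (use that in auto)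
  have T'T: "T' t = T t" if "t \<notin> Z" for t using that by (auto simp: T'_def)
  have power_eq: "conv_power T' n t = conv_power T n t" if "t \<notin> Z" for n t
    using that
  proof (induction n arbitrary: t)
    case (Suc n)
    show ?case
    proof (cases n)
      case 0
      then show ?thesis using T'T[OF Suc.prems] by simp
    next
      case (Suc m)
      have "conv T' (conv_power T' n) t x = conv T (conv_power T n) t x" for x
        by (rule conv_spike[OF T'T Suc.IH])
      then show ?thesis using Suc by auto
    qed
  qed simp
  have fourier_eq': "fourier T' lam x = fourier T lam x" for lam x
    unfolding fourier_def by (rule integral_spike[OF Z(1)]) (simp add: T'_def)
  define V where "V = conv_power T' N"
  have V: "nice p V" unfolding V_def by (rule nice_conv_power[OF p T']) (use N in simp)
  have modulus: "\<exists>\<eta>>0. \<forall>\<delta>. \<bar>\<delta>\<bar> < \<eta> \<longrightarrow> norm (Tr \<delta> * cop T' ^ N - cop T' ^ N) \<le> \<epsilon>" if \<epsilon>: "0 < \<epsilon>" for \<epsilon>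
  proof -
    \<comment> \<open>The factor \<open>2 powr p\<close> is lost in passing from \<open>jbr\<close>
      to \<open>kern\<close>, and \<open>kint p\<close> in integrating; the summand 1 keeps the
      denominator positive.\<close>
    define \<epsilon>' where "\<epsilon>' = \<epsilon> / (2 powr p * kint p + 1)"
    have d: "0 < 2 powr p * kint p + 1" using kint_nonneg[OF p] by (simp add: add_nonneg_pos)
    have \<epsilon>': "0 < \<epsilon>'" using \<epsilon> d by (simp add: \<epsilon>'_def)
    have "2 powr p * \<epsilon>' * kint p \<le> \<epsilon>' * (2 powr p * kint p + 1)" using \<epsilon>' by (simp add: algebra_simps)
    also have "\<dots> = \<epsilon>" using d by (simp add: \<epsilon>'_def)
    finally have le: "2 powr p * \<epsilon>' * kint p \<le> \<epsilon>" .
    obtain \<eta> where \<eta>: "\<eta> > 0" "\<And>\<delta>. \<bar>\<delta>\<bar> < \<eta> \<Longrightarrow> AE t in lebesgue. jbr t powr p *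
        onorm (\<lambda>x. conv_power T N t x - conv_power T N (t - \<delta>) x) \<le> \<epsilon>'"
      using cont \<epsilon>' by blast
    have "norm (Tr \<delta> * cop T' ^ N - cop T' ^ N) \<le> \<epsilon>" if \<delta>: "\<bar>\<delta>\<bar> < \<eta>" for \<delta>
    proof -
      obtain Y where Y: "negligible Y" "\<And>t. t \<notin> Y \<Longrightarrow> jbr t powr p *
        onorm (\<lambda>x. conv_power T N t x - conv_power T N (t - \<delta>) x) \<le> \<epsilon>'"
        using aeD[OF \<eta>(2)[OF \<delta>]] by blast
      have shift: "negligible {t. t - \<delta> \<in> Z}"
        using negligible_reflect[OF negligible_reflect[OF Z(1), of "- \<delta>"], of 0] by (simp add: algebra_simps)
      have "AE s in lebesgue. \<forall>x. norm (V s x - V (s - \<delta>) x) \<le> (2 powr p * \<epsilon>') * kern p s * norm x"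
      proof (rule aeI[of "Y \<union> (Z \<union> {t. t - \<delta> \<in> Z})"])
        show "negligible (Y \<union> (Z \<union> {t. t - \<delta> \<in> Z}))" by (intro negligible_Un Y Z shift)
        fix s assume "s \<notin> Y \<union> (Z \<union> {t. t - \<delta> \<in> Z})"
        then have s: "s \<notin> Y" "V s = conv_power T N s" "V (s - \<delta>) = conv_power T N (s - \<delta>)"
          by (auto simp: V_def power_eq)
        have "onorm (\<lambda>x. V s x - V (s - \<delta>) x) \<le> 2 powr p * \<epsilon>' * kern p s"
          using jbr_powr_imp_kern[OF p0 Y(2)[OF s(1)]] \<epsilon>' by (simp add: s)
        moreover have "bounded_linear (\<lambda>x. V s x - V (s - \<delta>) x)"
          by (intro bounded_linear_sub bop_bl[OF nice_bop[OF p V]])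
        ultimately show "\<forall>x. norm (V s x - V (s - \<delta>) x) \<le> (2 powr p * \<epsilon>') * kern p s * norm x"
          by (meson mult_right_mono norm_ge_zero onorm order_trans)
      qed
      from translation_modulus[OF p V _ this] have "norm (Tr \<delta> * cop V - cop V) \<le> 2 powr p * \<epsilon>' * kint p"
        using \<epsilon>' by simp
      then show ?thesis using le cop_power[OF p T', of N] N by (simp add: V_def)
    qed
    then show ?thesis using \<eta>(1) by blast
  qed
  have inv': "invertible_bop (\<lambda>x. x + fourier T' lam x)" for lam using inv by (simp add: fourier_eq')
  obtain J where J: "J * (1 + cop T') = 1" "(1 + cop T') * J = 1"
    using cop_inverse[OF p T' inv' modulus] by blast
  obtain F where F: "nice p F" "\<And>x. continuous_on UNIV (\<lambda>t. F t x)"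
    and eqs: "\<And>t x. T' t x + (F t x - T' t x) + conv T' (\<lambda>t x. F t x - T' t x) t x = 0"
      "\<And>t x. (F t x - T' t x) + T' t x + conv (\<lambda>t x. F t x - T' t x) T' t x = 0"
    using resolvent_exists[OF p T' J] by blast
  \<comment> \<open>Built with \<open>T\<close> rather than \<open>T'\<close>, so that the simple
    approximants of \<open>T\<close> can be subtracted pointwise; off \<open>Z\<close> the two
    choices agree.\<close>
  define S where "S t x = F t x - T t x" for t x
  have S': "nice p (\<lambda>t x. F t x - T' t x)" by (rule nice_diff[OF p F(1) T'])
  have SS: "S t = (\<lambda>x. F t x - T' t x)" if "t \<notin> Z" for t using that by (auto simp: S_def T'_def)
  have "in_W p S" unfolding in_W_def
  proof (intro conjI allI)
    show "bop (S t)" for t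
    proof -
      have "cscale c (F t x) - cscale c (T t x) = cscale c (F t x - T t x)" for c x
        by (rule linear_diff[OF bounded_linear.linear[OF bounded_linear_cscale], symmetric])
      then show ?thesis unfolding S_def bop_def
        using nice_bop[OF p F(1), of t] Tbop[of t] by (auto simp: bop_def intro: bounded_linear_sub)
    qed
    show "strongly_measurable S" unfolding strongly_measurable_def
    proof
      fix x
      obtain u where u: "\<And>i::nat. simple_function lebesgue (u i)" "\<And>t. (\<lambda>i. u i t) \<longlonglongrightarrow> F t x"
        using continuous_simple_approx[OF F(2)[of x]] by blast
      obtain v where v: "\<And>i::nat. simple_function lebesgue (v i)" "\<And>t. (\<lambda>i. v i t) \<longlonglongrightarrow> T t x"
        using Tsm unfolding strongly_measurable_def by blast
      show "\<exists>w :: nat \<Rightarrow> real \<Rightarrow> 'a. (\<forall>i. simple_function lebesgue (w i)) \<and> (\<forall>t. (\<lambda>i. w i t) \<longlonglongrightarrow> S t x)"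
        by (intro exI[of _ "\<lambda>i t. u i t - v i t"] conjI allI simple_function_compose2[OF u(1) v(1)])
          (simp add: S_def tendsto_diff u v)
    qed
    obtain D where D: "0 \<le> D" "opfam (\<lambda>t x. F t x - T' t x) (\<lambda>s. D * kern p s)" using nice_opfam[OF p S'] .
    have "AE t in lebesgue. jbr t powr p * onorm (S t) \<le> D"
    proof (rule aeI[OF Z(1)])
      fix t assume t: "t \<notin> Z"
      have "onorm (S t) \<le> D * kern p t"
        unfolding SS[OF t] using opfam_le[OF D(2), of t] D(1) by (intro onorm_bound) (auto simp: kern_nonneg)
      then show "jbr t powr p * onorm (S t) \<le> D" by (rule kern_imp_jbr_powr[OF p0 _ D(1)])
    qed
    then show "\<exists>C. AE t in lebesgue. jbr t powr p * onorm (S t) \<le> C" by blast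
  qed
  moreover have "AE t in lebesgue. \<forall>x. T t x + S t x + conv T S t x = 0"
  proof (rule aeI[OF Z(1)], rule allI)
    fix t x assume t: "t \<notin> Z"
    have "conv T S t x = conv T' (\<lambda>t x. F t x - T' t x) t x" by (rule conv_spike) (simp_all add: T'T SS)
    then show "T t x + S t x + conv T S t x = 0" using eqs(1)[of t x] t by (simp add: SS T'T)
  qed
  moreover have "AE t in lebesgue. \<forall>x. S t x + T t x + conv S T t x = 0"
  proof (rule aeI[OF Z(1)], rule allI)
    fix t x assume t: "t \<notin> Z"
    have "conv S T t x = conv (\<lambda>t x. F t x - T' t x) T' t x" by (rule conv_spike) (simp_all add: T'T SS)
    then show "S t x + T t x + conv S T t x = 0" using eqs(2)[of t x] t by (simp add: SS T'T)
  qed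
  ultimately show ?thesis by blast
qed


end
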